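(* Let $R$ be a finite commutative ring with unity given as an oracle, and let $f\in R[x]$ be a univariate polynomial given as an arithmetic circuit over $R$. Then there is a randomized algorithm, running in time polynomial in the circuit size and $\log|R|$, that tests whether $f\equiv 0$ in $R[x]$.
   Context: A ring oracle for $R$: the elements of $R$ are uniformly encoded as strings in $\{0,1\}^m$ (so $\log|R|\le m$), with designated strings encoding $0$ and $1$, and ring operations are performed by queries to the oracle. An arithmetic circuit over $R$ takes as inputs the variable and ring elements, and has addition and multiplication gates.
   Formalization: The running time is bounded by a polynomial in the circuit size and the length m of the strings encoding ring elements (log|R| ≤ m), instead of log|R|; with codes much longer than log|R|, even comparing one element with 0 takes about m steps. *)

theory Defs
  imports
    "HOL-Algebra.UnivPoly"
    "HOL-Computational_Algebra.Polynomial"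
    "HOL-Probability.Probability_Mass_Function"
begin

text \<open>
  A ring given by an oracle is modelled by identifying every ring element with the string of
  length \<open>m\<close> that encodes it, so that \<open>\<zero>\<^bsub>R\<^esub>\<close> and \<open>\<one>\<^bsub>R\<^esub>\<close> are the designated strings. Every finite
  ring with an injective encoding into strings of length \<open>m\<close> is of this form up to isomorphism.
  Fixing the type of elements once and for all is essential for uniformity: the program has to be
  chosen before the ring, and HOL cannot quantify over types inside a formula.
  The functions \<open>(\<oplus>\<^bsub>R\<^esub>)\<close> and \<open>(\<otimes>\<^bsub>R\<^esub>)\<close> are total; nothing is assumed about their values on strings
  that do not encode an element. Time bounds are stated in terms of \<open>m\<close>, the measure of \<open>log |R|\<close> in
  this model: a program needs \<open>m\<close> steps to read a single ring element.
\<close>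

definition ring_by_oracle :: "bool list ring \<Rightarrow> nat \<Rightarrow> bool" where
  "ring_by_oracle R m \<longleftrightarrow>
     cring R \<and> finite (carrier R) \<and> carrier R \<subseteq> {w. length w = m}"

lemma ring_by_oracle_card:
  assumes "ring_by_oracle R m"
  shows "log 2 (card (carrier R)) \<le> m"
proof -
  have eq: "{w :: bool list. length w = m} = {w. set w \<subseteq> UNIV \<and> length w = m}"
    by simp
  have fin: "finite {w :: bool list. length w = m}"
    unfolding eq by (rule finite_lists_length_eq) simp
  have "card {w :: bool list. length w = m} = 2 ^ m"
    unfolding eq by (subst card_lists_length_eq) simp_all
  moreover have "carrier R \<subseteq> {w. length w = m}"
    using assms by (simp add: ring_by_oracle_def)
  ultimately have le: "card (carrier R) \<le> 2 ^ m"
    using card_mono[OF fin] by metis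
  have "\<zero>\<^bsub>R\<^esub> \<in> carrier R"
    using assms by (simp add: ring_by_oracle_def cring.axioms(1) ring.ring_simprules(2))
  then have "card (carrier R) > 0"
    using assms by (auto simp: ring_by_oracle_def card_gt_0_iff)
  moreover have "real (card (carrier R)) \<le> 2 ^ m"
    using le by (metis of_nat_le_iff of_nat_numeral of_nat_power)
  ultimately show ?thesis
    by (simp add: log_le_iff powr_realpow)
qed


section \<open>Arithmetic circuits in one variable\<close>

text \<open>
  A circuit is the list of its gates in topological order, a gate being referred to by its
  position; the output gate is the last one.
\<close>

datatype 'a gate = Var | Const 'a | Plus nat nat | Times nat nat

definition circuit :: "('a, 'b) ring_scheme \<Rightarrow> 'a gate list \<Rightarrow> bool" where
  "circuit R C \<longleftrightarrow> C \<noteq> [] \<and>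
     (\<forall>k<length C. case C ! k of
        Var \<Rightarrow> True
      | Const a \<Rightarrow> a \<in> carrier R
      | Plus i j \<Rightarrow> i < k \<and> j < k
      | Times i j \<Rightarrow> i < k \<and> j < k)"

fun gate_poly :: "('a, 'b) ring_scheme \<Rightarrow> (nat \<Rightarrow> 'a) list \<Rightarrow> 'a gate \<Rightarrow> (nat \<Rightarrow> 'a)" where
  "gate_poly R ps Var = up_ring.monom (UP R) \<one>\<^bsub>R\<^esub> 1"
| "gate_poly R ps (Const a) = up_ring.monom (UP R) a 0"
| "gate_poly R ps (Plus i j) = ps ! i \<oplus>\<^bsub>UP R\<^esub> ps ! j"
| "gate_poly R ps (Times i j) = ps ! i \<otimes>\<^bsub>UP R\<^esub> ps ! j"

definition circuit_poly :: "('a, 'b) ring_scheme \<Rightarrow> 'a gate list \<Rightarrow> (nat \<Rightarrow> 'a)" where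
  "circuit_poly R C = last (foldl (\<lambda>ps g. ps @ [gate_poly R ps g]) [] C)"

abbreviation circuit_size :: "'a gate list \<Rightarrow> nat" where
  "circuit_size C \<equiv> length C"


section \<open>Randomized programs with access to a ring oracle\<close>

text \<open>
  The machine model is the language WHILE of Jones (Computability and Complexity from a
  Programming Perspective, 1997), extended by coin tosses and by queries to the ring oracle.
  Registers hold binary trees. Unlike in Jones' unit-cost measure, writing a register is charged
  with the size of the tree written, and a query also with the size of its arguments, so that
  the cost is polynomially related to the time of a probabilistic oracle Turing machine
  without any appeal to sharing of subtrees.
\<close>

datatype dtree = Leaf | Node dtree dtree

datatype expr = Null | Reg nat | Pair expr expr | Hd expr | Tl expr

datatype com =
    Assign nat expr
  | QueryAdd nat nat nat
  | QueryMult nat nat nat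
  | Toss nat
  | Seq com com
  | IfElse nat com com
  | While nat com

type_synonym state = "nat \<Rightarrow> dtree"

fun left :: "dtree \<Rightarrow> dtree" where
  "left Leaf = Leaf"
| "left (Node l r) = l"

fun right :: "dtree \<Rightarrow> dtree" where
  "right Leaf = Leaf"
| "right (Node l r) = r"

fun eval_expr :: "expr \<Rightarrow> state \<Rightarrow> dtree" where
  "eval_expr Null s = Leaf"
| "eval_expr (Reg x) s = s x"
| "eval_expr (Pair d e) s = Node (eval_expr d s) (eval_expr e s)"
| "eval_expr (Hd e) s = left (eval_expr e s)"
| "eval_expr (Tl e) s = right (eval_expr e s)"

fun tree_of_bit :: "bool \<Rightarrow> dtree" where
  "tree_of_bit False = Leaf"
| "tree_of_bit True = Node Leaf Leaf"

fun tree_of_list :: "dtree list \<Rightarrow> dtree" where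
  "tree_of_list [] = Leaf"
| "tree_of_list (t # ts) = Node t (tree_of_list ts)"

definition tree_of_string :: "bool list \<Rightarrow> dtree" where
  "tree_of_string w = tree_of_list (map tree_of_bit w)"

text \<open>Every tree can be read as a string, so queries are always defined.\<close>

fun string_of_tree :: "dtree \<Rightarrow> bool list" where
  "string_of_tree Leaf = []"
| "string_of_tree (Node t u) = (t \<noteq> Leaf) # string_of_tree u"

lemma string_of_tree_of_string [simp]: "string_of_tree (tree_of_string w) = w"
proof (induction w)
  case (Cons b w)
  then show ?case by (cases b) (simp_all add: tree_of_string_def)
qed (simp add: tree_of_string_def)

text \<open>
  \<open>exec R c (s, r) t (s', r')\<close>: started in state \<open>s\<close> with the coin sequence \<open>r\<close>, the program \<open>c\<close>
  halts after time \<open>t\<close> in state \<open>s'\<close>, and \<open>r'\<close> is the unused rest of the coin sequence.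
\<close>

inductive exec ::
    "bool list ring \<Rightarrow> com \<Rightarrow> state \<times> bool list \<Rightarrow> nat \<Rightarrow> state \<times> bool list \<Rightarrow> bool"
  for R where
  Assign: "v = eval_expr e s \<Longrightarrow> exec R (Assign x e) (s, r) (1 + size v) (s(x := v), r)"
| QueryAdd: "v = tree_of_string (string_of_tree (s y) \<oplus>\<^bsub>R\<^esub> string_of_tree (s z)) \<Longrightarrow>
    exec R (QueryAdd x y z) (s, r) (1 + size (s y) + size (s z) + size v) (s(x := v), r)"
| QueryMult: "v = tree_of_string (string_of_tree (s y) \<otimes>\<^bsub>R\<^esub> string_of_tree (s z)) \<Longrightarrow>
    exec R (QueryMult x y z) (s, r) (1 + size (s y) + size (s z) + size v) (s(x := v), r)"
| Toss: "exec R (Toss x) (s, b # r) 1 (s(x := tree_of_bit b), r)"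
| Seq: "exec R c (s, r) t (s', r') \<Longrightarrow> exec R d (s', r') u (s'', r'') \<Longrightarrow>
    exec R (Seq c d) (s, r) (t + u) (s'', r'')"
| IfTrue: "s x \<noteq> Leaf \<Longrightarrow> exec R c (s, r) t (s', r') \<Longrightarrow>
    exec R (IfElse x c d) (s, r) (1 + t) (s', r')"
| IfFalse: "s x = Leaf \<Longrightarrow> exec R d (s, r) t (s', r') \<Longrightarrow>
    exec R (IfElse x c d) (s, r) (1 + t) (s', r')"
| WhileFalse: "s x = Leaf \<Longrightarrow> exec R (While x c) (s, r) 1 (s, r)"
| WhileTrue: "s x \<noteq> Leaf \<Longrightarrow> exec R c (s, r) t (s', r') \<Longrightarrow>
    exec R (While x c) (s', r') u (s'', r'') \<Longrightarrow>
    exec R (While x c) (s, r) (1 + t + u) (s'', r'')"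

inductive_cases exec_AssignE: "exec R (Assign x e) a t b"
inductive_cases exec_QueryAddE: "exec R (QueryAdd x y z) a t b"
inductive_cases exec_QueryMultE: "exec R (QueryMult x y z) a t b"
inductive_cases exec_TossE: "exec R (Toss x) a t b"
inductive_cases exec_SeqE: "exec R (Seq c d) a t b"
inductive_cases exec_IfElseE: "exec R (IfElse x c d) a t b"
inductive_cases exec_WhileE: "exec R (While x c) a t b"

lemma exec_deterministic:
  "exec R c a t b \<Longrightarrow> exec R c a t' b' \<Longrightarrow> t' = t \<and> b' = b"
proof (induction arbitrary: t' b' rule: exec.induct)
  case (Assign v e s x r)
  then show ?case by (auto elim: exec_AssignE)
next
  case (QueryAdd v s y z x r)
  then show ?case by (auto elim: exec_QueryAddE)
next
  case (QueryMult v s y z x r)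
  then show ?case by (auto elim: exec_QueryMultE)
next
  case (Toss x s b r)
  then show ?case by (auto elim: exec_TossE)
next
  case (Seq c s r t s' r' d u s'' r'')
  from Seq.prems obtain t1 s1 r1 u1 s2 r2 where
    "exec R c (s, r) t1 (s1, r1)" "exec R d (s1, r1) u1 (s2, r2)" "t' = t1 + u1" "b' = (s2, r2)"
    by (auto elim: exec_SeqE)
  with Seq.IH(1)[of t1 "(s1, r1)"] Seq.IH(2)[of u1 "(s2, r2)"] show ?case by simp
next
  case (IfTrue s x c r t s' r' d)
  from IfTrue.prems IfTrue.hyps obtain t1 where
    "exec R c (s, r) t1 b'" "t' = 1 + t1"
    by (auto elim: exec_IfElseE)
  with IfTrue.IH[of t1 b'] show ?case by simp
next
  case (IfFalse s x d r t s' r' c)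
  from IfFalse.prems IfFalse.hyps obtain t1 where
    "exec R d (s, r) t1 b'" "t' = 1 + t1"
    by (auto elim: exec_IfElseE)
  with IfFalse.IH[of t1 b'] show ?case by simp
next
  case (WhileFalse s x c r)
  from WhileFalse.prems WhileFalse.hyps show ?case
    by (auto elim: exec_WhileE)
next
  case (WhileTrue s x c r t s' r' u s'' r'')
  from WhileTrue.prems WhileTrue.hyps obtain t1 s1 r1 u1 s2 r2 where
    "exec R c (s, r) t1 (s1, r1)" "exec R (While x c) (s1, r1) u1 (s2, r2)"
    "t' = 1 + t1 + u1" "b' = (s2, r2)"
    by (auto elim: exec_WhileE)
  with WhileTrue.IH(1)[of t1 "(s1, r1)"] WhileTrue.IH(2)[of u1 "(s2, r2)"] show ?case by simp
qed

definition initial_state :: "dtree \<Rightarrow> state" where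
  "initial_state inp = (\<lambda>x. if x = 0 then inp else Leaf)"

definition halts_within :: "bool list ring \<Rightarrow> com \<Rightarrow> dtree \<Rightarrow> nat \<Rightarrow> bool" where
  "halts_within R P inp T \<longleftrightarrow>
     (\<forall>r. length r = T \<longrightarrow>
        (\<exists>t s' r'. exec R P (initial_state inp, r) t (s', r') \<and> t \<le> T))"

text \<open>
  A run accepts if it halts with register 0 distinct from \<open>Leaf\<close>. Every toss takes one time unit,
  so a program that halts within time \<open>T\<close> never needs more than \<open>T\<close> coins.
\<close>

definition accept_prob :: "bool list ring \<Rightarrow> com \<Rightarrow> dtree \<Rightarrow> nat \<Rightarrow> real" where
  "accept_prob R P inp T =
     measure_pmf.prob (pmf_of_set {r :: bool list. length r = T})
       {r. \<exists>t s' r'. exec R P (initial_state inp, r) t (s', r') \<and> s' 0 \<noteq> Leaf}"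


section \<open>Encoding of the input\<close>

definition tree_of_nat :: "nat \<Rightarrow> dtree" where
  "tree_of_nat n = tree_of_list (replicate n Leaf)"

fun tree_of_gate :: "bool list gate \<Rightarrow> dtree" where
  "tree_of_gate Var = tree_of_list [tree_of_nat 0]"
| "tree_of_gate (Const a) = tree_of_list [tree_of_nat 1, tree_of_string a]"
| "tree_of_gate (Plus i j) = tree_of_list [tree_of_nat 2, tree_of_nat i, tree_of_nat j]"
| "tree_of_gate (Times i j) = tree_of_list [tree_of_nat 3, tree_of_nat i, tree_of_nat j]"

text \<open>
  Gate positions are written in unary; as they are below the size of the circuit, the input has
  size polynomial in that size and \<open>m\<close>.
\<close>

definition input_tree :: "bool list ring \<Rightarrow> bool list gate list \<Rightarrow> dtree" where
  "input_tree R C =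
     tree_of_list
       [tree_of_string \<zero>\<^bsub>R\<^esub>, tree_of_string \<one>\<^bsub>R\<^esub>, tree_of_list (map tree_of_gate C)]"

end

(*
  With s gates and ring elements of length m, the circuit computes a polynomial f of degree at most
  2^s. The program tosses w = s + m + 2 coins, takes them as the coefficients of a polynomial a(y)
  and evaluates the circuit at y^(r - w) a(y) in R[y]/(y^r - 1) for all r from w to w + w^4 - 1; it
  accepts if all results vanish. Elements of R[y]/(y^r - 1) are lists of r ring elements, multiplied
  by cyclic convolution, so no subtraction is needed.

  If f is nonzero, take an additive subgroup M of R that is maximal among those not containing all
  coefficients of f. Modulo M the coefficients of f are multiples u_n v of one element v whose order
  modulo M is a prime p <= 2^m. Hence f(a) = 0 in R[y]/(y^r - 1) implies F(a) = 0 in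
  F_p[y]/(y^r - 1) for F = sum u_n x^n, which is nonzero modulo p. Since lcm(1, ..., 2b + 1) >= 4^b,
  some prime power r = l^j <= 2w^3 + 1 with l distinct from p divides none of p^i - 1, 0 < i < w. In
  the residue field of a maximal ideal of Z[y] containing p and (y^r - 1)/(y^(r/l) - 1), y then has
  order r and degree at least w over F_p. So the 2^w points y^(r - w) a(y) are distinct in that field
  and at most 2^s of them are roots of F.
*)

theory Submission
  imports
    Defs
    "HOL-Algebra.Generated_Groups"
    "HOL-Algebra.Multiplicative_Group"
    "HOL-Computational_Algebra.Computational_Algebra"
begin

text \<open>Two obstacles shape the construction: the degree may exceed |R|, so a non-zero f can
  vanish on all of R; and the oracle offers no way to sample elements of R, to invert them or to
  find a residue field. Hence the points use only 0 and 1 as coefficients. They are images of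
  integer polynomials, so the coefficients of f(a) are integer combinations of those of f. This is
  why a subgroup M of the additive group suffices, although reduction modulo M does not respect
  products of elements of R. The program does not know p and cannot choose r; it tries all r with
  the same coins, and one good r is enough because the zero polynomial is never rejected. The factor
  y^(r - w) arises because r is raised by prepending a zero to the point; y is a unit, so points
  stay distinct. Sizes: the product of the p^i - 1 with 0 < i < w is at most 2^(m w^2) \<le> 2^b for
  b = w^3, while a common multiple of 1, ..., 2b + 1 is at least 4^b and its relevant power of p is
  at most 2b + 1. The two extra coins in w push the error 2^s / 2^w down to 1/4.\<close>

section \<open>Prime powers of large order\<close>

text \<open>Leibniz's harmonic triangle with entries 1 / ((n + 1) C(n, k)): each entry is the one
  above it to the left minus its left neighbour, so by induction on the column every entry is an
  integer combination of 1, 1/2, ..., 1/(n + 1).\<close>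

lemma binomial_Ints:
  fixes L :: nat
  assumes "k \<le> n" "\<forall>i\<in>{1..n+1}. i dvd L"
  shows "real L / (real (n + 1) * real (n choose k)) \<in> \<int>"
  using assms
proof (induction k arbitrary: n)
  case 0
  then have "n + 1 dvd L" by simp
  then obtain q where "L = (n + 1) * q" by (elim dvdE)
  then have "real L / (real (n + 1) * real (n choose 0)) = real q" by (simp add: field_simps)
  then show ?case by (metis Ints_of_nat)
next
  case (Suc k)
  then obtain n' where n: "n = Suc n'" and kn: "k \<le> n'" by (cases n) auto
  define c where "c = real (n' choose k)"
  have c: "c > 0" using kn by (simp add: c_def)
  have "Suc k * (n choose Suc k) = Suc n' * (n' choose k)"
    unfolding n by (rule Suc_times_binomial)
  then have 1: "real (n choose Suc k) = real n * c / real (Suc k)"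
    unfolding c_def n by (metis nonzero_mult_div_cancel_left of_nat_eq_0_iff of_nat_mult old.nat.distinct(2))
  have "(n - k) * (n choose k) = n * (n' choose k)"
    using binomial_absorb_comp[of n k] n by simp
  then have "real (n - k) * real (n choose k) = real n * c"
    unfolding c_def by (metis of_nat_mult)
  moreover have nk: "real (n - k) = real n - real k" "real n - real k > 0" using n kn by auto
  ultimately have 2: "real (n choose k) = real n * c / (real n - real k)"
    by (simp add: field_simps)
  have np: "real n > 0" using n by simp
  have "real L / (real (n + 1) * real (n choose Suc k))
      = real L / (real (n' + 1) * real (n' choose k)) - real L / (real (n + 1) * real (n choose k))"
    unfolding 1 2 c_def[symmetric] using np nk c
    by (simp add: n divide_simps) (simp add: algebra_simps)
  moreover have "real L / (real (n' + 1) * real (n' choose k)) \<in> \<int>"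
    using Suc.IH[of n'] kn Suc.prems n by simp
  moreover have "real L / (real (n + 1) * real (n choose k)) \<in> \<int>"
    using Suc.IH[of n] kn Suc.prems n by simp
  ultimately show ?case by simp
qed

text \<open>Nair's argument: for n = 2b and k = b the quotient of L by (2b + 1) C(2b, b) is a
  positive integer, and central binomial coefficients are at least 4^b / (2b).\<close>

lemma four_power_le_common_multiple:
  fixes L :: nat
  assumes "\<forall>i\<in>{1..2 * b + 1}. i dvd L" "L > 0"
  shows "4 ^ b \<le> L"
proof -
  define d where "d = (2 * b + 1) * ((2 * b) choose b)"
  have "real L / real d \<in> \<int>"
    using binomial_Ints[of b "2 * b" L] assms unfolding d_def of_nat_mult by simp
  moreover have d: "d > 0" by (simp add: d_def)
  then have "real L / real d > 0" using assms by simp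
  ultimately have "real L / real d \<ge> 1"
    by (auto elim!: Ints_cases)
  then have "d \<le> L" using d by (simp add: field_simps)
  moreover have "4 ^ b \<le> d"
  proof (cases "b = 0")
    case False
    then have "4 ^ b / (2 * real b) \<le> real ((2 * b) choose b)"
      by (intro central_binomial_lower_bound) simp
    then have "4 ^ b \<le> 2 * real b * real ((2 * b) choose b)"
      using False by (simp add: field_simps)
    also have "\<dots> \<le> real d" by (simp add: d_def algebra_simps)
    finally have "real (4 ^ b) \<le> real d" by simp
    then show ?thesis by linarith
  qed (simp add: d_def)
  ultimately show ?thesis by simp
qed

text \<open>Otherwise N times the largest power of p not exceeding 2b + 1 would be a common multiple
  of 1, ..., 2b + 1 and so at least 4^b. Excluding the prime p thus costs a single factor of at most
  2b + 1.\<close>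

lemma exists_prime_power_not_dvd:
  fixes p N b :: nat
  assumes p: "prime p" and N: "N > 0" and less: "(2 * b + 1) * N < 4 ^ b"
  shows "\<exists>l j. prime l \<and> l \<noteq> p \<and> j \<ge> 1 \<and> l ^ j \<le> 2 * b + 1 \<and> \<not> l ^ j dvd N"
proof (rule ccontr)
  assume "\<not> ?thesis"
  then have *: "l ^ j dvd N" if "prime l" "l \<noteq> p" "j \<ge> 1" "l ^ j \<le> 2 * b + 1" for l j
    using that by blast
  define A where "A = {i. p ^ i \<le> 2 * b + 1}"
  have "i < p ^ i" for i
    using prime_gt_1_nat[OF p] by (intro power_gt_expt) simp
  then have "A \<subseteq> {..2 * b + 1}" unfolding A_def
    by (auto intro: order.trans less_imp_le)
  then have finA: "finite A" by (rule finite_subset) simp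
  have "0 \<in> A" by (simp add: A_def)
  define a where "a = Max A"
  have aA: "a \<in> A" unfolding a_def using finA \<open>0 \<in> A\<close> by (intro Max_in) auto
  have "4 ^ b \<le> p ^ a * N"
  proof (rule four_power_le_common_multiple)
    show "\<forall>i\<in>{1..2 * b + 1}. i dvd p ^ a * N"
    proof
      fix i assume i: "i \<in> {1..2 * b + 1}"
      show "i dvd p ^ a * N"
      proof (rule multiplicity_le_imp_dvd)
        fix l :: nat assume l: "prime l"
        let ?j = "multiplicity l i"
        have "l ^ ?j dvd i" by (rule multiplicity_dvd)
        then have le: "l ^ ?j \<le> 2 * b + 1" using i by (auto dest!: dvd_imp_le)
        have "l ^ ?j dvd p ^ a * N"
        proof (cases "l = p")
          case True
          with le have "?j \<in> A" by (simp add: A_def)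
          then have "?j \<le> a" unfolding a_def using finA by simp
          then have "l ^ ?j dvd p ^ a" using True by (simp add: le_imp_power_dvd)
          then show ?thesis by simp
        next
          case False
          then have "l ^ ?j dvd N" using *[OF l False, of ?j] le by (cases "?j = 0") auto
          then show ?thesis by simp
        qed
        moreover have "p ^ a * N \<noteq> 0" using p N by (auto simp: prime_gt_0_nat)
        ultimately show "?j \<le> multiplicity l (p ^ a * N)"
          using not_prime_unit l by (intro multiplicity_geI) auto
      qed (use i in auto)
    qed
  qed (use p N in \<open>auto simp: prime_gt_0_nat\<close>)
  also have "\<dots> \<le> (2 * b + 1) * N" using aA by (intro mult_right_mono) (auto simp: A_def)
  finally show False using less by simp
qed

text \<open>The product N of all p^i - 1 collects the divisibilities to be avoided in one number.
  Its factors are at most 2^(m k) and there are fewer than k of them when k > 0, so N \<le>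
  2^b.\<close>

lemma exists_prime_power_large_order:
  fixes p m k b :: nat
  assumes p: "prime p" "p \<le> 2 ^ m" and b: "m * k * k \<le> b" "b \<ge> 3"
  shows "\<exists>l j. prime l \<and> l \<noteq> p \<and> j \<ge> 1 \<and> l ^ j \<le> 2 * b + 1 \<and>
    (\<forall>i\<in>{1..<k}. \<not> l ^ j dvd p ^ i - 1)"
proof -
  define N where "N = (\<Prod>i\<in>{1..<k}. p ^ i - 1)"
  have p1: "p > 1" using prime_gt_1_nat[OF p(1)] .
  have N0: "N > 0" unfolding N_def
  proof (rule prod_pos)
    fix i assume "i \<in> {1..<k}"
    then have "1 < p ^ i" using p1 by (intro one_less_power) auto
    then show "0 < p ^ i - 1" by simp
  qed
  have "N \<le> (\<Prod>i\<in>{1..<k}. 2 ^ (m * k))"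
    unfolding N_def
  proof (rule prod_mono, intro conjI)
    fix i assume i: "i \<in> {1..<k}"
    have "p ^ i \<le> (2 ^ m) ^ i" using p(2) by (rule power_mono) simp
    also have "\<dots> = 2 ^ (m * i)" by (simp add: power_mult)
    also have "\<dots> \<le> 2 ^ (m * k)" using i by (intro power_increasing mult_left_mono) auto
    finally show "p ^ i - 1 \<le> 2 ^ (m * k)" by simp
  qed simp
  also have "\<dots> = 2 ^ (m * k * (k - 1))" by (simp add: power_mult)
  also have "\<dots> \<le> 2 ^ b" using b order.trans[OF mult_le_mono2[of "k - 1" k "m * k"] b(1)]
    by (intro power_increasing) auto
  finally have "N \<le> 2 ^ b" .
  \<comment> \<open>The origin of the assumption \<open>b \<ge> 3\<close>: this is the least b for
    which the inequality holds.\<close>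
  moreover have "2 * b + 1 < 2 ^ b" using b(2)
    by (induction b rule: dec_induct) auto
  ultimately have "(2 * b + 1) * N < 2 ^ b * 2 ^ b"
    using N0 by (intro mult_less_le_imp_less) auto
  also have "\<dots> = 4 ^ b" by (simp flip: power_mult_distrib)
  finally obtain l j where lj: "prime l" "l \<noteq> p" "j \<ge> 1" "l ^ j \<le> 2 * b + 1" "\<not> l ^ j dvd N"
    using exists_prime_power_not_dvd[OF p(1) N0] by blast
  have "\<not> l ^ j dvd p ^ i - 1" if "i \<in> {1..<k}" for i
  proof
    assume "l ^ j dvd p ^ i - 1"
    moreover have "p ^ i - 1 dvd N" unfolding N_def using that by (intro dvd_prodI) auto
    ultimately show False using lj(5) dvd_trans by blast
  qed
  with lj show ?thesis by blast
qed

section \<open>Residue fields of the integer polynomials\<close>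

text \<open>Residue rings of \<open>int poly\<close> are handled through representatives:
  \<open>a - b \<in> I\<close> expresses equality of residues, and no quotient is formed.\<close>

definition ring_ideal :: "'a :: comm_ring_1 set \<Rightarrow> bool" where
  "ring_ideal I \<longleftrightarrow> 0 \<in> I \<and> (\<forall>a\<in>I. \<forall>b\<in>I. a + b \<in> I) \<and> (\<forall>a\<in>I. \<forall>c. c * a \<in> I)"

definition prime_ideal :: "'a :: comm_ring_1 set \<Rightarrow> bool" where
  "prime_ideal I \<longleftrightarrow> ring_ideal I \<and> 1 \<notin> I \<and> (\<forall>a b. a * b \<in> I \<longrightarrow> a \<in> I \<or> b \<in> I)"

lemma ring_idealD:
  assumes "ring_ideal I"
  shows "0 \<in> I" "a \<in> I \<Longrightarrow> b \<in> I \<Longrightarrow> a + b \<in> I" "a \<in> I \<Longrightarrow> c * a \<in> I" "a \<in> I \<Longrightarrow> a * c \<in> I"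
    "a \<in> I \<Longrightarrow> - a \<in> I" "a \<in> I \<Longrightarrow> b \<in> I \<Longrightarrow> a - b \<in> I"
proof -
  note I = assms[unfolded ring_ideal_def]
  show "0 \<in> I" "a \<in> I \<Longrightarrow> b \<in> I \<Longrightarrow> a + b \<in> I" "a \<in> I \<Longrightarrow> c * a \<in> I" using I by auto
  then show "a \<in> I \<Longrightarrow> a * c \<in> I" by (metis I mult.commute)
  have neg: "a \<in> I \<Longrightarrow> - a \<in> I" for a using I by (metis mult_minus1)
  then show "a \<in> I \<Longrightarrow> - a \<in> I" .
  show "a \<in> I \<Longrightarrow> b \<in> I \<Longrightarrow> a - b \<in> I" using I neg by (metis uminus_add_conv_diff add.commute)
qed

lemma ring_ideal_sum:
  assumes "ring_ideal I" "\<And>i. i \<in> A \<Longrightarrow> g i \<in> I"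
  shows "sum g A \<in> I"
  using assms(2) by (induction A rule: infinite_finite_induct) (auto intro: ring_idealD[OF assms(1)])

lemma ring_ideal_prod_cong:
  assumes "ring_ideal I" "\<And>i. i \<in> A \<Longrightarrow> g i - h i \<in> I"
  shows "prod g A - prod h A \<in> I"
  using assms(2)
proof (induction A rule: infinite_finite_induct)
  case (insert x F)
  have "prod g (insert x F) - prod h (insert x F)
    = (g x - h x) * prod g F + h x * (prod g F - prod h F)"
    using insert by (simp add: algebra_simps)
  also have "\<dots> \<in> I"
    using insert by (intro ring_idealD(2)[OF assms(1)] ring_idealD(3)[OF assms(1)] ring_idealD(4)[OF assms(1)]) auto
  finally show ?case .
qed (auto intro: ring_idealD[OF assms(1)])

lemma prime_ideal_prod:
  assumes "prime_ideal I" "prod g A \<in> I"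
  shows "\<exists>i\<in>A. g i \<in> I"
  using assms(2)
  by (induction A rule: infinite_finite_induct) (use assms(1) in \<open>auto simp: prime_ideal_def\<close>)

lemma ideal_sum_generated:
  fixes I :: "'a :: comm_ring_1 set"
  assumes "ring_ideal I"
  shows "ring_ideal {i + c * a |i c. i \<in> I}"
  unfolding ring_ideal_def
proof (intro conjI ballI allI)
  show "0 \<in> {i + c * a |i c. i \<in> I}"
    using ring_idealD(1)[OF assms] by (metis (mono_tags, lifting) add_0 mem_Collect_eq mult_zero_left)
next
  fix x y assume "x \<in> {i + c * a |i c. i \<in> I}" "y \<in> {i + c * a |i c. i \<in> I}"
  then obtain i c i' c' where "x = i + c * a" "y = i' + c' * a" "i \<in> I" "i' \<in> I" by blast
  then have "x + y = (i + i') + (c + c') * a" "i + i' \<in> I"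
    using ring_idealD(2)[OF assms] by (auto simp: algebra_simps)
  then show "x + y \<in> {i + c * a |i c. i \<in> I}" by blast
next
  fix x d assume "x \<in> {i + c * a |i c. i \<in> I}"
  then obtain i c where "x = i + c * a" "i \<in> I" by blast
  then have "d * x = d * i + (d * c) * a" "d * i \<in> I"
    using ring_idealD(3)[OF assms, of i d] by (auto simp: algebra_simps)
  then show "d * x \<in> {i + c * a |i c. i \<in> I}" by blast
qed

text \<open>Zorn's lemma gives a maximal proper ideal I. It is prime: for a outside I, the ideal
  generated by I and a contains 1, and multiplying 1 = i + c a by b shows that b lies in I whenever
  a b does.\<close>

lemma exists_prime_ideal_above:
  fixes I\<^sub>0 :: "'a :: comm_ring_1 set"
  assumes "ring_ideal I\<^sub>0" "1 \<notin> I\<^sub>0"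
  shows "\<exists>I. prime_ideal I \<and> I\<^sub>0 \<subseteq> I"
proof -
  define \<A> where "\<A> = {I. ring_ideal I \<and> 1 \<notin> I \<and> I\<^sub>0 \<subseteq> I}"
  have ne: "\<A> \<noteq> {}" using assms by (auto simp: \<A>_def)
  have "\<Union>\<C> \<in> \<A>" if C: "\<C> \<noteq> {}" "subset.chain \<A> \<C>" for \<C>
  proof -
    have CA: "\<C> \<subseteq> \<A>" using C by (simp add: subset_chain_def)
    have tot: "X \<subseteq> Y \<or> Y \<subseteq> X" if "X \<in> \<C>" "Y \<in> \<C>" for X Y
      using C that by (auto simp: subset_chain_def)
    obtain X where "X \<in> \<C>" using C by blast
    have "a + b \<in> \<Union>\<C>" if ab: "a \<in> \<Union>\<C>" "b \<in> \<Union>\<C>" for a b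
    proof -
      obtain X Y where "X \<in> \<C>" "Y \<in> \<C>" "a \<in> X" "b \<in> Y" using ab by blast
      then obtain Z where Z: "Z \<in> \<C>" "a \<in> Z" "b \<in> Z" using tot by blast
      then have "a + b \<in> Z" using CA by (auto simp: \<A>_def intro: ring_idealD)
      then show ?thesis using Z by blast
    qed
    moreover have "0 \<in> \<Union>\<C>" "1 \<notin> \<Union>\<C>" "I\<^sub>0 \<subseteq> \<Union>\<C>" "\<And>a c. a \<in> \<Union>\<C> \<Longrightarrow> c * a \<in> \<Union>\<C>"
      using CA \<open>X \<in> \<C>\<close> unfolding \<A>_def ring_ideal_def by blast+
    ultimately show ?thesis by (simp add: \<A>_def ring_ideal_def)
  qed
  with subset_Zorn_nonempty[OF ne] obtain I
    where I: "I \<in> \<A>" and max: "\<And>X. X \<in> \<A> \<Longrightarrow> I \<subseteq> X \<Longrightarrow> X = I" by metis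
  have id: "ring_ideal I" and I1: "1 \<notin> I" using I by (auto simp: \<A>_def)
  have "b \<in> I" if ab: "a * b \<in> I" "a \<notin> I" for a b
  proof -
    define J where "J = {i + c * a |i c. i \<in> I}"
    have J: "ring_ideal J" unfolding J_def by (rule ideal_sum_generated[OF id])
    have IJ: "I \<subseteq> J" 
    proof
      fix i assume "i \<in> I"
      moreover have "i = i + 0 * a" by simp
      ultimately show "i \<in> J" unfolding J_def by blast
    qed
    have "a = 0 + 1 * a" by simp
    then have "a \<in> J" unfolding J_def using ring_idealD(1)[OF id] by blast
    then have "J \<noteq> I" using ab by blast
    then have "J \<notin> \<A>" using max IJ by blast
    then have "1 \<in> J" using J IJ I by (auto simp: \<A>_def)
    then obtain i c where ic: "1 = i + c * a" "i \<in> I" unfolding J_def by blast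
    have "b = (i + c * a) * b" by (simp flip: ic(1))
    also have "\<dots> = i * b + c * (a * b)" by (simp add: algebra_simps)
    also have "\<dots> \<in> I" using ring_idealD(2)[OF id ring_idealD(4)[OF id ic(2)] ring_idealD(3)[OF id ab(1)]] .
    finally show ?thesis .
  qed
  then have "prime_ideal I" using id I1 by (auto simp: prime_ideal_def)
  then show ?thesis using I by (auto simp: \<A>_def)
qed

text \<open>Lagrange's bound in the domain of residues, carried out on representatives. Synthetic
  division by x - a takes place in the ring itself and leaves a remainder in I rather than zero. One
  coefficient outside I witnesses that F is non-zero modulo I, while d bounds the degree before
  reduction.\<close>

lemma card_roots_mod_prime_ideal:
  fixes F :: "'a :: comm_ring_1 poly"
  assumes I: "prime_ideal I"
    and "coeff F n \<notin> I" "degree F \<le> d"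
    and "finite A" "\<And>a. a \<in> A \<Longrightarrow> poly F a \<in> I"
    and "\<And>a b. a \<in> A \<Longrightarrow> b \<in> A \<Longrightarrow> a - b \<in> I \<Longrightarrow> a = b"
  shows "card A \<le> d"
  using assms(2-)
proof (induction d arbitrary: F A n)
  have id: "ring_ideal I" using I by (simp add: prime_ideal_def)
  case 0
  then obtain c where F: "F = [:c:]" by (auto elim: degree_eq_zeroE)
  have "c \<notin> I"
    using 0(1) ring_idealD(1)[OF id] unfolding F by (cases n) (auto simp: coeff_pCons)
  then have "A = {}" using 0(4) by (auto simp: F)
  then show ?case by simp
next
  case (Suc d)
  have id: "ring_ideal I" using I by (simp add: prime_ideal_def)
  show ?case
  proof (cases "A = {}")
    case False
    then obtain a where a: "a \<in> A" by blast
    define q where "q = synthetic_div F a"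
    have F: "F = [:- a, 1:] * q + [:poly F a:]"
      using synthetic_div_correct'[of a F] by (simp add: q_def)
    have Fa: "poly F a \<in> I" using Suc a by blast
    \<comment> \<open>Each coefficient of F is a combination of two coefficients of \<open>q\<close>
      and, for the constant term, of \<open>poly F a\<close>; if all of those were in I, so would be
      every coefficient of F.\<close>
    have "\<exists>n. coeff q n \<notin> I"
    proof (rule ccontr)
      assume "\<nexists>n. coeff q n \<notin> I"
      then have q: "coeff q n \<in> I" for n by blast
      have "coeff F n = - a * coeff q n + (case n of 0 \<Rightarrow> poly F a | Suc i \<Rightarrow> coeff q i)"
        by (subst F) (simp add: coeff_pCons split: nat.split)
      also have "\<dots> \<in> I"
        using q Fa by (intro ring_idealD(2,3)[OF id]) (auto split: nat.split)
      finally show False using Suc.prems by simp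
    qed
    then obtain n' where n': "coeff q n' \<notin> I" by blast
    have "card (A - {a}) \<le> d"
    proof (rule Suc.IH[OF n'])
      show "degree q \<le> d" using Suc.prems(2) by (simp add: q_def degree_synthetic_div)
      fix b assume b: "b \<in> A - {a}"
      have "poly F b = (b - a) * poly q b + poly F a"
        by (subst F) (simp add: algebra_simps)
      moreover have "poly F b \<in> I" using Suc.prems b by blast
      ultimately have "(b - a) * poly q b \<in> I"
        using ring_idealD(6)[OF id _ Fa, of "poly F b"] by simp
      moreover have "b - a \<notin> I" using Suc.prems(5)[of b a] a b by blast
      ultimately show "poly q b \<in> I" using I by (auto simp: prime_ideal_def)
    qed (use Suc.prems in auto)
    then show ?thesis using a Suc.prems by (simp add: card_Diff_singleton)
  qed simp
qed

lemma poly_mod_decomp: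
  fixes g :: "int poly"
  assumes "p > 0"
  defines "g' \<equiv> map_poly (\<lambda>c. c mod p) g"
  shows "\<exists>q. g = g' + [:p:] * q" "coeff g' i \<in> {0..<p}" "degree g' \<le> degree g"
proof -
  have "g = g' + [:p:] * map_poly (\<lambda>c. c div p) g"
    unfolding g'_def by (rule poly_eqI) (simp add: coeff_map_poly)
  then show "\<exists>q. g = g' + [:p:] * q" by blast
  show "coeff g' i \<in> {0..<p}" using assms(1) by (simp add: g'_def coeff_map_poly)
  show "degree g' \<le> degree g" unfolding g'_def
    by (intro degree_le) (simp add: coeff_map_poly coeff_eq_0)
qed

text \<open>These polynomials serve below as the elements of a field with p^e elements.\<close>

lemma card_polys_bounded_coeffs:
  fixes p :: int
  assumes "e > 0"
  shows "finite {g :: int poly. degree g < e \<and> (\<forall>i. coeff g i \<in> {0..<p})}"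
    "p > 0 \<Longrightarrow> card {g :: int poly. degree g < e \<and> (\<forall>i. coeff g i \<in> {0..<p})} = nat p ^ e"
proof -
  define T where "T = {g :: int poly. degree g < e \<and> (\<forall>i. coeff g i \<in> {0..<p})}"
  define X where "X = {xs. set xs \<subseteq> {0..<p} \<and> length xs = e}"
  have inj: "inj_on Poly X"
  proof (rule inj_onI)
    fix xs ys assume *: "xs \<in> X" "ys \<in> X" "Poly xs = Poly ys"
    show "xs = ys"
    proof (rule nth_equalityI)
      show "length xs = length ys" using * by (simp add: X_def)
      fix i assume "i < length xs"
      moreover have "coeff (Poly xs) i = coeff (Poly ys) i" using * by simp
      ultimately show "xs ! i = ys ! i" using *(1,2) by (simp add: X_def nth_default_def)
    qed
  qed
  have sub: "T \<subseteq> Poly ` X"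
  proof
    fix g assume g: "g \<in> T"
    have "g = Poly (map (coeff g) [0..<e])"
      using g by (intro poly_eqI) (auto simp: T_def nth_default_def coeff_eq_0)
    moreover have "map (coeff g) [0..<e] \<in> X" using g by (auto simp: X_def T_def)
    ultimately show "g \<in> Poly ` X" by blast
  qed
  have sup: "Poly ` X \<subseteq> T" if "p > 0"
  proof
    fix g assume "g \<in> Poly ` X"
    then obtain xs where xs: "xs \<in> X" "g = Poly xs" by blast
    have "coeff g i \<in> {0..<p}" for i
      using xs that by (auto simp: X_def nth_default_def dest!: subsetD[OF _ nth_mem])
    moreover have "degree g < e"
    proof -
      have "coeff g i = 0" if "i > e - 1" for i
        using xs that by (auto simp: X_def nth_default_def)
      then have "degree g \<le> e - 1" by (intro degree_le) auto
      then show ?thesis using assms by simp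
    qed
    ultimately show "g \<in> T" by (simp add: T_def)
  qed
  have finX: "finite X" unfolding X_def by (rule finite_lists_length_eq) simp
  then show "finite T" using sub by (rule finite_surj)
  have "card X = nat p ^ e" unfolding X_def by (subst card_lists_length_eq) auto
  then show "card T = nat p ^ e" if "p > 0"
    using sub sup[OF that] card_image[OF inj] by (metis subset_antisym)
qed

lemma coeff_mult_monic_lead:
  fixes Q :: "'a :: comm_ring_1 poly"
  assumes "lead_coeff Q = 1"
  shows "coeff (Q * b) (degree Q + degree b) = lead_coeff b"
  using assms by (simp add: coeff_mult_degree_sum)

text \<open>
  A maximal ideal above \<open>p\<close> and \<open>(y ^ l ^ j - 1) / (y ^ l ^ (j - 1) - 1)\<close>: in the quotient field,
  which has \<open>p ^ e\<close> elements, \<open>y\<close> has order exactly \<open>l ^ j\<close>.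
\<close>

lemma exists_prime_ideal_cyclotomic:
  fixes p l j k :: nat
  assumes p: "prime p" and l: "prime l" "l \<noteq> p" and j: "j \<ge> 1"
    and ord: "\<forall>i\<in>{1..<k}. \<not> l ^ j dvd p ^ i - 1"
  shows "\<exists>I :: int poly set. prime_ideal I \<and> [:int p:] \<in> I \<and> monom 1 (l ^ j) - 1 \<in> I \<and>
    (\<forall>g\<in>I. degree g < k \<longrightarrow> (\<forall>i. int p dvd coeff g i))"
proof -
  define q where "q = l ^ (j - 1)"
  \<comment> \<open>The cyclotomic polynomial of index l^j, in the form (y^(q l) - 1) / (y^q -
    1).\<close>
  define Q :: "int poly" where "Q = (\<Sum>i<l. monom 1 (q * i))"
  have lj: "l ^ j = q * l" using j by (simp add: q_def power_eq_if)
  have l1: "l > 1" using l prime_gt_1_nat by blast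
  have p1: "p > 1" using p prime_gt_1_nat by blast
  have q0: "q > 0" using l1 by (simp add: q_def)
  have monom_pow: "monom (1::int) (a * b) = monom 1 a ^ b" for a b
    by (simp add: monom_power)
  have geom: "(monom 1 q - 1) * Q = monom 1 (l ^ j) - 1"
    unfolding lj Q_def monom_pow using power_diff_1_eq[of "monom 1 q :: int poly" l] by simp
  have coeffQ: "coeff Q n = (if \<exists>i<l. n = q * i then 1 else 0)" for n
  proof -
    have "coeff Q n = (\<Sum>i<l. if q * i = n then 1 else 0)" by (simp add: Q_def coeff_sum)
    also have "\<dots> = (\<Sum>i\<in>{i. i < l \<and> q * i = n}. 1)"
      by (subst sum.inter_filter[symmetric]) auto
    also have "\<dots> = (if \<exists>i<l. n = q * i then 1 else 0)"
    proof (cases "\<exists>i<l. n = q * i")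
      case True
      then obtain i where i: "i < l" "n = q * i" by blast
      then have "{i. i < l \<and> q * i = n} = {i}" using q0 by auto
      then show ?thesis using True by simp
    next
      case False
      then have "{i. i < l \<and> q * i = n} = {}" by auto
      then show ?thesis using False by (simp only: sum.empty if_False)
    qed
    finally show ?thesis .
  qed
  have degQ: "degree Q = q * (l - 1)"
  proof (rule antisym)
    show "degree Q \<le> q * (l - 1)"
      using l1 by (intro degree_le) (auto simp: coeffQ)
    show "q * (l - 1) \<le> degree Q"
      using l1 by (intro le_degree) (auto simp: coeffQ intro!: exI[of _ "l - 1"])
  qed
  have Qmonic: "lead_coeff Q = 1" using l1 by (auto simp: degQ coeffQ intro!: exI[of _ "l - 1"])
  have degQ0: "degree Q > 0" using l1 q0 by (simp add: degQ)

  \<comment> \<open>The ideal generated by p and Q: one generator after the other is adjoined to the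
    zero ideal.\<close>
  define I\<^sub>0 where "I\<^sub>0 = {i + c * Q |i c. i \<in> {i + c * [:int p:] |i c. i \<in> {0}}}"
  have "ring_ideal {0 :: int poly}" by (simp add: ring_ideal_def)
  then have I0: "ring_ideal I\<^sub>0" unfolding I\<^sub>0_def by (intro ideal_sum_generated)
  \<comment> \<open>Modulo p, 1 would be a multiple b' Q. As Q is monic of positive degree, the
    leading coefficient of a non-zero b' survives in the product above degree 0, so p would divide
    it although it lies strictly between 0 and p.\<close>
  have "1 \<notin> I\<^sub>0"
  proof
    assume "1 \<in> I\<^sub>0"
    then obtain a b where ab: "1 = a * [:int p:] + b * Q" by (auto simp: I\<^sub>0_def)
    define b' where "b' = map_poly (\<lambda>c. c mod int p) b"
    obtain b2 where b: "b = b' + [:int p:] * b2"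
      using poly_mod_decomp(1)[of "int p" b] p1 unfolding b'_def by auto
    have eq: "1 = b' * Q + [:int p:] * (a + b2 * Q)"
      unfolding ab b by (simp add: algebra_simps)
    have dv: "int p dvd coeff (1 - b' * Q) n" for n
      by (subst eq) simp
    show False
    proof (cases "b' = 0")
      case True
      then have "int p dvd 1" using dv[of 0] by simp
      then show False using p1 by simp
    next
      case False
      have "coeff (1 - b' * Q) (degree Q + degree b') = - lead_coeff b'"
        using coeff_mult_monic_lead[OF Qmonic, of b'] degQ0 by (simp add: mult.commute)
      then have "int p dvd lead_coeff b'" using dv[of "degree Q + degree b'"] by simp
      moreover have "lead_coeff b' \<in> {0..<int p}" unfolding b'_def
        using p1 by (intro poly_mod_decomp(2)) simp
      ultimately show False
        using False zdvd_imp_le[of "int p" "lead_coeff b'"] leading_coeff_0_iff[of b'] by force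
    qed
  qed
  with exists_prime_ideal_above[OF I0] obtain I where I: "prime_ideal I" and I0I: "I\<^sub>0 \<subseteq> I" by blast
  have id: "ring_ideal I" and I1: "1 \<notin> I" using I by (auto simp: prime_ideal_def)
  have "[:int p:] = (0 + 1 * [:int p:]) + 0 * Q" "Q = (0 + 0 * [:int p:]) + 1 * Q" by simp_all
  then have pI: "[:int p:] \<in> I" and QI: "Q \<in> I" using I0I unfolding I\<^sub>0_def by blast+
  have yrI: "monom 1 (l ^ j) - 1 \<in> I"
    unfolding geom[symmetric] by (rule ring_idealD(3)[OF id QI])

  \<comment> \<open>A monic member of I of least degree plays the minimal polynomial of y over F_p,
    and e is the degree of the residue field.\<close>
  define e where "e = (LEAST e. \<exists>h\<in>I. lead_coeff h = 1 \<and> degree h = e)"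
  have "\<exists>h\<in>I. lead_coeff h = 1 \<and> degree h = e"
    unfolding e_def by (rule LeastI_ex) (use QI Qmonic in blast)
  then obtain h where h: "h \<in> I" "lead_coeff h = 1" "degree h = e" by blast
  have e_min: "e \<le> degree g" if "g \<in> I" "lead_coeff g = 1" for g
    unfolding e_def by (rule Least_le) (use that in blast)
  have e0: "e > 0"
  proof (rule ccontr)
    assume "\<not> e > 0"
    then have "h = 1" using h by (auto elim!: degree_eq_zeroE)
    then show False using h I1 by simp
  qed
  \<comment> \<open>A counterexample, reduced modulo p, would have a leading coefficient invertible
    modulo p. Bezout then yields a monic member of I of degree below e; the term that corrects the
    leading coefficient is a multiple of p and hence stays in I.\<close>
  have small: "int p dvd coeff g i" if g: "g \<in> I" "degree g < e" for g i
  proof -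
    define g' where "g' = map_poly (\<lambda>c. c mod int p) g"
    obtain g2 where g2: "g = g' + [:int p:] * g2"
      using poly_mod_decomp(1)[of "int p" g] p1 unfolding g'_def by auto
    have g'g: "degree g' \<le> degree g" unfolding g'_def using p1 by (intro poly_mod_decomp(3)) simp
    have g'I: "g' \<in> I"
      using ring_idealD(6)[OF id g(1) ring_idealD(4)[OF id pI], of g2] g2 by simp
    have "g' = 0"
    proof (rule ccontr)
      assume nz: "g' \<noteq> 0"
      have "lead_coeff g' \<in> {0..<int p}" unfolding g'_def
        using p1 by (intro poly_mod_decomp(2)) simp
      then have "\<not> int p dvd lead_coeff g'"
        using nz zdvd_imp_le[of "int p" "lead_coeff g'"] leading_coeff_0_iff[of g'] by force
      then have "coprime (lead_coeff g') (int p)"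
        using p by (simp add: coprime_commute prime_imp_coprime)
      then obtain c d where cd: "lead_coeff g' * c + int p * d = 1"
        by (metis bezout_int coprime_iff_gcd_eq_1 mult.commute)
      define f where "f = smult c g' + monom (int p * d) (degree g')"
      have "f = [:c:] * g' + [:int p:] * monom d (degree g')"
        by (simp add: f_def smult_monom)
      also have "\<dots> \<in> I" by (intro ring_idealD(2)[OF id] ring_idealD(3)[OF id g'I] ring_idealD(4)[OF id pI])
      finally have fI: "f \<in> I" .
      have cf: "coeff f (degree g') = 1" using cd by (simp add: f_def mult.commute)
      have "degree f \<le> degree g'" unfolding f_def
        by (intro degree_add_le degree_smult_le) (simp add: degree_monom_le)
      moreover have "degree g' \<le> degree f" using cf by (intro le_degree) simp
      ultimately have "degree f = degree g'" by simp
      then show False using e_min[OF fI] cf g'g g(2) by simp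
    qed
    then show ?thesis using g2 by simp
  qed

  \<comment> \<open>Representatives of the residue field: distinct ones are incongruent by
    \<open>small\<close>, and division by the monic \<open>h\<close> followed by reduction modulo p
    reaches every class.\<close>
  define T where "T = {g :: int poly. degree g < e \<and> (\<forall>i. coeff g i \<in> {0..<int p})}"
  have finT: "finite T" and cardT: "card T = p ^ e"
    unfolding T_def using card_polys_bounded_coeffs[OF e0, of "int p"] p1 by auto
  have T_eq: "t = t'" if t: "t \<in> T" "t' \<in> T" "t - t' \<in> I" for t t'
  proof (rule poly_eqI)
    fix i
    have "degree (t - t') < e" using t by (intro degree_diff_less) (auto simp: T_def)
    then have "int p dvd coeff t i - coeff t' i" using small[OF t(3)] by simp
    moreover have "coeff t i \<in> {0..<int p}" "coeff t' i \<in> {0..<int p}" using t by (auto simp: T_def)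
    ultimately show "coeff t i = coeff t' i"
      by (metis atLeastLessThan_iff mod_eq_dvd_iff mod_pos_pos_trivial)
  qed
  have "\<exists>t\<in>T. g - t \<in> I" for g
  proof -
    obtain u v where uv: "pseudo_divmod g h = (u, v)" by (cases "pseudo_divmod g h")
    have "h \<noteq> 0" using h by auto
    from pseudo_divmod[OF this uv] have g: "g = h * u + v" and "v = 0 \<or> degree v < degree h"
      using h by auto
    then have dv: "degree v < e" using e0 h by auto
    define v' where "v' = map_poly (\<lambda>c. c mod int p) v"
    obtain v2 where v2: "v = v' + [:int p:] * v2"
      using poly_mod_decomp(1)[of "int p" v] p1 unfolding v'_def by auto
    have "v' \<in> T" using poly_mod_decomp(2,3)[of "int p" v] p1 dv unfolding v'_def T_def by auto
    moreover have "g - v' = h * u + [:int p:] * v2" using g v2 by simp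
    then have "g - v' \<in> I"
      using ring_idealD(2)[OF id ring_idealD(4)[OF id h(1)] ring_idealD(4)[OF id pI]] by simp
    ultimately show ?thesis by blast
  qed
  then obtain \<rho> where \<rho>: "\<And>g. \<rho> g \<in> T" "\<And>g. g - \<rho> g \<in> I" by metis

  define y :: "int poly" where "y = monom 1 1"
  have y_pow: "y ^ n = monom 1 n" for n by (simp add: y_def monom_power)
  have yI: "y \<notin> I"
  proof
    assume "y \<in> I"
    then have "y * y ^ (l ^ j - 1) \<in> I" by (rule ring_idealD(4)[OF id])
    then have "monom 1 (l ^ j) \<in> I"
      using l1 by (simp add: y_pow flip: power_Suc y_pow)
    from ring_idealD(6)[OF id this yrI] I1 show False by simp
  qed
  have "0 \<in> T" using e0 p1 by (simp add: T_def)
  have TI: "t \<in> I \<longleftrightarrow> t = 0" if "t \<in> T" for t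
    using T_eq[OF that \<open>0 \<in> T\<close>] ring_idealD(1)[OF id] by auto
  define U where "U = T - {0}"
  have finU: "finite U" and cardU: "card U = p ^ e - 1"
    using finT cardT \<open>0 \<in> T\<close> by (simp_all add: U_def)
  \<comment> \<open>Multiplication by y on representatives permutes the non-zero ones. Comparing the
    products over all of them gives Fermat's identity y^(p^e - 1) = 1 in the residue field.\<close>
  define \<mu> where "\<mu> t = \<rho> (y * t)" for t
  have \<mu>: "y * t - \<mu> t \<in> I" for t unfolding \<mu>_def by (rule \<rho>)
  have "inj_on \<mu> U"
  proof (rule inj_onI)
    fix t t' assume t: "t \<in> U" "t' \<in> U" "\<mu> t = \<mu> t'"
    have "y * (t - t') \<in> I"
      using ring_idealD(6)[OF id \<mu> \<mu>, of t t'] t(3) by (simp add: algebra_simps)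
    then have "t - t' \<in> I" using I yI by (auto simp: prime_ideal_def)
    then show "t = t'" using t T_eq by (auto simp: U_def)
  qed
  moreover have "\<mu> ` U \<subseteq> U"
  proof
    fix x assume "x \<in> \<mu> ` U"
    then obtain t where t: "t \<in> U" "x = \<mu> t" by blast
    have "x \<noteq> 0"
    proof
      assume "x = 0"
      then have "y * t \<in> I" using \<mu>[of t] t by simp
      then have "t \<in> I" using I yI by (auto simp: prime_ideal_def)
      then show False using t TI by (auto simp: U_def)
    qed
    then show "x \<in> U" using t \<rho> by (simp add: U_def \<mu>_def)
  qed
  ultimately have bij: "bij_betw \<mu> U U"
    using finU by (simp add: bij_betw_def endo_inj_surj)
  define u where "u = (\<Prod>t\<in>U. t)"
  have "(\<Prod>t\<in>U. y * t) - (\<Prod>t\<in>U. \<mu> t) \<in> I" by (rule ring_ideal_prod_cong[OF id \<mu>])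
  moreover have "(\<Prod>t\<in>U. \<mu> t) = u" unfolding u_def by (rule prod.reindex_bij_betw[OF bij])
  moreover have "(\<Prod>t\<in>U. y * t) = y ^ (p ^ e - 1) * u"
    by (simp add: prod.distrib u_def cardU)
  ultimately have "(y ^ (p ^ e - 1) - 1) * u \<in> I" by (simp add: algebra_simps)
  moreover have "u \<notin> I"
    using prime_ideal_prod[OF I, of "\<lambda>t. t" U] TI unfolding u_def U_def by auto
  ultimately have fermat: "y ^ (p ^ e - 1) - 1 \<in> I" using I by (auto simp: prime_ideal_def)

  have y_mult: "y ^ (a * b) - 1 \<in> I" if "y ^ a - 1 \<in> I" for a b
  proof -
    have "y ^ (a * b) - 1 = (y ^ a - 1) * (\<Sum>i<b. (y ^ a) ^ i)"
      unfolding power_mult by (rule power_diff_1_eq)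
    then show ?thesis using ring_idealD(4)[OF id that] by simp
  qed
  have y_gcd: "y ^ gcd a b - 1 \<in> I" if ab: "y ^ a - 1 \<in> I" "y ^ b - 1 \<in> I" for a b :: nat
  proof (cases "a = 0")
    case True
    then show ?thesis using ab by simp
  next
    case False
    then obtain u v where "a * u = b * v + gcd a b" using bezout_nat by blast
    moreover have "y ^ (b * v) * (y ^ gcd a b - 1) = (y ^ (b * v + gcd a b) - 1) - (y ^ (b * v) - 1)"
      by (simp add: power_add algebra_simps)
    ultimately have "y ^ (b * v) * (y ^ gcd a b - 1) \<in> I"
      using y_mult[OF ab(1), of u] y_mult[OF ab(2), of v] ring_idealD(6)[OF id] by metis
    moreover have "y ^ n \<notin> I" for n
      using I1 yI I by (induction n) (auto simp: prime_ideal_def)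
    ultimately show ?thesis using I by (auto simp: prime_ideal_def)
  qed
  \<comment> \<open>If y^q were 1, each of the l summands of Q would be 1, so l would lie in I
    together with the coprime number p.\<close>
  have yq: "y ^ q - 1 \<notin> I"
  proof
    assume yq: "y ^ q - 1 \<in> I"
    have "monom 1 (q * i) - 1 \<in> I" for i using y_mult[OF yq, of i] by (simp add: y_pow)
    then have "(\<Sum>i<l. monom 1 (q * i) - 1) \<in> I" by (intro ring_ideal_sum[OF id])
    then have "Q - of_nat l \<in> I" by (simp add: Q_def sum_subtractf)
    from ring_idealD(6)[OF id QI this] have lI: "of_nat l \<in> I" by simp
    have "coprime (int l) (int p)" using primes_coprime[OF l(1) p l(2)] by simp
    then obtain c d where cd: "c * int l + d * int p = 1"
      by (metis bezout_int coprime_iff_gcd_eq_1)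
    have "1 = [:c:] * of_nat l + [:d:] * [:int p:]"
      using cd by (simp add: of_nat_poly mult.commute one_pCons)
    also have "\<dots> \<in> I" by (intro ring_idealD(2)[OF id] ring_idealD(3)[OF id lI] ring_idealD(3)[OF id pI])
    finally show False using I1 by simp
  qed
  \<comment> \<open>The order of y divides l^j but not q = l^(j - 1), so it equals l^j and divides
    p^e - 1. By \<open>ord\<close> this excludes e < k, and \<open>small\<close> then gives the last
    claim.\<close>
  have "l ^ j dvd p ^ e - 1"
  proof -
    define g where "g = gcd (l ^ j) (p ^ e - 1)"
    have yg: "y ^ g - 1 \<in> I" unfolding g_def using yrI fermat by (intro y_gcd) (simp_all add: y_pow)
    have "g dvd l ^ j" by (simp add: g_def)
    then obtain i where i: "i \<le> j" "g = l ^ i" using l(1) by (metis divides_primepow_nat)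
    have "i = j"
    proof (rule ccontr)
      assume "i \<noteq> j"
      then have "g dvd q" using i by (simp add: q_def le_imp_power_dvd)
      then show False using yq y_mult[OF yg] by (auto elim!: dvdE)
    qed
    then show ?thesis using i unfolding g_def by (metis gcd_dvd2)
  qed
  then have "k \<le> e" using ord e0 by (metis One_nat_def Suc_leI atLeastLessThan_iff not_le)
  then show ?thesis using I pI yrI small by (intro exI[of _ I]) auto
qed

text \<open>Modulo y^r - 1 exponents count only modulo r, so g is congruent to the polynomial whose
  i-th coefficient is the sum over the residue class of i. The criterion involves nothing but sums
  of coefficients and can therefore be verified through additive maps.\<close>

lemma poly_in_ideal_if_folded_coeffs_dvd:
  fixes g :: "int poly"
  assumes id: "ring_ideal I" and pI: "[:p:] \<in> I" and yrI: "monom 1 r - 1 \<in> I"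
    and deg: "degree g < N * r"
    and dv: "\<And>i. i < r \<Longrightarrow> p dvd (\<Sum>t<N. coeff g (t * r + i))"
  shows "g \<in> I"
proof -
  have "g = (\<Sum>n\<le>degree g. monom (coeff g n) n)" by (rule poly_as_sum_of_monoms[symmetric])
  also have "\<dots> = (\<Sum>n<N * r. monom (coeff g n) n)"
    using deg by (intro sum.mono_neutral_left) (auto simp: coeff_eq_0)
  also have "\<dots> = (\<Sum>t<N. \<Sum>i<r. monom (coeff g (t * r + i)) (t * r + i))"
    unfolding sum.nat_group[symmetric]
  proof (rule sum.cong[OF refl])
    fix t
    show "(\<Sum>n = t * r..<t * r + r. monom (coeff g n) n)
        = (\<Sum>i<r. monom (coeff g (t * r + i)) (t * r + i))"
      by (rule sum.reindex_bij_witness[of _ "\<lambda>i. t * r + i" "\<lambda>i. i - t * r"]) auto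
  qed
  finally have g: "g = (\<Sum>t<N. \<Sum>i<r. monom (coeff g (t * r + i)) (t * r + i))" .
  define g' where "g' = (\<Sum>t<N. \<Sum>i<r. monom (coeff g (t * r + i)) i)"
  have "monom c (t * r + i) - monom c i \<in> I" for c t i
  proof -
    have "monom (1::int) (t * r) - 1 = monom 1 r ^ t - 1" by (simp add: monom_power mult.commute)
    also have "\<dots> = (monom 1 r - 1) * (\<Sum>i<t. monom 1 r ^ i)" by (rule power_diff_1_eq)
    finally have eq: "(monom 1 r - 1) * (\<Sum>i<t. monom 1 r ^ i) = monom (1::int) (t * r) - 1" ..
    have "monom c (t * r + i) - monom c i
        = monom c i * ((monom 1 r - 1) * (\<Sum>i<t. monom 1 r ^ i))"
      unfolding eq
      by (simp add: right_diff_distrib mult_monom add.commute)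
    also have "\<dots> \<in> I" by (intro ring_idealD(3)[OF id] ring_idealD(4)[OF id] yrI)
    finally show ?thesis .
  qed
  then have "g - g' \<in> I" by (subst g) (simp add: g'_def ring_ideal_sum[OF id] flip: sum_subtractf)
  moreover have "g' = (\<Sum>i<r. monom (\<Sum>t<N. coeff g (t * r + i)) i)"
    unfolding g'_def by (subst sum.swap) (simp add: monom_sum)
  moreover have "monom (\<Sum>t<N. coeff g (t * r + i)) i \<in> I" if i: "i < r" for i
  proof -
    obtain c where "(\<Sum>t<N. coeff g (t * r + i)) = p * c" using dv[OF i] by (elim dvdE)
    then have "monom (\<Sum>t<N. coeff g (t * r + i)) i = monom c i * [:p:]"
      by (simp add: smult_monom mult.commute)
    then show ?thesis using ring_idealD(3)[OF id pI] by simp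
  qed
  ultimately show ?thesis
    using ring_idealD(2)[OF id, of "g - g'" g'] ring_ideal_sum[OF id, of "{..<r}"] by simp
qed

definition bits_poly :: "bool list \<Rightarrow> int poly" where
  "bits_poly es = Poly (map of_bool es)"

lemma coeff_bits_poly: "coeff (bits_poly es) i = of_bool (i < length es \<and> es ! i)"
  by (simp add: bits_poly_def nth_default_def)

text \<open>Two different bit lists of length k give polynomials whose difference has degree below k
  and some coefficient 1 or -1, so it is not in I; multiplying by a power of y, a unit modulo I,
  keeps the points distinct. All of them are roots of F modulo I. The number of blocks
  \<open>N es\<close> may depend on the point, since it merely has to cover the whole of
  F(a).\<close>

lemma card_bits_roots_le:
  fixes p l j k c D :: nat and N :: "bool list \<Rightarrow> nat" and F :: "int poly"
  assumes p: "prime p" and l: "prime l" "l \<noteq> p" and j: "j \<ge> 1" and k: "k > 0"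
    and ord: "\<forall>i\<in>{1..<k}. \<not> l ^ j dvd p ^ i - 1"
    and F: "\<not> int p dvd coeff F n" "degree F \<le> D"
    and A: "\<And>es. es \<in> A \<Longrightarrow> length es = k"
    and deg: "\<And>es. es \<in> A \<Longrightarrow> degree (F \<circ>\<^sub>p (monom 1 c * bits_poly es)) < N es * l ^ j"
    and root: "\<And>es i. es \<in> A \<Longrightarrow> i < l ^ j \<Longrightarrow>
      int p dvd (\<Sum>t<N es. coeff (F \<circ>\<^sub>p (monom 1 c * bits_poly es)) (t * l ^ j + i))"
  shows "card A \<le> D"
proof -
  obtain I where I: "prime_ideal I" and pI: "[:int p:] \<in> I" and yrI: "monom 1 (l ^ j) - 1 \<in> I"
    and small: "\<And>g i. g \<in> I \<Longrightarrow> degree g < k \<Longrightarrow> int p dvd coeff g i"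
    using exists_prime_ideal_cyclotomic[OF p l j ord] by blast
  have id: "ring_ideal I" and I1: "1 \<notin> I" using I by (auto simp: prime_ideal_def)
  have p1: "p > 1" using p prime_gt_1_nat by blast
  have l1: "l > 1" using l prime_gt_1_nat by blast
  \<comment> \<open>The l^j-th power of y^n is 1 modulo I, so y^n cannot be 0.\<close>
  have monomI: "monom 1 n \<notin> I" for n :: nat
  proof
    assume *: "monom 1 n \<in> I"
    have "n \<le> l ^ j * n" using l1 by simp
    then have "monom 1 (l ^ j * n) = monom (1 :: int) (l ^ j * n - n) * monom 1 n"
      by (simp add: mult_monom)
    then have "monom 1 (l ^ j * n) \<in> I" using ring_idealD(3)[OF id *] by simp
    moreover have "monom 1 (l ^ j * n) - 1 = (monom (1::int) (l ^ j) - 1) * (\<Sum>i<n. monom 1 (l ^ j) ^ i)"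
      using power_diff_1_eq[of "monom (1::int) (l ^ j)" n] by (simp add: monom_power)
    then have "monom 1 (l ^ j * n) - 1 \<in> I" using ring_idealD(4)[OF id yrI] by simp
    ultimately show False using ring_idealD(6)[OF id] I1 by force
  qed
  define \<alpha> where "\<alpha> es = monom 1 c * bits_poly es" for es
  have eqI: "es = es'" if es: "es \<in> A" "es' \<in> A" "\<alpha> es - \<alpha> es' \<in> I" for es es'
  proof (rule nth_equalityI)
    show "length es = length es'" using A es by simp
    fix i assume i: "i < length es"
    have "monom 1 c * (bits_poly es - bits_poly es') \<in> I"
      using es by (simp add: \<alpha>_def algebra_simps)
    then have "bits_poly es - bits_poly es' \<in> I" using I monomI by (auto simp: prime_ideal_def)
    moreover have "degree (bits_poly es - bits_poly es') \<le> k - 1"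
      using A es k by (intro degree_le) (auto simp: coeff_bits_poly)
    ultimately have "int p dvd coeff (bits_poly es - bits_poly es') i" using small k by fastforce
    then show "es ! i = es' ! i"
      using i A[OF es(1)] A[OF es(2)] p1
      by (cases "es ! i"; cases "es' ! i") (simp_all add: coeff_bits_poly)
  qed
  have inj: "inj_on \<alpha> A" using eqI ring_idealD(1)[OF id] by (intro inj_onI) auto
  have "finite A" by (rule finite_subset[OF _ finite_lists_length_eq[of "UNIV :: bool set" k]]) (use A in auto)
  have "card (\<alpha> ` A) \<le> D"
  proof (rule card_roots_mod_prime_ideal[OF I])
    \<comment> \<open>A constant has degree 0 < k, hence lies in I only if p divides it; so F
      remains non-zero after its coefficients are embedded as constants.\<close>
    show "coeff (map_poly (\<lambda>c. [:c:]) F) n \<notin> I"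
      using small[of "[:coeff F n:]" 0] k F(1) by (auto simp: coeff_map_poly)
    show "degree (map_poly (\<lambda>c. [:c:]) F) \<le> D"
      using F(2) by (subst degree_map_poly) auto
    show "finite (\<alpha> ` A)" using \<open>finite A\<close> by simp
    fix a assume "a \<in> \<alpha> ` A"
    then obtain es where es: "es \<in> A" "a = \<alpha> es" by blast
    show "poly (map_poly (\<lambda>c. [:c:]) F) a \<in> I"
      unfolding pcompose_altdef[symmetric] es \<alpha>_def
      by (rule poly_in_ideal_if_folded_coeffs_dvd[OF id pI yrI deg root]) (use es in auto)
  qed (use eqI in auto)
  then show ?thesis using card_image[OF inj] by simp
qed

text \<open>The ideal contains y^r - 1 with leading coefficient 1; were r below k, p would divide 1.
  The bound makes \<open>l ^ j - k\<close> a true difference, so that a point has exactly l^j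
  coefficients.\<close>

lemma order_bound_le:
  fixes p l j k :: nat
  assumes p: "prime p" and l: "prime l" "l \<noteq> p" and j: "j \<ge> 1"
    and ord: "\<forall>i\<in>{1..<k}. \<not> l ^ j dvd p ^ i - 1"
  shows "k \<le> l ^ j"
proof (rule ccontr)
  assume "\<not> k \<le> l ^ j"
  obtain I where I: "prime_ideal I" "monom 1 (l ^ j) - 1 \<in> I"
    and small: "\<And>g i. g \<in> I \<Longrightarrow> degree g < k \<Longrightarrow> int p dvd coeff g i"
    using exists_prime_ideal_cyclotomic[OF p l j ord] by blast
  have "l > 1" using l prime_gt_1_nat by blast
  have "degree (monom 1 (l ^ j) - 1 :: int poly) \<le> l ^ j"
    by (intro degree_diff_le) (auto simp: degree_monom_le)
  then have "int p dvd coeff (monom 1 (l ^ j) - 1) (l ^ j)"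
    using \<open>\<not> k \<le> l ^ j\<close> by (intro small[OF I(2)]) simp
  moreover have "coeff (monom 1 (l ^ j) - 1 :: int poly) (l ^ j) = 1" using \<open>l > 1\<close> by simp
  ultimately have "int p dvd 1" by metis
  then show False using prime_gt_1_nat[OF p] by simp
qed

section \<open>Finite abelian groups\<close>

text \<open>It will be applied to the additive group of R, where \<open>a [^] k\<close> becomes the
  k-fold sum. \<open>\<rho> a z\<close> says that a equals the z-th power of v modulo M. It is a
  relation because z is determined only modulo p and exists only for elements generated by M and
  v.\<close>

lemma (in comm_group) exists_prime_functional:
  fixes f :: "nat \<Rightarrow> 'a"
  assumes fin: "finite (carrier G)" and f: "\<And>n. f n \<in> carrier G" and ne: "f n\<^sub>0 \<noteq> \<one>"
  obtains p N :: nat and u :: "nat \<Rightarrow> int" and \<rho> :: "'a \<Rightarrow> int \<Rightarrow> bool"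
  where "Factorial_Ring.prime p" "p \<le> card (carrier G)" "u N = 1"
    and "\<And>a b z z'. \<rho> a z \<Longrightarrow> \<rho> b z' \<Longrightarrow> \<rho> (a \<otimes> b) (z + z')"
    and "\<And>a z k. \<rho> a z \<Longrightarrow> \<rho> (a [^] (k :: int)) (k * z)"
    and "\<rho> \<one> 0" "\<And>n. \<rho> (f n) (u n)" "\<And>z. \<rho> \<one> z \<Longrightarrow> int p dvd z"
proof -
  define \<A> where "\<A> = {M. subgroup M G \<and> (\<exists>n. f n \<notin> M)}"
  have "finite \<A>"
    by (rule finite_subset[of _ "Pow (carrier G)"]) (use fin in \<open>auto simp: \<A>_def dest: subgroup.subset\<close>)
  moreover have "{\<one>} \<in> \<A>" using ne triv_subgroup by (auto simp: \<A>_def)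
  ultimately obtain M where M: "M \<in> \<A>" and max: "\<And>M'. M' \<in> \<A> \<Longrightarrow> M \<subseteq> M' \<Longrightarrow> M = M'"
    using finite_has_maximal[of \<A>] by blast
  have sub: "subgroup M G" using M by (simp add: \<A>_def)
  obtain N where N: "f N \<notin> M" using M by (auto simp: \<A>_def)
  \<comment> \<open>M together with the powers of \<open>a\<close> forms a subgroup strictly larger
    than M; by maximality it contains every \<open>f n\<close>.\<close>
  have gen: "\<exists>m\<in>M. \<exists>z::int. f n = m \<otimes> a [^] z" if a: "a \<in> carrier G" "a \<notin> M" for a n
  proof -
    define M' where "M' = {m \<otimes> a [^] z |m (z::int). m \<in> M}"
    have car: "m \<in> carrier G" if "m \<in> M" for m using subgroup.mem_carrier[OF sub that] .
    have "subgroup M' G"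
    proof (rule subgroupI)
      show "M' \<subseteq> carrier G" using a car by (auto simp: M'_def)
      show "M' \<noteq> {}" using subgroup.one_closed[OF sub] by (auto simp: M'_def)
    next
      fix x assume "x \<in> M'"
      then obtain m z where x: "x = m \<otimes> a [^] (z::int)" "m \<in> M" by (auto simp: M'_def)
      then have "inv x = inv m \<otimes> a [^] (- z)" using a car by (simp add: inv_mult int_pow_neg)
      moreover have "inv m \<in> M" using x subgroup.m_inv_closed[OF sub] by blast
      ultimately show "inv x \<in> M'" unfolding M'_def by blast
    next
      fix x y assume "x \<in> M'" "y \<in> M'"
      then obtain m z m' z' where x: "x = m \<otimes> a [^] (z::int)" "m \<in> M"
        and y: "y = m' \<otimes> a [^] (z'::int)" "m' \<in> M" unfolding M'_def by blast
      have "x \<otimes> y = (m \<otimes> m') \<otimes> a [^] (z + z')"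
        using a car x y by (simp add: int_pow_mult m_ac)
      moreover have "m \<otimes> m' \<in> M" using x y subgroup.m_closed[OF sub] by blast
      ultimately show "x \<otimes> y \<in> M'" unfolding M'_def by blast
    qed
    moreover have "M \<subseteq> M'"
    proof
      fix m assume "m \<in> M"
      moreover from this have "m = m \<otimes> a [^] (0::int)" using car by simp
      ultimately show "m \<in> M'" unfolding M'_def by blast
    qed
    moreover have "a \<in> M'"
    proof -
      have "a = \<one> \<otimes> a [^] (1::int)" using a by simp
      then show ?thesis unfolding M'_def using subgroup.one_closed[OF sub] by blast
    qed
    ultimately have "f n \<in> M'" using max[of M'] a by (auto simp: \<A>_def)
    then show ?thesis by (auto simp: M'_def)
  qed
  define v where "v = f N"
  have v: "v \<in> carrier G" "v \<notin> M" using f N by (simp_all add: v_def)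
  have "v [^] int (Coset.order G) = \<one>"
    unfolding int_pow_int using fin v by (intro pow_order_eq_1)
  then have ord: "v [^] int (Coset.order G) \<in> M" using subgroup.one_closed[OF sub] by simp
  \<comment> \<open>The order of v modulo M, bounded by the order of the group since v raised to
    that order is trivial.\<close>
  define p where "p = (LEAST n. n > 0 \<and> v [^] int n \<in> M)"
  have ord0: "Coset.order G > 0" using fin by (simp add: order_gt_0_iff_finite)
  have p: "p > 0" "v [^] int p \<in> M"
    unfolding p_def using LeastI_ex[of "\<lambda>n. n > 0 \<and> v [^] int n \<in> M"] ord ord0 by blast+
  have p_le: "p \<le> n" if "n > 0" "v [^] int n \<in> M" for n
    unfolding p_def using that by (intro Least_le) simp
  have pdvd: "int p dvd z" if "v [^] z \<in> M" for z :: int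
  proof (rule ccontr)
    assume "\<not> int p dvd z"
    then have "z mod int p \<noteq> 0" by auto
    moreover have "0 \<le> z mod int p" "z mod int p < int p" using p by simp_all
    ultimately have lt: "nat (z mod int p) > 0" "nat (z mod int p) < p" by linarith+
    have "v [^] (int p * (z div int p)) = (v [^] int p) [^] (z div int p)"
      using v by (simp only: int_pow_pow)
    also have "\<dots> \<in> M" by (rule subgroup_int_pow_closed[OF sub p(2)])
    finally have "v [^] z \<otimes> inv (v [^] (int p * (z div int p))) \<in> M"
      using that sub by (meson subgroup.m_closed subgroup.m_inv_closed)
    moreover have "z mod int p = z - int p * (z div int p)" by (simp add: minus_mult_div_eq_mod)
    ultimately have "v [^] (z mod int p) \<in> M" using v by (simp add: int_pow_diff)
    moreover have "int (nat (z mod int p)) = z mod int p" using p by simp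
    ultimately have "v [^] int (nat (z mod int p)) \<in> M" by simp
    from p_le[OF lt(1) this] lt(2) show False by simp
  qed
  have prime: "Factorial_Ring.prime p"
    unfolding prime_nat_iff
  proof (intro conjI allI impI)
    have "p \<noteq> 1"
    proof
      assume "p = 1"
      then show False using p v by simp
    qed
    then show "1 < p" using p by linarith
    fix a assume "a dvd p"
    then obtain b where ab: "p = a * b" by (elim dvdE)
    \<comment> \<open>For a proper divisor a > 1 the power v^a is still outside M, so
      \<open>gen\<close> expresses v as a power (v^a)^z modulo M. Then p divides 1 - a z, and so
      does a, which is absurd.\<close>
    show "a = 1 \<or> a = p"
    proof (rule ccontr)
      assume "\<not> (a = 1 \<or> a = p)"
      then have "a \<noteq> 1" "a \<noteq> p" by auto
      moreover have "a \<le> p" "a > 0" using \<open>a dvd p\<close> p(1) by (auto intro: dvd_imp_le dvd_pos_nat)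
      ultimately have a: "a > 1" "a < p" by linarith+
      have "v [^] int a \<notin> M" using p_le[of a] a by auto
      then obtain m z where m: "m \<in> M" "v = m \<otimes> (v [^] int a) [^] (z::int)"
        using gen[of "v [^] int a" N] v by (auto simp: v_def)
      have mc: "m \<in> carrier G" using subgroup.mem_carrier[OF sub m(1)] .
      have eq: "v = m \<otimes> v [^] (int a * z)" using m(2) v by (simp only: int_pow_pow)
      have "v [^] (1 - int a * z) = v \<otimes> inv (v [^] (int a * z))" using v by (simp add: int_pow_diff)
      also have "\<dots> = (m \<otimes> v [^] (int a * z)) \<otimes> inv (v [^] (int a * z))" using eq by simp
      also have "\<dots> = m" using v mc by (simp add: m_assoc)
      finally have "int p dvd 1 - int a * z" using m(1) by (intro pdvd) simp
      then have "int a dvd 1 - int a * z" using ab dvd_mult_left by (metis of_nat_mult)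
      then have "int a dvd 1" using dvd_add[of "int a" "1 - int a * z" "int a * z"] by simp
      then show False using a by simp
    qed
  qed
  have card: "p \<le> card (carrier G)" using p_le[OF ord0 ord] by (simp add: Coset.order_def)
  define \<rho> where "\<rho> a z \<longleftrightarrow> (\<exists>m\<in>M. a = m \<otimes> v [^] z)" for a and z :: int
  have car: "m \<in> carrier G" if "m \<in> M" for m using subgroup.mem_carrier[OF sub that] .
  \<comment> \<open>As v is \<open>f N\<close>, its exponent can be chosen to be 1; this later
    provides a coefficient of F that p does not divide.\<close>
  have "\<exists>z. \<rho> (f n) z \<and> (n = N \<longrightarrow> z = 1)" for n
  proof (cases "n = N")
    case True
    then have "f n = \<one> \<otimes> v [^] (1::int)" using v by (simp add: v_def)
    then have "\<rho> (f n) 1" unfolding \<rho>_def using subgroup.one_closed[OF sub] by blast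
    then show ?thesis by blast
  next
    case False
    then show ?thesis using gen[OF v, of n] by (auto simp: \<rho>_def)
  qed
  then obtain u where u: "\<And>n. \<rho> (f n) (u n)" "u N = 1" by metis
  have add: "\<rho> (a \<otimes> b) (z + z')" if ab: "\<rho> a z" "\<rho> b z'" for a b z z'
  proof -
    obtain m m' where m: "m \<in> M" "a = m \<otimes> v [^] z" "m' \<in> M" "b = m' \<otimes> v [^] z'"
      using ab by (auto simp: \<rho>_def)
    then have "a \<otimes> b = (m \<otimes> m') \<otimes> v [^] (z + z')"
      using v car by (simp add: int_pow_mult m_ac)
    then show ?thesis unfolding \<rho>_def using m subgroup.m_closed[OF sub] by blast
  qed
  have pow: "\<rho> (a [^] k) (k * z)" if az: "\<rho> a z" for a z and k :: int
  proof -
    obtain m where m: "m \<in> M" "a = m \<otimes> v [^] z" using az by (auto simp: \<rho>_def)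
    then have "a [^] k = m [^] k \<otimes> v [^] (k * z)"
      using v car by (simp add: int_pow_distrib int_pow_pow mult.commute)
    then show ?thesis unfolding \<rho>_def using m subgroup_int_pow_closed[OF sub] by blast
  qed
  have zero: "\<rho> \<one> 0"
    unfolding \<rho>_def using subgroup.one_closed[OF sub] by (intro bexI[of _ \<one>]) simp_all
  have dvd: "int p dvd z" if z: "\<rho> \<one> z" for z
  proof (rule pdvd)
    obtain m where m: "m \<in> M" "\<one> = m \<otimes> v [^] z" using z by (auto simp: \<rho>_def)
    then have "v [^] z = inv m" using v car by (metis int_pow_closed inv_equality inv_inv m_comm)
    then show "v [^] z \<in> M" using m subgroup.m_inv_closed[OF sub] by simp
  qed
  show thesis by (rule that[OF prime card u(2) add pow zero u(1) dvd])
qed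

section \<open>Circuits over cyclic convolution rings\<close>

text \<open>Scalar 1 gives addition, a general scalar gives one row of a convolution, so that a
  single program serves both kinds of gates.\<close>

definition lin_comb :: "('a, 'b) ring_scheme \<Rightarrow> 'a \<Rightarrow> 'a list \<Rightarrow> 'a list \<Rightarrow> 'a list" where
  "lin_comb R a xs ys = map2 (\<lambda>x y. x \<oplus>\<^bsub>R\<^esub> a \<otimes>\<^bsub>R\<^esub> y) xs ys"

text \<open>Multiplication by y in R[y]/(y^r - 1), on coefficient lists of length r with the
  constant term in front.\<close>

definition rotate_right :: "'a list \<Rightarrow> 'a list" where
  "rotate_right xs = last xs # butlast xs"

text \<open>The value cs + as ys in R[y]/(y^r - 1): the i-th coefficient of \<open>as\<close> meets
  \<open>ys\<close> after i rotations.\<close>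

fun conv_add :: "('a, 'b) ring_scheme \<Rightarrow> 'a list \<Rightarrow> 'a list \<Rightarrow> 'a list \<Rightarrow> 'a list" where
  "conv_add R cs [] ys = cs"
| "conv_add R cs (a # as) ys = conv_add R (lin_comb R a cs ys) as (rotate_right ys)"

fun gate_val :: "('a, 'b) ring_scheme \<Rightarrow> 'a list \<Rightarrow> 'a list list \<Rightarrow> 'a gate \<Rightarrow> 'a list" where
  "gate_val R A vs Var = A"
| "gate_val R A vs (Const a) = a # replicate (length A - 1) \<zero>\<^bsub>R\<^esub>"
| "gate_val R A vs (Plus i j) = lin_comb R \<one>\<^bsub>R\<^esub> (vs ! i) (vs ! j)"
| "gate_val R A vs (Times i j) = conv_add R (replicate (length A) \<zero>\<^bsub>R\<^esub>) (vs ! i) (vs ! j)"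

definition circuit_vals :: "('a, 'b) ring_scheme \<Rightarrow> 'a list \<Rightarrow> 'a gate list \<Rightarrow> 'a list list" where
  "circuit_vals R A C = foldl (\<lambda>vs g. vs @ [gate_val R A vs g]) [] C"

definition point :: "('a, 'b) ring_scheme \<Rightarrow> nat \<Rightarrow> bool list \<Rightarrow> 'a list" where
  "point R n es = replicate n \<zero>\<^bsub>R\<^esub> @ map (\<lambda>b. if b then \<one>\<^bsub>R\<^esub> else \<zero>\<^bsub>R\<^esub>) es"

lemma length_lin_comb [simp]: "length (lin_comb R a xs ys) = min (length xs) (length ys)"
  by (simp add: lin_comb_def)

lemma length_rotate_right [simp]: "xs \<noteq> [] \<Longrightarrow> length (rotate_right xs) = length xs"
  by (simp add: rotate_right_def)

lemma set_rotate_right [simp]: "xs \<noteq> [] \<Longrightarrow> set (rotate_right xs) = set xs"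
  by (metis append_butlast_last_id list.set(2) rotate_right_def set_append Un_commute
      insert_is_Un list.set(1))

lemma rotate_right_eq_Nil [simp]: "rotate_right xs \<noteq> []"
  by (simp add: rotate_right_def)

lemma circuit_vals_snoc: "circuit_vals R A (C @ [g]) = circuit_vals R A C @ [gate_val R A (circuit_vals R A C) g]"
  by (simp add: circuit_vals_def)

lemma length_circuit_vals [simp]: "length (circuit_vals R A C) = length C"
  by (induction C rule: rev_induct) (simp_all add: circuit_vals_snoc, simp add: circuit_vals_def)

lemma (in cring) lin_comb_closed:
  assumes "a \<in> carrier R" "set xs \<subseteq> carrier R" "set ys \<subseteq> carrier R"
  shows "set (lin_comb R a xs ys) \<subseteq> carrier R"
  using assms by (auto simp: lin_comb_def set_zip subset_iff)

lemma (in cring) conv_add_closed: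
  assumes "set as \<subseteq> carrier R" "set cs \<subseteq> carrier R" "set ys \<subseteq> carrier R" "ys \<noteq> []"
    "length cs = length ys"
  shows "set (conv_add R cs as ys) \<subseteq> carrier R \<and> length (conv_add R cs as ys) = length ys"
  using assms
proof (induction as arbitrary: cs ys)
  case (Cons a as)
  then show ?case
    using Cons.IH[of "lin_comb R a cs ys" "rotate_right ys"] lin_comb_closed[of a cs ys] by simp
qed simp

section \<open>Polynomials over R modulo y^r - 1\<close>

context UP_cring
begin

abbreviation "cf \<equiv> up_ring.coeff P"
abbreviation "mnm \<equiv> up_ring.monom P"

lemma coeff_monom_mult_less:
  assumes "c \<in> carrier R" "p \<in> carrier P" "k < n"
  shows "cf (mnm c n \<otimes>\<^bsub>P\<^esub> p) k = \<zero>"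
proof -
  have "cf (mnm c n \<otimes>\<^bsub>P\<^esub> p) k = (\<Oplus>i\<in>{..k}. cf (mnm c n) i \<otimes> cf p (k - i))"
    using assms by simp
  also have "\<dots> = (\<Oplus>i\<in>{..k}. \<zero>)"
    using assms by (intro R.finsum_cong') auto
  finally show ?thesis by simp
qed

lemma coeff_monom_mult_if:
  assumes "c \<in> carrier R" "p \<in> carrier P"
  shows "cf (mnm c n \<otimes>\<^bsub>P\<^esub> p) k = (if k < n then \<zero> else c \<otimes> cf p (k - n))"
  using coeff_monom_mult[OF assms, of n "k - n"] coeff_monom_mult_less[OF assms] by auto

lemma coeff_var_mult:
  "p \<in> carrier P \<Longrightarrow> cf (mnm \<one> 1 \<otimes>\<^bsub>P\<^esub> p) n = (if n = 0 then \<zero> else cf p (n - 1))"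
  using coeff_monom_mult_if[of \<one> p 1 n] by (auto simp del: coeff_mult)

primrec list_poly :: "'a list \<Rightarrow> nat \<Rightarrow> 'a" where
  "list_poly [] = \<zero>\<^bsub>P\<^esub>"
| "list_poly (a # as) = mnm a 0 \<oplus>\<^bsub>P\<^esub> mnm \<one> 1 \<otimes>\<^bsub>P\<^esub> list_poly as"

lemma list_poly_closed [simp]: "set L \<subseteq> carrier R \<Longrightarrow> list_poly L \<in> carrier P"
  by (induction L) auto

lemma coeff_list_poly [simp]:
  "set L \<subseteq> carrier R \<Longrightarrow> cf (list_poly L) n = (if n < length L then L ! n else \<zero>)"
proof (induction L arbitrary: n)
  case (Cons a L)
  then have eq: "cf (list_poly (a # L)) n
      = (if n = 0 then a else \<zero>) \<oplus> (if n = 0 then \<zero> else cf (list_poly L) (n - 1))"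
    using coeff_var_mult[of "list_poly L" n] by (auto simp del: coeff_mult)
  have carr: "L ! i \<in> carrier R" if "i < length L" for i using that Cons.prems by auto
  have IH: "cf (list_poly L) i = (if i < length L then L ! i else \<zero>)" for i
    using Cons by simp
  show ?case unfolding eq IH using Cons.prems carr by (cases n) simp_all
qed simp

definition cyc :: "nat \<Rightarrow> nat \<Rightarrow> 'a" where
  "cyc r = mnm \<one> r \<ominus>\<^bsub>P\<^esub> \<one>\<^bsub>P\<^esub>"

lemma cyc_closed [simp]: "cyc r \<in> carrier P" by (simp add: cyc_def)

text \<open>Congruence modulo y^r - 1. Membership in the carrier is built in, so that congruences
  chain and combine without side conditions.\<close>

definition cyc_cong :: "nat \<Rightarrow> (nat \<Rightarrow> 'a) \<Rightarrow> (nat \<Rightarrow> 'a) \<Rightarrow> bool" where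
  "cyc_cong r g g' \<longleftrightarrow> g \<in> carrier P \<and> g' \<in> carrier P \<and> (\<exists>h\<in>carrier P. g = g' \<oplus>\<^bsub>P\<^esub> cyc r \<otimes>\<^bsub>P\<^esub> h)"

lemma cyc_cong_refl: "g \<in> carrier P \<Longrightarrow> cyc_cong r g g"
  unfolding cyc_cong_def by (auto intro!: bexI[of _ "\<zero>\<^bsub>P\<^esub>"])

lemma cyc_cong_trans:
  assumes "cyc_cong r f g" "cyc_cong r g h"
  shows "cyc_cong r f h"
proof -
  obtain u v where "u \<in> carrier P" "v \<in> carrier P" "f = g \<oplus>\<^bsub>P\<^esub> cyc r \<otimes>\<^bsub>P\<^esub> u" "g = h \<oplus>\<^bsub>P\<^esub> cyc r \<otimes>\<^bsub>P\<^esub> v"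
    "f \<in> carrier P" "g \<in> carrier P" "h \<in> carrier P"
    using assms by (auto simp: cyc_cong_def)
  then show ?thesis
    unfolding cyc_cong_def by (intro conjI bexI[of _ "u \<oplus>\<^bsub>P\<^esub> v"]) (auto simp: P.r_distr P.a_ac)
qed

lemma cyc_cong_add:
  assumes "cyc_cong r f f'" "cyc_cong r g g'"
  shows "cyc_cong r (f \<oplus>\<^bsub>P\<^esub> g) (f' \<oplus>\<^bsub>P\<^esub> g')"
proof -
  obtain u v where "u \<in> carrier P" "v \<in> carrier P" "f = f' \<oplus>\<^bsub>P\<^esub> cyc r \<otimes>\<^bsub>P\<^esub> u" "g = g' \<oplus>\<^bsub>P\<^esub> cyc r \<otimes>\<^bsub>P\<^esub> v"
    "f' \<in> carrier P" "g' \<in> carrier P"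
    using assms by (auto simp: cyc_cong_def)
  then show ?thesis
    unfolding cyc_cong_def by (intro conjI bexI[of _ "u \<oplus>\<^bsub>P\<^esub> v"]) (auto simp: P.r_distr P.a_ac)
qed

lemma cyc_cong_mult:
  assumes "cyc_cong r f f'" "cyc_cong r g g'"
  shows "cyc_cong r (f \<otimes>\<^bsub>P\<^esub> g) (f' \<otimes>\<^bsub>P\<^esub> g')"
proof -
  obtain u v where "u \<in> carrier P" "v \<in> carrier P" "f = f' \<oplus>\<^bsub>P\<^esub> cyc r \<otimes>\<^bsub>P\<^esub> u" "g = g' \<oplus>\<^bsub>P\<^esub> cyc r \<otimes>\<^bsub>P\<^esub> v"
    "f' \<in> carrier P" "g' \<in> carrier P" "cyc r \<in> carrier P"
    using assms by (auto simp: cyc_cong_def)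
  then show ?thesis
    unfolding cyc_cong_def
    by (intro conjI bexI[of _ "u \<otimes>\<^bsub>P\<^esub> g' \<oplus>\<^bsub>P\<^esub> f' \<otimes>\<^bsub>P\<^esub> v \<oplus>\<^bsub>P\<^esub> cyc r \<otimes>\<^bsub>P\<^esub> u \<otimes>\<^bsub>P\<^esub> v"])
      (simp_all add: P.r_distr P.l_distr P.a_ac P.m_ac)
qed

text \<open>Rotation moves the last coefficient c from y^r to y^0, which changes the polynomial by c
  (y^r - 1).\<close>

lemma list_poly_rotate_right:
  assumes L: "set L \<subseteq> carrier R" "L \<noteq> []"
  shows "cyc_cong (length L) (mnm \<one> 1 \<otimes>\<^bsub>P\<^esub> list_poly L) (list_poly (rotate_right L))"
proof -
  let ?c = "last L"
  have c: "?c \<in> carrier R" using L by auto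
  have rot: "set (rotate_right L) \<subseteq> carrier R" using L by simp
  have eq: "cyc (length L) \<otimes>\<^bsub>P\<^esub> mnm ?c 0 = mnm ?c (length L) \<ominus>\<^bsub>P\<^esub> mnm ?c 0"
    using c monom_mult[of \<one> ?c "length L" 0] by (simp add: cyc_def P.minus_eq P.l_distr P.l_minus del: monom_mult)
  have "mnm \<one> 1 \<otimes>\<^bsub>P\<^esub> list_poly L
      = list_poly (rotate_right L) \<oplus>\<^bsub>P\<^esub> (mnm ?c (length L) \<ominus>\<^bsub>P\<^esub> mnm ?c 0)"
  proof (rule up_eqI)
    fix n
    have "cf (mnm \<one> 1 \<otimes>\<^bsub>P\<^esub> list_poly L) n
        = (if n = 0 then \<zero> else if n - 1 < length L then L ! (n - 1) else \<zero>)"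
      using L coeff_var_mult[of "list_poly L" n] by (auto simp del: coeff_mult)
    moreover have "cf (list_poly (rotate_right L) \<oplus>\<^bsub>P\<^esub> (mnm ?c (length L) \<ominus>\<^bsub>P\<^esub> mnm ?c 0)) n
        = (if n < length L then rotate_right L ! n else \<zero>)
          \<oplus> ((if length L = n then ?c else \<zero>) \<ominus> (if n = 0 then ?c else \<zero>))"
      using c L rot by (simp add: P.minus_closed)
    moreover have "n < length L \<Longrightarrow> n > 0 \<Longrightarrow> rotate_right L ! n = L ! (n - 1)"
      by (auto simp: rotate_right_def nth_butlast nth_Cons')
    moreover have "rotate_right L ! 0 = ?c" by (simp add: rotate_right_def)
    moreover have "length L = n \<Longrightarrow> L ! (n - 1) = ?c" using L by (simp add: last_conv_nth)
    moreover have "n < length L \<Longrightarrow> n > 0 \<Longrightarrow> L ! (n - 1) \<in> carrier R" using L by (auto simp: subset_iff)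
    ultimately show "cf (mnm \<one> 1 \<otimes>\<^bsub>P\<^esub> list_poly L) n
        = cf (list_poly (rotate_right L) \<oplus>\<^bsub>P\<^esub> (mnm ?c (length L) \<ominus>\<^bsub>P\<^esub> mnm ?c 0)) n"
      using L c by (auto simp: R.minus_eq R.r_neg)
  qed (use L rot c in \<open>simp_all add: P.minus_closed\<close>)
  then show ?thesis
    unfolding cyc_cong_def using L rot c eq by (intro conjI bexI[of _ "mnm ?c 0"]) simp_all
qed

lemma list_poly_lin_comb:
  assumes "a \<in> carrier R" "set xs \<subseteq> carrier R" "set ys \<subseteq> carrier R" "length xs = length ys"
  shows "list_poly (lin_comb R a xs ys) = list_poly xs \<oplus>\<^bsub>P\<^esub> mnm a 0 \<otimes>\<^bsub>P\<^esub> list_poly ys"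
proof (rule up_eqI)
  fix n
  have "xs ! n \<in> carrier R" "ys ! n \<in> carrier R" if "n < length ys"
    using that assms by (auto simp: subset_iff)
  then show "cf (list_poly (lin_comb R a xs ys)) n
      = cf (list_poly xs \<oplus>\<^bsub>P\<^esub> mnm a 0 \<otimes>\<^bsub>P\<^esub> list_poly ys) n"
    using assms coeff_monom_mult_if[of a "list_poly ys" 0 n] R.lin_comb_closed[OF assms(1-3)]
    by (auto simp: lin_comb_def simp del: coeff_mult)
qed (use assms R.lin_comb_closed[OF assms(1-3)] in simp_all)

text \<open>One step rests on cs + (a + y as) ys = (cs + a ys) + as (y ys), where y ys is congruent
  to the rotated list.\<close>

lemma list_poly_conv_add:
  assumes "set as \<subseteq> carrier R" "set cs \<subseteq> carrier R" "set ys \<subseteq> carrier R" "ys \<noteq> []"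
    "length cs = length ys"
  shows "cyc_cong (length ys) (list_poly cs \<oplus>\<^bsub>P\<^esub> list_poly as \<otimes>\<^bsub>P\<^esub> list_poly ys)
    (list_poly (conv_add R cs as ys))"
  using assms
proof (induction as arbitrary: cs ys)
  case Nil
  then show ?case by (simp add: cyc_cong_refl)
next
  case (Cons a as)
  let ?y = "mnm \<one> 1"
  have c: "list_poly cs \<in> carrier P" "list_poly ys \<in> carrier P" "list_poly as \<in> carrier P"
    "mnm a 0 \<in> carrier P" "?y \<in> carrier P" "list_poly (rotate_right ys) \<in> carrier P"
    using Cons by auto
  have lc: "set (lin_comb R a cs ys) \<subseteq> carrier R" using Cons by (intro R.lin_comb_closed) auto
  have 1: "list_poly cs \<oplus>\<^bsub>P\<^esub> list_poly (a # as) \<otimes>\<^bsub>P\<^esub> list_poly ys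
      = list_poly (lin_comb R a cs ys) \<oplus>\<^bsub>P\<^esub> list_poly as \<otimes>\<^bsub>P\<^esub> (?y \<otimes>\<^bsub>P\<^esub> list_poly ys)"
  proof -
    have "(?y \<otimes>\<^bsub>P\<^esub> list_poly as) \<otimes>\<^bsub>P\<^esub> list_poly ys = list_poly as \<otimes>\<^bsub>P\<^esub> (?y \<otimes>\<^bsub>P\<^esub> list_poly ys)"
      using c by (metis P.m_assoc P.m_comm)
    moreover have "list_poly (lin_comb R a cs ys) = list_poly cs \<oplus>\<^bsub>P\<^esub> mnm a 0 \<otimes>\<^bsub>P\<^esub> list_poly ys"
      using Cons.prems by (intro list_poly_lin_comb) auto
    ultimately show ?thesis
      using c by (simp only: list_poly.simps P.l_distr P.a_assoc P.m_closed)
  qed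
  have 2: "cyc_cong (length ys)
      (list_poly (lin_comb R a cs ys) \<oplus>\<^bsub>P\<^esub> list_poly as \<otimes>\<^bsub>P\<^esub> (?y \<otimes>\<^bsub>P\<^esub> list_poly ys))
      (list_poly (lin_comb R a cs ys) \<oplus>\<^bsub>P\<^esub> list_poly as \<otimes>\<^bsub>P\<^esub> list_poly (rotate_right ys))"
    using Cons c lc by (intro cyc_cong_add cyc_cong_mult list_poly_rotate_right cyc_cong_refl) auto
  have 3: "cyc_cong (length ys)
      (list_poly (lin_comb R a cs ys) \<oplus>\<^bsub>P\<^esub> list_poly as \<otimes>\<^bsub>P\<^esub> list_poly (rotate_right ys))
      (list_poly (conv_add R cs (a # as) ys))"
    using Cons.IH[of "lin_comb R a cs ys" "rotate_right ys"] Cons.prems lc by simp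
  show ?case unfolding 1 by (rule cyc_cong_trans[OF 2 3])
qed

text \<open>Summing the coefficients of a multiple of \<open>y ^ r - 1\<close> along a residue class telescopes.\<close>

lemma folded_coeffs_cyc_mult:
  assumes h: "h \<in> carrier P"
  shows "\<exists>N\<^sub>0. \<forall>N\<ge>N\<^sub>0. \<forall>i<r. (\<Oplus>t\<in>{..<N}. cf (cyc r \<otimes>\<^bsub>P\<^esub> h) (t * r + i)) = \<zero>"
proof (intro exI[of _ "Suc (Suc (deg R h))"] allI impI)
  fix N i assume N: "Suc (Suc (deg R h)) \<le> N" and i: "i < r"
  have eq: "cyc r \<otimes>\<^bsub>P\<^esub> h = mnm \<one> r \<otimes>\<^bsub>P\<^esub> h \<ominus>\<^bsub>P\<^esub> h"
    using h by (simp add: cyc_def P.minus_eq P.l_distr P.l_minus)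
  have coeff: "cf (cyc r \<otimes>\<^bsub>P\<^esub> h) k = (if k < r then \<zero> else cf h (k - r)) \<ominus> cf h k" for k
    unfolding eq using h coeff_monom_mult_if[of \<one> h r k] by (auto simp del: coeff_mult)
  have carr: "cf (cyc r \<otimes>\<^bsub>P\<^esub> h) k \<in> carrier R" for k using h by (intro coeff_closed) simp
  have hc: "cf h k \<in> carrier R" for k using h by simp
  \<comment> \<open>Only the last coefficient of h is left over. For N summands it sits at position
    (N - 1) r + i, beyond the degree of h as soon as N is at least that degree plus 2.\<close>
  have "(\<Oplus>t\<in>{..<Suc n}. cf (cyc r \<otimes>\<^bsub>P\<^esub> h) (t * r + i)) = \<ominus> cf h (n * r + i)" for n
  proof (induction n)
    case 0
    then show ?case using i carr hc by (simp add: coeff lessThan_Suc R.minus_eq del: coeff_mult)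
  next
    case (Suc n)
    have "(\<Oplus>t\<in>{..<Suc (Suc n)}. cf (cyc r \<otimes>\<^bsub>P\<^esub> h) (t * r + i))
        = cf (cyc r \<otimes>\<^bsub>P\<^esub> h) (Suc n * r + i) \<oplus> (\<Oplus>t\<in>{..<Suc n}. cf (cyc r \<otimes>\<^bsub>P\<^esub> h) (t * r + i))"
      unfolding lessThan_Suc[of "Suc n"] using carr by (subst R.finsum_insert) auto
    also have "\<dots> = (cf h (n * r + i) \<ominus> cf h (Suc n * r + i)) \<oplus> \<ominus> cf h (n * r + i)"
      unfolding Suc coeff[of "Suc n * r + i"] by (simp add: add.assoc)
    also have "\<dots> = \<ominus> cf h (Suc n * r + i)"
      using hc[of "n * r + i"] hc[of "Suc n * r + i"] by (simp add: R.minus_eq R.a_ac R.r_neg R.r_neg1 R.r_neg2)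
    finally show ?case .
  qed
  from this[of "N - 1"] have "(\<Oplus>t\<in>{..<N}. cf (cyc r \<otimes>\<^bsub>P\<^esub> h) (t * r + i))
      = \<ominus> cf h ((N - 1) * r + i)" using N by simp
  moreover have "deg R h < (N - 1) * r + i"
  proof -
    have "deg R h < N - 1" using N by simp
    also have "N - 1 \<le> (N - 1) * r + i" using i by (cases r) auto
    finally show ?thesis .
  qed
  then have "cf h ((N - 1) * r + i) = \<zero>" using h by (rule deg_aboveD)
  ultimately show "(\<Oplus>t\<in>{..<N}. cf (cyc r \<otimes>\<^bsub>P\<^esub> h) (t * r + i)) = \<zero>" by simp
qed

text \<open>A multiple of y^r - 1 sums to zero along each residue class of exponents, and a list of
  length r has just one coefficient in each class.\<close>

lemma list_poly_cong_zero:
  assumes L: "set L \<subseteq> carrier R" and cong: "cyc_cong (length L) \<zero>\<^bsub>P\<^esub> (list_poly L)"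
  shows "L = replicate (length L) \<zero>"
proof (rule nth_equalityI)
  fix i assume i: "i < length L"
  obtain h where h: "h \<in> carrier P" "\<zero>\<^bsub>P\<^esub> = list_poly L \<oplus>\<^bsub>P\<^esub> cyc (length L) \<otimes>\<^bsub>P\<^esub> h"
    using cong by (auto simp: cyc_cong_def)
  have "list_poly L \<oplus>\<^bsub>P\<^esub> cyc (length L) \<otimes>\<^bsub>P\<^esub> \<ominus>\<^bsub>P\<^esub> (\<ominus>\<^bsub>P\<^esub> h) = \<zero>\<^bsub>P\<^esub>" using h by simp
  then have eq: "list_poly L = cyc (length L) \<otimes>\<^bsub>P\<^esub> (\<ominus>\<^bsub>P\<^esub> h)"
    using L h by (metis P.minus_equality P.r_minus P.m_closed P.a_inv_closed cyc_closed list_poly_closed P.minus_minus)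
  obtain N\<^sub>0 where N0: "\<And>N. N \<ge> N\<^sub>0 \<Longrightarrow> (\<Oplus>t\<in>{..<N}. cf (list_poly L) (t * length L + i)) = \<zero>"
    using folded_coeffs_cyc_mult[of "\<ominus>\<^bsub>P\<^esub> h" "length L"] h i unfolding eq by auto
  have Li: "L ! i \<in> carrier R" using L i by auto
  have "cf (list_poly L) (t * length L + i) = (if 0 = t then L ! i else \<zero>)" for t
    using L i by (cases t) auto
  then have "(\<Oplus>t\<in>{..<Suc N\<^sub>0}. cf (list_poly L) (t * length L + i)) = (\<Oplus>t\<in>{..<Suc N\<^sub>0}. if 0 = t then L ! i else \<zero>)"
    by presburger
  also have "\<dots> = L ! i" using Li R.finsum_singleton[of 0 "{..<Suc N\<^sub>0}" "\<lambda>_. L ! i"] by simp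
  finally show "L ! i = replicate (length L) \<zero> ! i" using N0[of "Suc N\<^sub>0"] i by simp
qed simp

text \<open>The graph of the canonical homomorphism from Z[y] to R[y].\<close>

definition lifts :: "int poly \<Rightarrow> (nat \<Rightarrow> 'a) \<Rightarrow> bool" where
  "lifts a \<alpha> \<longleftrightarrow> \<alpha> \<in> carrier P \<and> (\<forall>l. cf \<alpha> l = [coeff a l] \<cdot> \<one>)"

lemma add_pow_0: "[(0 :: int)] \<cdot> x = \<zero>"
  by (simp add: add_pow_def)

lemma add_pow_sum:
  fixes z :: "'c \<Rightarrow> int"
  assumes "finite A" "x \<in> carrier R"
  shows "[(\<Sum>i\<in>A. z i)] \<cdot> x = (\<Oplus>i\<in>A. [z i] \<cdot> x)"
  using assms(1)
proof induction
  case (insert i A)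
  then show ?case using assms(2) by (simp add: R.add.int_pow_mult R.add.int_pow_closed)
qed (simp add: add_pow_0)

lemma lifts_mult:
  assumes "lifts a \<alpha>" "lifts b \<beta>"
  shows "lifts (a * b) (\<alpha> \<otimes>\<^bsub>P\<^esub> \<beta>)"
proof -
  have "cf (\<alpha> \<otimes>\<^bsub>P\<^esub> \<beta>) n = [coeff (a * b) n] \<cdot> \<one>" for n
  proof -
    have *: "[y] \<cdot> \<one> \<otimes> [z] \<cdot> \<one> = [(y * z)] \<cdot> \<one>" for y z :: int
      by (simp add: R.add_pow_ldistr_int R.add.int_pow_pow R.add.int_pow_closed mult.commute)
    have "cf (\<alpha> \<otimes>\<^bsub>P\<^esub> \<beta>) n = (\<Oplus>i\<in>{..n}. [(coeff a i * coeff b (n - i))] \<cdot> \<one>)"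
      using assms by (simp add: lifts_def * del: R.add.int_pow_mult)
    then show ?thesis by (simp add: add_pow_sum Polynomial.coeff_mult)
  qed
  then show ?thesis using assms by (simp add: lifts_def)
qed

lemma lifts_one: "lifts 1 \<one>\<^bsub>P\<^esub>"
  by (simp add: lifts_def add_pow_0)

lemma lifts_power: "lifts a \<alpha> \<Longrightarrow> lifts (a ^ n) (\<alpha> [^]\<^bsub>P\<^esub> (n :: nat))"
proof (induction n)
  case (Suc n)
  then show ?case unfolding power_Suc2 P.nat_pow_Suc by (intro lifts_mult) auto
qed (simp add: lifts_one)

text \<open>Substitution of \<alpha> for x. The structure \<open>P\<close> appears in two roles: as
  R[x], to which the circuit polynomial belongs, and as R[y], which contains the points.\<close>

definition eval_at :: "(nat \<Rightarrow> 'a) \<Rightarrow> (nat \<Rightarrow> 'a) \<Rightarrow> nat \<Rightarrow> 'a" where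
  "eval_at \<alpha> = eval R P (\<lambda>a. mnm a 0) \<alpha>"

lemma UP_pre_univ_prop_const: "UP_pre_univ_prop R P (\<lambda>a. mnm a 0)"
proof -
  have "ring_hom_cring R P (\<lambda>a. mnm a 0)"
    using const_ring_hom R.is_cring P.is_cring by (intro ring_hom_cringI) auto
  then show ?thesis
    unfolding UP_pre_univ_prop_def using UP_cring_axioms P_def by auto
qed

lemma eval_at_hom:
  assumes "\<alpha> \<in> carrier P"
  shows "eval_at \<alpha> \<in> ring_hom P P" "a \<in> carrier R \<Longrightarrow> eval_at \<alpha> (mnm a 0) = mnm a 0"
    "eval_at \<alpha> (mnm \<one> 1) = \<alpha>"
  unfolding eval_at_def
  by (fact UP_pre_univ_prop.eval_ring_hom[OF UP_pre_univ_prop_const assms, folded P_def]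
    UP_pre_univ_prop.eval_const[OF UP_pre_univ_prop_const assms, folded P_def]
    UP_pre_univ_prop.eval_monom1[OF UP_pre_univ_prop_const assms, folded P_def])+

text \<open>Powers of a lifted point again come from integer polynomials, so no product of two
  elements of R remains in the result: f enters only through integer multiples of its coefficients.
  This is what opens f(a) to purely additive arguments.\<close>

lemma coeff_eval_at:
  assumes "lifts a \<alpha>" "f \<in> carrier P"
  shows "cf (eval_at \<alpha> f) l = (\<Oplus>n\<in>{..deg R f}. [coeff (a ^ n) l] \<cdot> cf f n)"
proof -
  have \<alpha>: "\<alpha> \<in> carrier P" using assms by (simp add: lifts_def)
  have "cf (eval_at \<alpha> f) l = cf (\<Oplus>\<^bsub>P\<^esub>n\<in>{..deg R f}. mnm (cf f n) 0 \<otimes>\<^bsub>P\<^esub> \<alpha> [^]\<^bsub>P\<^esub> n) l"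
    using assms(2) unfolding eval_at_def eval_def P_def[symmetric] by (simp only: restrict_apply' if_True)
  also have "\<dots> = (\<Oplus>n\<in>{..deg R f}. cf (mnm (cf f n) 0 \<otimes>\<^bsub>P\<^esub> \<alpha> [^]\<^bsub>P\<^esub> n) l)"
    using assms \<alpha> by (intro coeff_finsum) auto
  also have "\<dots> = (\<Oplus>n\<in>{..deg R f}. [coeff (a ^ n) l] \<cdot> cf f n)"
  proof (rule R.finsum_cong'[OF refl])
    fix n
    have "cf (mnm (cf f n) 0 \<otimes>\<^bsub>P\<^esub> \<alpha> [^]\<^bsub>P\<^esub> n) l = cf f n \<otimes> cf (\<alpha> [^]\<^bsub>P\<^esub> n) l"
      using assms \<alpha> coeff_monom_mult_if[of "cf f n" "\<alpha> [^]\<^bsub>P\<^esub> n" 0 l] by (simp del: coeff_mult)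
    also have "\<dots> = cf f n \<otimes> [coeff (a ^ n) l] \<cdot> \<one>"
      using lifts_power[OF assms(1), of n] by (simp add: lifts_def)
    also have "\<dots> = [coeff (a ^ n) l] \<cdot> cf f n"
      using assms by (simp add: R.add_pow_rdistr_int)
    finally show "cf (mnm (cf f n) 0 \<otimes>\<^bsub>P\<^esub> \<alpha> [^]\<^bsub>P\<^esub> n) l = [coeff (a ^ n) l] \<cdot> cf f n" .
  qed (use assms in \<open>auto intro: R.add.int_pow_closed\<close>)
  finally show ?thesis .
qed

text \<open>Evaluation at the point is a ring homomorphism, so each gate preserves the congruence.
  The degree bound doubles from position to position because operands stand at earlier positions and
  2^(n - 1) + 2^(n - 1) = 2^n.\<close>

lemma circuit_invariant:
  assumes C: "circuit R C" and A: "set A \<subseteq> carrier R" "A \<noteq> []" and n: "n \<le> length C"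
  defines "vs \<equiv> circuit_vals R A (take n C)"
    and "ps \<equiv> foldl (\<lambda>ps g. ps @ [gate_poly R ps g]) [] (take n C)"
  shows "length ps = n \<and> (\<forall>i<n. set (vs ! i) \<subseteq> carrier R \<and> length (vs ! i) = length A \<and>
    ps ! i \<in> carrier P \<and> deg R (ps ! i) \<le> 2 ^ i \<and>
    cyc_cong (length A) (eval_at (list_poly A) (ps ! i)) (list_poly (vs ! i)))"
  using n unfolding vs_def ps_def
proof (induction n)
  case (Suc n)
  define vs where "vs = circuit_vals R A (take n C)"
  define ps where "ps = foldl (\<lambda>ps g. ps @ [gate_poly R ps g]) [] (take n C)"
  let ?g = "C ! n"
  have n: "n < length C" using Suc by simp
  have IH: "length ps = n" "\<And>i. i < n \<Longrightarrow> set (vs ! i) \<subseteq> carrier R" "\<And>i. i < n \<Longrightarrow> length (vs ! i) = length A"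
    "\<And>i. i < n \<Longrightarrow> ps ! i \<in> carrier P" "\<And>i. i < n \<Longrightarrow> deg R (ps ! i) \<le> 2 ^ i"
    "\<And>i. i < n \<Longrightarrow> cyc_cong (length A) (eval_at (list_poly A) (ps ! i)) (list_poly (vs ! i))"
    using Suc unfolding vs_def ps_def by simp_all
  have lvs: "length vs = n" using n by (simp add: vs_def)
  have \<alpha>: "list_poly A \<in> carrier P" using A by simp
  note hom = eval_at_hom[OF \<alpha>]
  have homs: "eval_at (list_poly A) (f \<oplus>\<^bsub>P\<^esub> g) = eval_at (list_poly A) f \<oplus>\<^bsub>P\<^esub> eval_at (list_poly A) g"
    "eval_at (list_poly A) (f \<otimes>\<^bsub>P\<^esub> g) = eval_at (list_poly A) f \<otimes>\<^bsub>P\<^esub> eval_at (list_poly A) g"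
    if "f \<in> carrier P" "g \<in> carrier P" for f g
    by (fact ring_hom_add[OF hom(1) that] ring_hom_mult[OF hom(1) that])+
  have gate: "case ?g of Var \<Rightarrow> True | Const a \<Rightarrow> a \<in> carrier R
      | Plus i j \<Rightarrow> i < n \<and> j < n | Times i j \<Rightarrow> i < n \<and> j < n"
    using C n by (simp add: circuit_def)
  let ?v = "gate_val R A vs ?g" and ?p = "gate_poly R ps ?g"
  have pow: "(2::nat) ^ i + 2 ^ j \<le> 2 ^ n" if "i < n" "j < n" for i j
  proof -
    have "(2::nat) ^ i \<le> 2 ^ (n - 1)" "(2::nat) ^ j \<le> 2 ^ (n - 1)"
      using that by (auto intro!: power_increasing)
    moreover have "(2::nat) ^ n = 2 ^ (n - 1) + 2 ^ (n - 1)" using that by (cases n) auto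
    ultimately show ?thesis by linarith
  qed
  have new: "set ?v \<subseteq> carrier R \<and> length ?v = length A \<and> ?p \<in> carrier P \<and> deg R ?p \<le> 2 ^ n \<and>
    cyc_cong (length A) (eval_at (list_poly A) ?p) (list_poly ?v)"
  proof (cases ?g)
    case Var
    have "deg R (mnm \<one> 1) \<le> 1" by (rule deg_monom_le) simp
    also have "1 \<le> (2::nat) ^ n" by simp
    finally have "deg R (mnm \<one> 1) \<le> 2 ^ n" .
    then show ?thesis using Var A hom \<alpha> by (simp add: cyc_cong_refl flip: P_def)
  next
    case (Const a)
    then have a: "a \<in> carrier R" using gate by simp
    have v: "set (a # replicate (length A - 1) \<zero>) \<subseteq> carrier R" using a by auto
    have "list_poly (a # replicate (length A - 1) \<zero>) = mnm a 0"
      by (rule up_eqI) (use a v in \<open>simp_all add: coeff_list_poly[OF v] nth_Cons' del: list_poly.simps\<close>)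
    then show ?thesis using Const a v A hom(2)[OF a] by (simp add: cyc_cong_refl flip: P_def)
  next
    case (Plus i j)
    then have ij: "i < n" "j < n" using gate by simp_all
    have "list_poly ?v = list_poly (vs ! i) \<oplus>\<^bsub>P\<^esub> list_poly (vs ! j)"
      using Plus ij IH by (simp add: list_poly_lin_comb)
    moreover have "deg R (ps ! i \<oplus>\<^bsub>P\<^esub> ps ! j) \<le> max (deg R (ps ! i)) (deg R (ps ! j))"
      using ij IH by simp
    then have "deg R (ps ! i \<oplus>\<^bsub>P\<^esub> ps ! j) \<le> 2 ^ n"
      using IH(5)[OF ij(1)] IH(5)[OF ij(2)] pow[OF ij] by linarith
    ultimately show ?thesis
      using Plus ij IH R.lin_comb_closed[of \<one> "vs ! i" "vs ! j"]
      by (simp add: homs cyc_cong_add flip: P_def)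
  next
    case (Times i j)
    then have ij: "i < n" "j < n" using gate by simp_all
    let ?z = "replicate (length A) \<zero>"
    have sz: "set ?z \<subseteq> carrier R" by auto
    have z: "list_poly ?z = \<zero>\<^bsub>P\<^esub>"
      by (rule up_eqI) (simp_all only: coeff_list_poly[OF sz] list_poly_closed[OF sz] coeff_zero UP_zero_closed
        length_replicate nth_replicate if_cancel cong: if_cong)
    have ne: "vs ! j \<noteq> []" using IH(3)[OF ij(2)] A by auto
    have c: "list_poly (vs ! i) \<in> carrier P" "list_poly (vs ! j) \<in> carrier P" using IH ij by auto
    have "cyc_cong (length A) (eval_at (list_poly A) (ps ! i) \<otimes>\<^bsub>P\<^esub> eval_at (list_poly A) (ps ! j))
      (list_poly (vs ! i) \<otimes>\<^bsub>P\<^esub> list_poly (vs ! j))"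
      using IH ij by (intro cyc_cong_mult) auto
    moreover have "cyc_cong (length A) (list_poly (vs ! i) \<otimes>\<^bsub>P\<^esub> list_poly (vs ! j)) (list_poly ?v)"
      using list_poly_conv_add[of "vs ! i" ?z "vs ! j", OF IH(2)[OF ij(1)] sz IH(2)[OF ij(2)] ne]
        IH(3)[OF ij(2)] c Times z by simp
    ultimately have "cyc_cong (length A) (eval_at (list_poly A) (ps ! i) \<otimes>\<^bsub>P\<^esub> eval_at (list_poly A) (ps ! j)) (list_poly ?v)"
      by (rule cyc_cong_trans)
    moreover have "deg R (ps ! i \<otimes>\<^bsub>P\<^esub> ps ! j) \<le> deg R (ps ! i) + deg R (ps ! j)"
      using ij IH by (intro deg_mult_ring) auto
    then have "deg R (ps ! i \<otimes>\<^bsub>P\<^esub> ps ! j) \<le> 2 ^ n"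
      using IH(5)[OF ij(1)] IH(5)[OF ij(2)] pow[OF ij] by linarith
    ultimately show ?thesis
      using Times ij IH ne sz R.conv_add_closed[of "vs ! i" ?z "vs ! j"]
      by (simp add: homs flip: P_def)
  qed
  have "circuit_vals R A (take (Suc n) C) = vs @ [?v]"
    using n by (simp add: take_Suc_conv_app_nth circuit_vals_snoc vs_def)
  moreover have "foldl (\<lambda>ps g. ps @ [gate_poly R ps g]) [] (take (Suc n) C) = ps @ [?p]"
    using n by (simp add: take_Suc_conv_app_nth ps_def)
  moreover have "set ((vs @ [?v]) ! i) \<subseteq> carrier R \<and> length ((vs @ [?v]) ! i) = length A \<and>
    (ps @ [?p]) ! i \<in> carrier P \<and> deg R ((ps @ [?p]) ! i) \<le> 2 ^ i \<and>
    cyc_cong (length A) (eval_at (list_poly A) ((ps @ [?p]) ! i)) (list_poly ((vs @ [?v]) ! i))"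
    if "i < Suc n" for i
  proof (cases "i = n")
    case True
    then have "(vs @ [?v]) ! i = ?v" "(ps @ [?p]) ! i = ?p"
      using lvs IH(1) by (simp_all add: nth_append)
    then show ?thesis using new True by (simp only:)
  next
    case False
    then have i: "i < n" using that by simp
    then have "(vs @ [?v]) ! i = vs ! i" "(ps @ [?p]) ! i = ps ! i"
      using lvs IH(1) by (simp_all add: nth_append)
    then show ?thesis using IH(2-)[OF i] by (simp only:)
  qed
  ultimately show ?case using IH(1) by simp
qed simp

lemma circuit_correct:
  assumes C: "circuit R C" and A: "set A \<subseteq> carrier R" "A \<noteq> []"
  defines "v \<equiv> last (circuit_vals R A C)"
  shows "set v \<subseteq> carrier R" "length v = length A"
    "circuit_poly R C \<in> carrier P" "deg R (circuit_poly R C) \<le> 2 ^ length C"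
    "cyc_cong (length A) (eval_at (list_poly A) (circuit_poly R C)) (list_poly v)"
proof -
  let ?n = "length C - 1"
  let ?ps = "foldl (\<lambda>ps g. ps @ [gate_poly R ps g]) [] C"
  note inv = circuit_invariant[OF C A order.refl, simplified]
  have n: "?n < length C" using C by (cases C) (auto simp: circuit_def)
  have "circuit_vals R A C \<noteq> []" using n length_circuit_vals[of R A C] by force
  then have v: "v = circuit_vals R A C ! ?n" by (simp add: v_def last_conv_nth)
  have "length ?ps = length C" by (rule inv[THEN conjunct1])
  moreover from this have "?ps \<noteq> []" using n by force
  ultimately have f: "circuit_poly R C = ?ps ! ?n" by (simp add: circuit_poly_def last_conv_nth)
  note inv' = inv[THEN conjunct2, rule_format, OF n, folded v f]
  show "set v \<subseteq> carrier R" "length v = length A"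
    "circuit_poly R C \<in> carrier P"
    "cyc_cong (length A) (eval_at (list_poly A) (circuit_poly R C)) (list_poly v)"
    using inv' by simp_all
  have "deg R (circuit_poly R C) \<le> 2 ^ ?n" using inv' by simp
  also have "(2::nat) ^ ?n \<le> 2 ^ length C" by (intro power_increasing) auto
  finally show "deg R (circuit_poly R C) \<le> 2 ^ length C" .
qed

text \<open>The computed list is congruent to the value of the zero polynomial, and a list of length
  r congruent to zero is zero; so the program makes no error on this side.\<close>

lemma circuit_zero_complete:
  assumes C: "circuit R C" and A: "set A \<subseteq> carrier R" "A \<noteq> []" and zero: "circuit_poly R C = \<zero>\<^bsub>P\<^esub>"
  shows "last (circuit_vals R A C) = replicate (length A) \<zero>"
proof -
  note v = circuit_correct[OF C A]
  have "eval_at (list_poly A) \<zero>\<^bsub>P\<^esub> = \<zero>\<^bsub>P\<^esub>"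
    using A by (intro ring_hom_zero[OF eval_at_hom(1) P.ring_axioms P.ring_axioms]) simp
  then show ?thesis using list_poly_cong_zero[OF v(1)] v(2,5) zero by simp
qed

end

lemma circuit_vals_closed:
  assumes "cring R" "circuit R C" "set A \<subseteq> carrier R" "A \<noteq> []" "n \<le> length C" "i < n"
  shows "set (circuit_vals R A (take n C) ! i) \<subseteq> carrier R \<and> length (circuit_vals R A (take n C) ! i) = length A"
proof -
  interpret UP_cring R "UP R" using assms(1) by (simp_all add: UP_cring_def)
  show ?thesis using circuit_invariant[OF assms(2-5)] assms(6) by blast
qed

lemma pcompose_sum_monom:
  fixes a :: "'a :: comm_ring_1 poly"
  shows "(\<Sum>n\<in>A. monom (u n) n) \<circ>\<^sub>p a = (\<Sum>n\<in>A. smult (u n) (a ^ n))"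
proof -
  have "(\<Sum>n\<in>A. monom (u n) n) \<circ>\<^sub>p a = (\<Sum>n\<in>A. monom (u n) n \<circ>\<^sub>p a)"
    by (rule pcompose_sum)
  moreover have "monom c n \<circ>\<^sub>p a = smult c (a ^ n)" for c n
    by (simp add: pcompose_altdef map_poly_monom poly_monom)
  ultimately show ?thesis by simp
qed

section \<open>Few points annihilate a non-zero polynomial\<close>

context UP_cring
begin

lemma lifts_point:
  "lifts (monom 1 n * bits_poly es) (list_poly (point R n es))"
proof -
  have set: "set (point R n es) \<subseteq> carrier R" by (auto simp: point_def)
  have "cf (list_poly (point R n es)) i = [coeff (monom 1 n * bits_poly es) i] \<cdot> \<one>" for i
    using coeff_list_poly[OF set, of i]
    by (auto simp: Polynomial.coeff_monom_mult coeff_bits_poly point_def nth_append add_pow_0)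
  then show ?thesis using set by (simp add: lifts_def)
qed

text \<open>For a point that passes, f(a) is a multiple of y^r - 1 in R[y], so its coefficients sum
  to zero along residue classes. \<open>\<rho>\<close> transports these sums to the coefficients of
  F(a), turning zero in R into divisibility by p; what remains is to count roots of F in a residue
  field of Z[y].\<close>

lemma circuit_nonzero_sound:
  fixes m k b :: nat
  assumes fin: "finite (carrier R)" and card: "card (carrier R) \<le> 2 ^ m"
    and C: "circuit R C" and ne: "circuit_poly R C \<noteq> \<zero>\<^bsub>P\<^esub>"
    and k: "k > 0" and b: "m * k * k \<le> b" "b \<ge> 3"
  shows "\<exists>r. k \<le> r \<and> r \<le> 2 * b + 1 \<and>
    card {es. length es = k \<and> last (circuit_vals R (point R (r - k) es) C) = replicate r \<zero>}
      \<le> 2 ^ length C"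
proof -
  define f where "f = circuit_poly R C"
  define d where "d = deg R f"
  have f: "f \<in> carrier P" and d: "d \<le> 2 ^ length C"
    using circuit_correct(3,4)[OF C, of "[\<zero>]"] by (simp_all add: f_def d_def)
  obtain n\<^sub>0 where n0: "cf f n\<^sub>0 \<noteq> \<zero>"
    using ne f up_eqI[of f "\<zero>\<^bsub>P\<^esub>"] by (auto simp: f_def)
  obtain p N :: nat and u :: "nat \<Rightarrow> int" and \<rho> :: "'a \<Rightarrow> int \<Rightarrow> bool"
    where p: "Factorial_Ring.prime p" "p \<le> card (carrier R)" and uN: "u N = 1"
    and \<rho>_add: "\<And>a b z z'. \<rho> a z \<Longrightarrow> \<rho> b z' \<Longrightarrow> \<rho> (a \<oplus> b) (z + z')"
    and \<rho>_pow: "\<And>a z k. \<rho> a z \<Longrightarrow> \<rho> ([(k :: int)] \<cdot> a) (k * z)"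
    and \<rho>_0: "\<rho> \<zero> 0" and \<rho>_f: "\<And>n. \<rho> (cf f n) (u n)"
    and \<rho>_dvd: "\<And>z. \<rho> \<zero> z \<Longrightarrow> int p dvd z"
    using R.add.exists_prime_functional[of "cf f" n\<^sub>0] fin f n0 by (metis coeff_closed)
  have \<rho>_sum: "\<rho> (\<Oplus>i\<in>A. g i) (\<Sum>i\<in>A. z i)"
    if "finite A" "\<And>i. i \<in> A \<Longrightarrow> g i \<in> carrier R" "\<And>i. i \<in> A \<Longrightarrow> \<rho> (g i) (z i)"
    for A :: "nat set" and g z
    using that
  proof (induction A)
    case (insert i A)
    then have "finsum R g (insert i A) = g i \<oplus> finsum R g A" by (intro R.finsum_insert) auto
    then show ?case using insert by (simp add: \<rho>_add)
  qed (simp add: \<rho>_0)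
  \<comment> \<open>Coefficients beyond the degree are zero, which forces p to divide their
    exponents. Since \<open>u N = 1\<close>, cutting F off at d keeps a coefficient that p does not
    divide.\<close>
  have N: "N \<le> d"
  proof (rule ccontr)
    assume "\<not> N \<le> d"
    then have "cf f N = \<zero>" using f by (simp add: d_def deg_aboveD)
    then have "int p dvd 1" using \<rho>_f[of N] \<rho>_dvd[of 1] uN by simp
    then show False using prime_gt_1_nat[OF p(1)] by simp
  qed
  define F where "F = (\<Sum>n\<le>d. monom (u n) n)"
  have coeffF: "coeff F n = (if n \<le> d then u n else 0)" for n
    by (simp add: F_def coeff_sum)
  have degF: "degree F \<le> d" by (intro degree_le) (simp add: coeffF)
  obtain l j where l: "Factorial_Ring.prime l" "l \<noteq> p" and j: "j \<ge> 1"
    and r: "l ^ j \<le> 2 * b + 1" and ord: "\<forall>i\<in>{1..<k}. \<not> l ^ j dvd p ^ i - 1"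
    using exists_prime_power_large_order[OF p(1) _ b] p(2) card by (meson order.trans)
  have kr: "k \<le> l ^ j" by (rule order_bound_le[OF p(1) l j ord])
  define a where "a es = monom 1 (l ^ j - k) * bits_poly es" for es
  define B where "B = {es. length es = k \<and>
    last (circuit_vals R (point R (l ^ j - k) es) C) = replicate (l ^ j) \<zero>}"
  have "\<exists>M. degree (F \<circ>\<^sub>p a es) < M * l ^ j \<and>
      (\<forall>i<l ^ j. int p dvd (\<Sum>t<M. coeff (F \<circ>\<^sub>p a es) (t * l ^ j + i)))" if es: "es \<in> B" for es
  proof -
    define A where "A = point R (l ^ j - k) es"
    have A: "set A \<subseteq> carrier R" "length A = l ^ j" "A \<noteq> []"
      using es kr k by (auto simp: A_def B_def point_def)
    have lifts: "lifts (a es) (list_poly A)" unfolding a_def A_def by (rule lifts_point)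
    have fA: "eval_at (list_poly A) f \<in> carrier P"
      using A by (intro Ring.ring_hom_closed[OF eval_at_hom(1) f]) simp
    \<comment> \<open>The same integer combination is formed twice: of the coefficients
      \<open>cf f n\<close> and of the integers \<open>u n\<close>.\<close>
    have \<rho>_eval: "\<rho> (cf (eval_at (list_poly A) f) i) (coeff (F \<circ>\<^sub>p a es) i)" for i
    proof -
      have "\<rho> (\<Oplus>n\<in>{..d}. [coeff (a es ^ n) i] \<cdot> cf f n) (\<Sum>n\<le>d. coeff (a es ^ n) i * u n)"
        using f by (intro \<rho>_sum \<rho>_pow \<rho>_f R.add.int_pow_closed coeff_closed) auto
      then show ?thesis
        unfolding coeff_eval_at[OF lifts f] F_def pcompose_sum_monom
        by (simp add: d_def coeff_sum mult.commute)
    qed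
    have z: "set (replicate (l ^ j) \<zero>) \<subseteq> carrier R" by auto
    have "list_poly (replicate (l ^ j) \<zero>) = \<zero>\<^bsub>P\<^esub>"
      by (rule up_eqI) (simp_all only: coeff_list_poly[OF z] list_poly_closed[OF z] coeff_zero UP_zero_closed
        length_replicate nth_replicate if_cancel cong: if_cong)
    then have "cyc_cong (l ^ j) (eval_at (list_poly A) f) \<zero>\<^bsub>P\<^esub>"
      using circuit_correct(5)[OF C A(1,3)] es A(2) by (simp add: f_def B_def A_def)
    then obtain h where h: "h \<in> carrier P" "eval_at (list_poly A) f = cyc (l ^ j) \<otimes>\<^bsub>P\<^esub> h"
      by (auto simp: cyc_cong_def)
    obtain M\<^sub>0 where M0: "\<And>M i. M \<ge> M\<^sub>0 \<Longrightarrow> i < l ^ j \<Longrightarrow>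
        (\<Oplus>t\<in>{..<M}. cf (eval_at (list_poly A) f) (t * l ^ j + i)) = \<zero>"
      using folded_coeffs_cyc_mult[OF h(1), of "l ^ j"] unfolding h(2)[symmetric] by blast
    \<comment> \<open>Large enough both for the sums in R to have telescoped and for all of F(a) to
      be covered; as an integer polynomial, F(a) may have a larger degree than f(a).\<close>
    define M where "M = max M\<^sub>0 (Suc (degree (F \<circ>\<^sub>p a es)))"
    have "degree (F \<circ>\<^sub>p a es) < M * 1" by (simp add: M_def)
    also have "\<dots> \<le> M * l ^ j" using kr k by (intro mult_le_mono2) simp
    finally have "degree (F \<circ>\<^sub>p a es) < M * l ^ j" .
    moreover have "int p dvd (\<Sum>t<M. coeff (F \<circ>\<^sub>p a es) (t * l ^ j + i))" if i: "i < l ^ j" for i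
    proof (rule \<rho>_dvd)
      have "\<rho> (\<Oplus>t\<in>{..<M}. cf (eval_at (list_poly A) f) (t * l ^ j + i))
          (\<Sum>t<M. coeff (F \<circ>\<^sub>p a es) (t * l ^ j + i))"
        using fA by (intro \<rho>_sum \<rho>_eval) auto
      moreover have "(\<Oplus>t\<in>{..<M}. cf (eval_at (list_poly A) f) (t * l ^ j + i)) = \<zero>"
        by (rule M0) (simp_all add: M_def i)
      ultimately show "\<rho> \<zero> (\<Sum>t<M. coeff (F \<circ>\<^sub>p a es) (t * l ^ j + i))" by simp
    qed
    ultimately show ?thesis by blast
  qed
  then obtain M where M: "\<And>es. es \<in> B \<Longrightarrow> degree (F \<circ>\<^sub>p a es) < M es * l ^ j"
    "\<And>es i. es \<in> B \<Longrightarrow> i < l ^ j \<Longrightarrow> int p dvd (\<Sum>t<M es. coeff (F \<circ>\<^sub>p a es) (t * l ^ j + i))"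
    by metis
  have "card B \<le> d"
  proof (rule card_bits_roots_le[OF p(1) l j k ord _ degF, where n = N])
    show "\<not> int p dvd coeff F N" using N uN prime_gt_1_nat[OF p(1)] by (simp add: coeffF)
  qed (use M in \<open>simp_all only: a_def\<close>, simp add: B_def)
  then show ?thesis using kr r d unfolding B_def by (intro exI[of _ "l ^ j"]) auto
qed

end

section \<open>Resource-bounded execution\<close>

text \<open>In each iteration \<open>x\<close> holds the suffix still to be processed, so the
  current element is its head. The list is copied from \<open>y\<close>, which is why one register
  can drive several nested loops.\<close>

definition foreach :: "nat \<Rightarrow> nat \<Rightarrow> com \<Rightarrow> com" where
  "foreach x y c = Seq (Assign x (Reg y)) (While x (Seq c (Assign x (Tl (Reg x)))))"

text \<open>
  A time bound for runs in which every tree written has size at most \<open>S\<close> and every loop traverses a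
  list stored in such a tree, hence makes at most \<open>S\<close> iterations.
\<close>

primrec cost :: "nat \<Rightarrow> com \<Rightarrow> nat" where
  "cost S (Assign x e) = 1 + S"
| "cost S (QueryAdd x y z) = 1 + 3 * S"
| "cost S (QueryMult x y z) = 1 + 3 * S"
| "cost S (Toss x) = 1"
| "cost S (Seq c d) = cost S c + cost S d"
| "cost S (IfElse x c d) = 1 + cost S c + cost S d"
| "cost S (While x c) = 1 + S * (1 + cost S c)"

text \<open>For a fixed program the nesting depth of the loops is a constant, and each level
  contributes one more factor S.\<close>

lemma cost_poly: "\<exists>q :: nat poly. \<forall>S. poly q S = cost S c"
proof (induction c)
  case (Assign x e)
  show ?case by (intro exI[of _ "[:1, 1:]"]) simp
next
  case (QueryAdd x y z)
  show ?case by (intro exI[of _ "[:1, 3:]"]) simp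
next
  case (QueryMult x y z)
  show ?case by (intro exI[of _ "[:1, 3:]"]) simp
next
  case (Toss x)
  show ?case by (intro exI[of _ 1]) simp
next
  case (Seq c d)
  then obtain q q' where "\<forall>S. poly q S = cost S c" "\<forall>S. poly q' S = cost S d" by blast
  then show ?case by (intro exI[of _ "q + q'"]) simp
next
  case (IfElse x c d)
  then obtain q q' where "\<forall>S. poly q S = cost S c" "\<forall>S. poly q' S = cost S d" by blast
  then show ?case by (intro exI[of _ "1 + q + q'"]) simp
next
  case (While x c)
  then obtain q where "\<forall>S. poly q S = cost S c" by blast
  then show ?case by (intro exI[of _ "1 + [:0, 1:] * (1 + q)"]) simp
qed

text \<open>Total correctness in the style of weakest preconditions, with the time limit fixed by
  the shape of the program. Proofs about programs then only bound sizes of trees; the arithmetic of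
  running times is done once, in the rules below.\<close>

definition runs ::
    "bool list ring \<Rightarrow> nat \<Rightarrow> com \<Rightarrow> state \<Rightarrow> bool list \<Rightarrow> (state \<Rightarrow> bool list \<Rightarrow> bool) \<Rightarrow> bool" where
  "runs R S c s r Q \<longleftrightarrow> (\<exists>t s' r'. exec R c (s, r) t (s', r') \<and> t \<le> cost S c \<and> Q s' r')"

lemma runs_mono:
  assumes "runs R S c s r Q" "\<And>s' r'. Q s' r' \<Longrightarrow> Q' s' r'"
  shows "runs R S c s r Q'"
  using assms unfolding runs_def by blast

lemma runs_Assign:
  assumes "size (eval_expr e s) \<le> S" "Q (s(x := eval_expr e s)) r"
  shows "runs R S (Assign x e) s r Q"
  unfolding runs_def using assms exec.Assign[OF refl, where R = R and e = e and s = s and x = x and r = r] by fastforce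

lemma runs_QueryAdd:
  assumes "s y = tree_of_string a" "s z = tree_of_string b"
    "size (tree_of_string a) \<le> S" "size (tree_of_string b) \<le> S" "size (tree_of_string (a \<oplus>\<^bsub>R\<^esub> b)) \<le> S"
    "Q (s(x := tree_of_string (a \<oplus>\<^bsub>R\<^esub> b))) r"
  shows "runs R S (QueryAdd x y z) s r Q"
  unfolding runs_def
  using assms exec.QueryAdd[OF refl, where R = R and s = s and x = x and y = y and z = z and r = r]
  by (intro exI[of _ "1 + size (s y) + size (s z) + size (tree_of_string (a \<oplus>\<^bsub>R\<^esub> b))"]
        exI[of _ "s(x := tree_of_string (a \<oplus>\<^bsub>R\<^esub> b))"] exI[of _ r]) simp

lemma runs_QueryMult:
  assumes "s y = tree_of_string a" "s z = tree_of_string b"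
    "size (tree_of_string a) \<le> S" "size (tree_of_string b) \<le> S" "size (tree_of_string (a \<otimes>\<^bsub>R\<^esub> b)) \<le> S"
    "Q (s(x := tree_of_string (a \<otimes>\<^bsub>R\<^esub> b))) r"
  shows "runs R S (QueryMult x y z) s r Q"
  unfolding runs_def
  using assms exec.QueryMult[OF refl, where R = R and s = s and x = x and y = y and z = z and r = r]
  by (intro exI[of _ "1 + size (s y) + size (s z) + size (tree_of_string (a \<otimes>\<^bsub>R\<^esub> b))"]
        exI[of _ "s(x := tree_of_string (a \<otimes>\<^bsub>R\<^esub> b))"] exI[of _ r]) simp

lemma runs_Toss:
  assumes "Q (s(x := tree_of_bit b)) r"
  shows "runs R S (Toss x) s (b # r) Q"
  unfolding runs_def using assms exec.Toss[of R x s b r] by fastforce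

lemma runs_Seq:
  assumes "runs R S c s r (\<lambda>s' r'. runs R S d s' r' Q)"
  shows "runs R S (Seq c d) s r Q"
  using assms unfolding runs_def by (fastforce intro: exec.Seq add_mono)

lemma runs_IfElse:
  assumes "s x \<noteq> Leaf \<Longrightarrow> runs R S c s r Q" "s x = Leaf \<Longrightarrow> runs R S d s r Q"
  shows "runs R S (IfElse x c d) s r Q"
proof (cases "s x = Leaf")
  case True
  with assms(2) obtain t s' r' where "exec R d (s, r) t (s', r')" "t \<le> cost S d" "Q s' r'"
    by (auto simp: runs_def)
  with exec.IfFalse[of s x R d r t s' r' c] True show ?thesis unfolding runs_def by fastforce
next
  case False
  with assms(1) obtain t s' r' where "exec R c (s, r) t (s', r')" "t \<le> cost S c" "Q s' r'"
    by (auto simp: runs_def)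
  with exec.IfTrue[of s x R c r t s' r' d] False show ?thesis unfolding runs_def by fastforce
qed

lemma size_tree_of_list: "size (tree_of_list ts) = (\<Sum>t\<leftarrow>ts. Suc (size t))"
  by (induction ts) auto

lemma length_le_size_tree_of_list: "length ts \<le> size (tree_of_list ts)"
  by (induction ts) auto

lemma right_tree_of_list [simp]: "right (tree_of_list ts) = tree_of_list (tl ts)"
  by (cases ts) auto

lemma left_tree_of_list: "left (tree_of_list ts) = (if ts = [] then Leaf else hd ts)"
  by (cases ts) auto

lemma left_tree_of_list_drop [simp]: "i < length ts \<Longrightarrow> left (tree_of_list (drop i ts)) = ts ! i"
  by (simp add: left_tree_of_list hd_drop_conv_nth)

lemma tree_of_list_eq_Leaf [simp]: "tree_of_list ts = Leaf \<longleftrightarrow> ts = []"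
  by (cases ts) auto

lemma sum_list_take_le:
  fixes f :: "'a \<Rightarrow> nat"
  shows "(\<Sum>t\<leftarrow>take i ts. f t) \<le> (\<Sum>t\<leftarrow>ts. f t)"
  by (metis append_take_drop_id le_add1 map_append sum_list_append)

lemma sum_list_drop_le:
  fixes f :: "'a \<Rightarrow> nat"
  shows "(\<Sum>t\<leftarrow>drop i ts. f t) \<le> (\<Sum>t\<leftarrow>ts. f t)"
  by (metis append_take_drop_id le_add2 map_append sum_list_append)

lemma size_tree_of_list_rev_take: "size (tree_of_list (rev (take i ts))) \<le> size (tree_of_list ts)"
  unfolding size_tree_of_list rev_map[symmetric] sum_list_rev by (rule sum_list_take_le)

lemma size_tree_of_list_drop: "size (tree_of_list (drop i ts)) \<le> size (tree_of_list ts)"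
  unfolding size_tree_of_list by (rule sum_list_drop_le)

text \<open>The body has to preserve \<open>x\<close>, and the invariant for the next index is
  demanded after \<open>x\<close> has been advanced, that is, in the entry state of the next
  iteration. A list is no longer than its tree is large, so at most S iterations occur, as
  \<open>cost\<close> presumes.\<close>

lemma runs_foreach:
  assumes sy: "s y = tree_of_list ts" and S: "size (tree_of_list ts) \<le> S"
    and I0: "I 0 (s(x := tree_of_list ts)) r"
    and step: "\<And>i s r. i < length ts \<Longrightarrow> I i s r \<Longrightarrow> s x = tree_of_list (drop i ts) \<Longrightarrow>
      runs R S c s r (\<lambda>s' r'. s' x = tree_of_list (drop i ts) \<and>
        I (Suc i) (s'(x := tree_of_list (drop (Suc i) ts))) r')"
    and Q: "\<And>s r. I (length ts) s r \<Longrightarrow> s x = Leaf \<Longrightarrow> Q s r"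
  shows "runs R S (foreach x y c) s r Q"
proof -
  let ?body = "Seq c (Assign x (Tl (Reg x)))"
  have loop: "\<exists>t s' r'. exec R (While x ?body) (s, r) t (s', r') \<and>
      t \<le> 1 + (length ts - i) * (1 + cost S ?body) \<and> Q s' r'"
    if "i \<le> length ts" "I i s r" "s x = tree_of_list (drop i ts)" for i s r
    using that
  proof (induction "length ts - i" arbitrary: i s r)
    case 0
    then have "I (length ts) s r" "s x = Leaf" by auto
    then show ?case using Q exec.WhileFalse[of s x R ?body r] by fastforce
  next
    case (Suc n)
    then have i: "i < length ts" by simp
    obtain t s' r' where 1: "exec R c (s, r) t (s', r')" "t \<le> cost S c"
      and s'x: "s' x = tree_of_list (drop i ts)" and I: "I (Suc i) (s'(x := tree_of_list (drop (Suc i) ts))) r'"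
      using step[OF i Suc.prems(2,3)] by (auto simp: runs_def)
    let ?v = "tree_of_list (drop (Suc i) ts)"
    have v: "eval_expr (Tl (Reg x)) s' = ?v" using s'x by (simp add: drop_Suc tl_drop)
    have 2: "exec R ?body (s, r) (t + (1 + size ?v)) (s'(x := ?v), r')"
      using exec.Seq[OF 1(1) exec.Assign[OF refl, where e = "Tl (Reg x)" and x = x]] unfolding v .
    have "n = length ts - Suc i" using Suc by simp
    from Suc.hyps(1)[OF this _ I] i obtain u s'' r'' where
      3: "exec R (While x ?body) (s'(x := ?v), r') u (s'', r'')"
      "u \<le> 1 + (length ts - Suc i) * (1 + cost S ?body)" "Q s'' r''" by auto
    have "s x \<noteq> Leaf" using Suc.prems(3) i by simp
    from exec.WhileTrue[OF this 2 3(1)]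
    have "exec R (While x ?body) (s, r) (1 + (t + (1 + size ?v)) + u) (s'', r'')" .
    moreover have "size ?v \<le> S" using size_tree_of_list_drop S order.trans by blast
    then have "t + (1 + size ?v) \<le> cost S ?body" using 1(2) by simp
    moreover have "(length ts - i) * (1 + cost S ?body)
        = (1 + cost S ?body) + (length ts - Suc i) * (1 + cost S ?body)"
      using i by (metis Suc_diff_Suc mult_Suc)
    ultimately show ?case using 3(2,3)
      by (intro exI[of _ "1 + (t + (1 + size ?v)) + u"] exI[of _ s''] exI[of _ r'']) linarith
  qed
  obtain t s' r' where 1: "exec R (While x ?body) (s(x := tree_of_list ts), r) t (s', r')"
      "t \<le> 1 + length ts * (1 + cost S ?body)" "Q s' r'"
    using loop[of 0 "s(x := tree_of_list ts)" r] I0 by auto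
  have "length ts \<le> S" using length_le_size_tree_of_list S order.trans by blast
  then have "length ts * (1 + cost S ?body) \<le> S * (1 + cost S ?body)" by (rule mult_le_mono1)
  then have "t \<le> 1 + S * (1 + cost S ?body)" using 1(2) by linarith
  then have "t \<le> cost S (While x ?body)" by simp
  then have "(1 + size (tree_of_list ts)) + t \<le> cost S (foreach x y c)"
    using S by (simp add: foreach_def)
  moreover have "exec R (Assign x (Reg y)) (s, r) (1 + size (tree_of_list ts)) (s(x := tree_of_list ts), r)"
    by (rule exec.Assign) (simp add: sy)
  from exec.Seq[OF this 1(1)]
  have "exec R (foreach x y c) (s, r) ((1 + size (tree_of_list ts)) + t) (s', r')"
    unfolding foreach_def .
  ultimately show ?thesis unfolding runs_def using 1(3) by blast
qed

lemma size_tree_of_string: "size (tree_of_string w) \<le> 2 * length w"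
proof (induction w)
  case (Cons b w)
  then show ?case by (cases b) (simp_all add: tree_of_string_def)
qed (simp add: tree_of_string_def)


section \<open>The program\<close>

text \<open>
  Registers: 1 and 2 hold \<open>\<zero>\<close> and \<open>\<one>\<close>, 3 the gates, 4 the number \<open>w\<close>, 5 the point of evaluation, 6
  the zero of the convolution ring, 7 the values of the gates processed so far (latest first) and 8
  the verdict. The operands of an operation are expected in 14 (or 16) and 15, a scalar in 18, and the
  result is left in 16. Loops run over the registers 10, 17, 21, 30, 32, 40, 41 and 50 to 53.
\<close>

definition rev_com :: "nat \<Rightarrow> nat \<Rightarrow> com" where
  "rev_com x y = Seq (Assign x Null) (foreach 30 y (Assign x (Pair (Hd (Reg 30)) (Reg x))))"

lemma runs_rev_com:
  assumes y: "s y = tree_of_list ts" and S: "size (tree_of_list ts) \<le> S"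
    and xy: "x \<noteq> y" "x \<noteq> 30" "y \<noteq> 30"
    and Q: "\<And>s'. s' x = tree_of_list (rev ts) \<Longrightarrow> (\<And>z. z \<noteq> x \<Longrightarrow> z \<noteq> 30 \<Longrightarrow> s' z = s z) \<Longrightarrow> Q s' r"
  shows "runs R S (rev_com x y) s r Q"
  unfolding rev_com_def
proof (intro runs_Seq runs_Assign)
  show "runs R S (foreach 30 y (Assign x (Pair (Hd (Reg 30)) (Reg x)))) (s(x := eval_expr Null s)) r Q"
  proof (rule runs_foreach[where ts = ts and I = "\<lambda>i s' r'. r' = r \<and>
      s' x = tree_of_list (rev (take i ts)) \<and> (\<forall>z. z \<noteq> x \<and> z \<noteq> 30 \<longrightarrow> s' z = s z)"])
    fix i s' r' assume i: "i < length ts" and I: "r' = r \<and> s' x = tree_of_list (rev (take i ts)) \<and>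
        (\<forall>z. z \<noteq> x \<and> z \<noteq> 30 \<longrightarrow> s' z = s z)"
      and t: "s' 30 = tree_of_list (drop i ts)"
    have v: "eval_expr (Pair (Hd (Reg 30)) (Reg x)) s' = tree_of_list (rev (take (Suc i) ts))"
      using i I t by (simp add: take_Suc_conv_app_nth)
    show "runs R S (Assign x (Pair (Hd (Reg 30)) (Reg x))) s' r'
      (\<lambda>s'a r'a. s'a 30 = tree_of_list (drop i ts) \<and> r'a = r \<and>
        (s'a(30 := tree_of_list (drop (Suc i) ts))) x = tree_of_list (rev (take (Suc i) ts)) \<and>
        (\<forall>z. z \<noteq> x \<and> z \<noteq> 30 \<longrightarrow> (s'a(30 := tree_of_list (drop (Suc i) ts))) z = s z))"
      by (rule runs_Assign; unfold v)
        (use size_tree_of_list_rev_take[of "Suc i" ts] S xy I t in auto)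
  next
    fix s' r' assume "r' = r \<and> s' x = tree_of_list (rev (take (length ts) ts)) \<and>
        (\<forall>z. z \<noteq> x \<and> z \<noteq> 30 \<longrightarrow> s' z = s z)"
    then show "Q s' r'" using Q by simp
  qed (use y xy S in auto)
qed simp

text \<open>Values are stored latest first while gate positions count from the start; hence the
  reversal, after which the unary position itself drives the loop that skips entries.\<close>

definition lookup_com :: "nat \<Rightarrow> nat \<Rightarrow> com" where
  "lookup_com x i = Seq (rev_com 31 7) (Seq (foreach 32 i (Assign 31 (Tl (Reg 31)))) (Assign x (Hd (Reg 31))))"

lemma runs_lookup_com:
  assumes V: "s 7 = tree_of_list (rev vs)" "size (tree_of_list vs) \<le> S"
    and i: "s i = tree_of_nat n" "n < length vs" "i \<notin> {30, 31, 32}"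
    and Q: "\<And>s'. s' x = vs ! n \<Longrightarrow> (\<And>z. z \<notin> {x, 30, 31, 32} \<Longrightarrow> s' z = s z) \<Longrightarrow> Q s' r"
  shows "runs R S (lookup_com x i) s r Q"
  unfolding lookup_com_def
proof (intro runs_Seq, rule runs_rev_com[where s = s and y = 7 and ts = "rev vs"])
  show "s 7 = tree_of_list (rev vs)" by (rule V(1))
  have sz: "size (tree_of_list (rev vs)) = size (tree_of_list vs)"
    by (simp add: size_tree_of_list rev_map[symmetric])
  show "size (tree_of_list (rev vs)) \<le> S" using V(2) sz by simp
  fix s1 assume s1: "s1 31 = tree_of_list (rev (rev vs))" "\<And>z. z \<noteq> 31 \<Longrightarrow> z \<noteq> 30 \<Longrightarrow> s1 z = s z"
  have "n \<le> size (tree_of_list vs)" using i length_le_size_tree_of_list[of vs] by linarith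
  then have nS: "size (tree_of_list (replicate n Leaf)) \<le> S"
    using V(2) by (simp add: size_tree_of_list sum_list_replicate)
  show "runs R S (Seq (foreach 32 i (Assign 31 (Tl (Reg 31)))) (Assign x (Hd (Reg 31)))) s1 r Q"
  proof (rule runs_Seq, rule runs_foreach[where ts = "replicate n Leaf" and I = "\<lambda>j s' r'. r' = r \<and>
      s' 31 = tree_of_list (drop j vs) \<and> (\<forall>z. z \<notin> {30, 31, 32} \<longrightarrow> s' z = s z)"])
    fix j s' r' assume j: "j < length (replicate n Leaf)" and I: "r' = r \<and>
      s' 31 = tree_of_list (drop j vs) \<and> (\<forall>z. z \<notin> {30, 31, 32} \<longrightarrow> s' z = s z)"
      and t: "s' 32 = tree_of_list (drop j (replicate n Leaf))"
    have v: "eval_expr (Tl (Reg 31)) s' = tree_of_list (drop (Suc j) vs)"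
      using I by (simp add: drop_Suc tl_drop)
    show "runs R S (Assign 31 (Tl (Reg 31))) s' r'
          (\<lambda>s'a r'a. s'a 32 = tree_of_list (drop j (replicate n Leaf)) \<and> r'a = r \<and>
            (s'a(32 := tree_of_list (drop (Suc j) (replicate n Leaf)))) 31 = tree_of_list (drop (Suc j) vs) \<and>
            (\<forall>z. z \<notin> {30, 31, 32} \<longrightarrow> (s'a(32 := tree_of_list (drop (Suc j) (replicate n Leaf)))) z = s z))"
      by (rule runs_Assign; unfold v)
        (use size_tree_of_list_drop[of "Suc j" vs] V(2) I t in auto)
  next
    fix s' r' assume *: "r' = r \<and> s' 31 = tree_of_list (drop (length (replicate n Leaf)) vs) \<and>
      (\<forall>z. z \<notin> {30, 31, 32} \<longrightarrow> s' z = s z)"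
    then have v: "eval_expr (Hd (Reg 31)) s' = vs ! n" using i by simp
    have "size (vs ! n) \<le> size (tree_of_list vs)"
      using i(2) member_le_sum_list[of "Suc (size (vs ! n))" "map (\<lambda>t. Suc (size t)) vs"]
      by (simp add: size_tree_of_list)
    then show "runs R S (Assign x (Hd (Reg 31))) s' r' Q"
      by (intro runs_Assign; unfold v) (use V(2) * in \<open>auto intro!: Q\<close>)
  qed (use s1 i nS in \<open>auto simp: tree_of_nat_def\<close>)
qed auto

definition enc :: "bool list list \<Rightarrow> dtree" where
  "enc xs = tree_of_list (map tree_of_string xs)"

text \<open>The result grows by consing and therefore backwards, in register 20, until the final
  reversal. Register 22 runs along the second vector in step with the loop over the first.\<close>

definition lincomb_com :: com where
  "lincomb_com = Seq (Assign 20 Null) (Seq (Assign 22 (Reg 15)) (Seq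
    (foreach 21 16
      (Seq (Assign 23 (Hd (Reg 21))) (Seq (Assign 24 (Hd (Reg 22))) (Seq (QueryMult 24 18 24)
      (Seq (QueryAdd 23 23 24) (Seq (Assign 20 (Pair (Reg 23) (Reg 20))) (Assign 22 (Tl (Reg 22)))))))))
    (rev_com 16 20)))"

definition rot_com :: com where
  "rot_com = Seq (rev_com 31 15) (Seq (Assign 33 (Hd (Reg 31))) (Seq (Assign 31 (Tl (Reg 31)))
    (Seq (rev_com 15 31) (Assign 15 (Pair (Reg 33) (Reg 15))))))"

definition conv_com :: com where
  "conv_com = Seq (Assign 16 (Reg 6)) (foreach 17 14 (Seq (Assign 18 (Hd (Reg 17))) (Seq lincomb_com rot_com)))"

definition add_com :: com where
  "add_com = Seq (Assign 16 (Reg 14)) (Seq (Assign 18 (Reg 2)) lincomb_com)"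

text \<open>The unary tag in register 11 is tested and decremented: 0 is the variable, 1 a constant,
  and after two decrements an empty tag means addition, a non-empty one multiplication. A constant
  is followed by the tail of the zero vector, which gives it the right length.\<close>

definition gate_com :: com where
  "gate_com = Seq (Assign 11 (Hd (Hd (Reg 10)))) (IfElse 11
    (Seq (Assign 11 (Tl (Reg 11))) (IfElse 11
      (Seq (Assign 11 (Tl (Reg 11)))
        (Seq (Assign 12 (Hd (Tl (Hd (Reg 10))))) (Seq (Assign 13 (Hd (Tl (Tl (Hd (Reg 10))))))
        (Seq (lookup_com 14 12) (Seq (lookup_com 15 13) (IfElse 11 conv_com add_com))))))
      (Assign 16 (Pair (Hd (Tl (Hd (Reg 10)))) (Tl (Reg 6))))))
    (Assign 16 (Reg 5)))"

definition eval_com :: com where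
  "eval_com = Seq (Assign 7 Null) (foreach 10 3 (Seq gate_com (Assign 7 (Pair (Reg 16) (Reg 7)))))"

text \<open>Every entry is compared bit by bit with the string for zero, whose remaining bits are in
  register 42. A mismatch clears register 8 for good; an assignment to register 46 stands for doing
  nothing.\<close>

definition check_com :: com where
  "check_com = Seq (Assign 14 (Hd (Reg 7))) (foreach 40 14 (Seq (Assign 42 (Reg 1)) (Seq (Assign 45 (Hd (Reg 40)))
    (foreach 41 45 (Seq (Assign 43 (Hd (Reg 41))) (Seq (Assign 44 (Hd (Reg 42)))
      (Seq (IfElse 43 (IfElse 44 (Assign 46 Null) (Assign 8 Null)) (IfElse 44 (Assign 8 Null) (Assign 46 Null)))
        (Assign 42 (Tl (Reg 42))))))))))"

text \<open>Prepending a zero multiplies the point by y, and it lengthens the point and the zero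
  vector by one. The next round thus works with r + 1 in place of r, without new coins.\<close>

definition round_com :: com where
  "round_com = Seq eval_com (Seq check_com (Seq (Assign 5 (Pair (Reg 1) (Reg 5))) (Assign 6 (Pair (Reg 1) (Reg 6)))))"

section \<open>Vector operations and gates\<close>

locale program_run =
  fixes R :: "bool list ring" and m K S :: nat
  assumes R: "ring_by_oracle R m" and K: "K > 0" "K * (2 * m + 1) \<le> S"
begin

text \<open>The vectors that fit the size bound: K elements with trees of size at most 2m, each in
  one list cell, make up K (2m + 1) \<le> S.\<close>

definition vec :: "bool list list \<Rightarrow> bool" where
  "vec xs \<longleftrightarrow> set xs \<subseteq> carrier R \<and> length xs \<le> K"

lemma size_string: "a \<in> carrier R \<Longrightarrow> size (tree_of_string a) \<le> 2 * m"
  using R size_tree_of_string[of a] by (auto simp: ring_by_oracle_def)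

lemma size_string_le: "a \<in> carrier R \<Longrightarrow> size (tree_of_string a) \<le> S"
proof -
  assume "a \<in> carrier R"
  then have "size (tree_of_string a) \<le> 1 * (2 * m + 1)" using size_string[of a] by simp
  also have "\<dots> \<le> K * (2 * m + 1)" using K by (intro mult_le_mono1) simp
  finally show ?thesis using K by simp
qed

lemma size_enc: "vec xs \<Longrightarrow> size (enc xs) \<le> K * (2 * m + 1)"
proof -
  assume xs: "vec xs"
  have "size (enc xs) = (\<Sum>a\<leftarrow>xs. Suc (size (tree_of_string a)))"
    by (simp add: enc_def size_tree_of_list comp_def)
  also have "\<dots> \<le> (\<Sum>a\<leftarrow>xs. 2 * m + 1)"
    using xs size_string by (intro sum_list_mono) (auto simp: vec_def)
  also have "\<dots> = length xs * (2 * m + 1)" by (simp add: sum_list_triv)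
  also have "\<dots> \<le> K * (2 * m + 1)" using xs by (intro mult_le_mono1) (simp add: vec_def)
  finally show ?thesis .
qed

lemma size_enc_le: "vec xs \<Longrightarrow> size (enc xs) \<le> S"
  using size_enc K order.trans by blast

lemma vec_rev [simp]: "vec (rev xs) = vec xs" by (simp add: vec_def)
lemma vec_take: "vec xs \<Longrightarrow> vec (take i xs)" by (auto simp: vec_def dest: in_set_takeD)
lemma vec_drop: "vec xs \<Longrightarrow> vec (drop i xs)" by (auto simp: vec_def dest: in_set_dropD)

lemma right_enc [simp]: "right (enc xs) = enc (tl xs)" by (simp add: enc_def map_tl)
lemma left_enc_drop: "i < length xs \<Longrightarrow> left (enc (drop i xs)) = tree_of_string (xs ! i)"
  by (simp add: enc_def drop_map[symmetric])
lemma Node_enc [simp]: "Node (tree_of_string a) (enc xs) = enc (a # xs)" by (simp add: enc_def)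
lemma enc_Nil: "enc [] = Leaf" by (simp add: enc_def)

lemma runs_rev_com_enc:
  assumes "s y = enc xs" "vec xs" "x \<noteq> y" "x \<noteq> 30" "y \<noteq> 30"
    and "\<And>s'. s' x = enc (rev xs) \<Longrightarrow> (\<And>z. z \<noteq> x \<Longrightarrow> z \<noteq> 30 \<Longrightarrow> s' z = s z) \<Longrightarrow> Q s' r"
  shows "runs R S (rev_com x y) s r Q"
  using assms size_enc_le[of xs] by (intro runs_rev_com[where ts = "map tree_of_string xs"]) (auto simp: enc_def rev_map)

lemma cring: "cring R" using R by (simp add: ring_by_oracle_def)

lemma runs_lincomb_com:
  assumes s: "s 16 = enc cs" "s 15 = enc ys" "s 18 = tree_of_string a"
    and vec: "a \<in> carrier R" "vec cs" "vec ys" "length cs = length ys"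
    and Q: "\<And>s'. s' 16 = enc (lin_comb R a cs ys) \<Longrightarrow>
      (\<And>z. z \<notin> {16, 20, 21, 22, 23, 24, 30} \<Longrightarrow> s' z = s z) \<Longrightarrow> Q s' r"
  shows "runs R S lincomb_com s r Q"
proof -
  interpret cring R by (rule cring)
  let ?L = "lin_comb R a cs ys"
  have carr: "cs ! i \<in> carrier R" "ys ! i \<in> carrier R" if "i < length cs" for i
    using that vec by (auto simp: vec_def)
  have L: "vec ?L" using vec lin_comb_closed by (simp add: vec_def)
  have Li: "?L ! i = cs ! i \<oplus>\<^bsub>R\<^esub> a \<otimes>\<^bsub>R\<^esub> ys ! i" if "i < length cs" for i
    using that vec by (simp add: lin_comb_def)
  show ?thesis
    unfolding lincomb_com_def
  proof (intro runs_Seq runs_Assign)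
    let ?s = "s(20 := eval_expr Null s, 22 := eval_expr (Reg 15) (s(20 := eval_expr Null s)))"
    let ?body = "Seq (Assign 23 (Hd (Reg 21))) (Seq (Assign 24 (Hd (Reg 22))) (Seq (QueryMult 24 18 24)
      (Seq (QueryAdd 23 23 24) (Seq (Assign 20 (Pair (Reg 23) (Reg 20))) (Assign 22 (Tl (Reg 22)))))))"
    show "runs R S (foreach 21 16 ?body) ?s r (\<lambda>s' r'. runs R S (rev_com 16 20) s' r' Q)"
    proof (rule runs_foreach[where ts = "map tree_of_string cs" and I = "\<lambda>i s' r'. r' = r \<and>
        s' 20 = enc (rev (take i ?L)) \<and> s' 22 = enc (drop i ys) \<and>
        (\<forall>z. z \<notin> {20, 21, 22, 23, 24, 30} \<longrightarrow> s' z = s z)"])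
      fix i s' r' assume "i < length (map tree_of_string cs)" and I: "r' = r \<and>
        s' 20 = enc (rev (take i ?L)) \<and> s' 22 = enc (drop i ys) \<and>
        (\<forall>z. z \<notin> {20, 21, 22, 23, 24, 30} \<longrightarrow> s' z = s z)"
        and t: "s' 21 = tree_of_list (drop i (map tree_of_string cs))"
      then have i: "i < length cs" "i < length ys" "i < length ?L" using vec by simp_all
      have h: "left (s' 21) = tree_of_string (cs ! i)" "left (s' 22) = tree_of_string (ys ! i)"
        using t I i by (simp_all add: left_enc_drop)
      have tk: "rev (take (Suc i) ?L) = (cs ! i \<oplus>\<^bsub>R\<^esub> a \<otimes>\<^bsub>R\<^esub> ys ! i) # rev (take i ?L)"
        using i Li by (simp add: take_Suc_conv_app_nth)
      have sz: "size (enc (rev (take (Suc i) ?L))) \<le> S" "size (enc (drop (Suc i) ys)) \<le> S"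
        using L vec by (auto intro!: size_enc_le vec_take vec_drop)
      have s18: "s' 18 = tree_of_string a" using I s by simp
      have tl: "tl (drop i ys) = drop (Suc i) ys" by (simp add: drop_Suc tl_drop)
      show "runs R S ?body s' r' (\<lambda>s'' r''. s'' 21 = tree_of_list (drop i (map tree_of_string cs)) \<and> r'' = r \<and>
            (s''(21 := tree_of_list (drop (Suc i) (map tree_of_string cs)))) 20 = enc (rev (take (Suc i) ?L)) \<and>
            (s''(21 := tree_of_list (drop (Suc i) (map tree_of_string cs)))) 22 = enc (drop (Suc i) ys) \<and>
            (\<forall>z. z \<notin> {20, 21, 22, 23, 24, 30} \<longrightarrow>
              (s''(21 := tree_of_list (drop (Suc i) (map tree_of_string cs)))) z = s z))"
        apply (intro runs_Seq runs_Assign)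
          apply (simp_all add: h size_string_le carr i)
        apply (rule runs_QueryMult[where a = a and b = "ys ! i"])
             apply (simp_all add: s18 size_string_le carr i vec)
        apply (intro runs_Seq)
        apply (rule runs_QueryAdd[where a = "cs ! i" and b = "a \<otimes>\<^bsub>R\<^esub> ys ! i"])
             apply (simp_all add: size_string_le carr i vec)
        apply (intro runs_Seq runs_Assign)
        using sz I t by (simp_all add: tk tl)
    next
      fix s1 r1 assume *: "r1 = r \<and> s1 20 = enc (rev (take (length (map tree_of_string cs)) ?L)) \<and>
        s1 22 = enc (drop (length (map tree_of_string cs)) ys) \<and>
        (\<forall>z. z \<notin> {20, 21, 22, 23, 24, 30} \<longrightarrow> s1 z = s z)"
      then have "s1 20 = enc (rev ?L)" using vec by simp
      then show "runs R S (rev_com 16 20) s1 r1 Q"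
      proof (rule runs_rev_com_enc)
        fix s2 assume s2: "s2 16 = enc (rev (rev ?L))" "\<And>z. z \<noteq> 16 \<Longrightarrow> z \<noteq> 30 \<Longrightarrow> s2 z = s1 z"
        have "s2 z = s z" if "z \<notin> {16, 20, 21, 22, 23, 24, 30}" for z
          using s2(2)[of z] * that by auto
        then show "Q s2 r1" using Q s2(1) * by simp
      qed (use L in auto)
    qed (use s vec size_enc_le[of cs] in \<open>auto simp: enc_def\<close>)
  qed (use s vec size_enc_le[of ys] in auto)
qed

lemma runs_rot_com:
  assumes s: "s 15 = enc ys" "vec ys" "ys \<noteq> []"
    and Q: "\<And>s'. s' 15 = enc (rotate_right ys) \<Longrightarrow>
      (\<And>z. z \<notin> {15, 30, 31, 33} \<Longrightarrow> s' z = s z) \<Longrightarrow> Q s' r"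
  shows "runs R S rot_com s r Q"
  unfolding rot_com_def
proof (rule runs_Seq, rule runs_rev_com_enc[where xs = ys])
  fix s1 assume s1: "s1 31 = enc (rev ys)" "\<And>z. z \<noteq> 31 \<Longrightarrow> z \<noteq> 30 \<Longrightarrow> s1 z = s z"
  have l: "left (enc (rev ys)) = tree_of_string (last ys)"
    using s by (simp add: enc_def left_tree_of_list hd_rev last_map flip: rev_map)
  have t: "tl (rev ys) = rev (butlast ys)" by (metis butlast_rev rev_rev_ident rev_swap)
  have last: "last ys \<in> carrier R" using s by (auto simp: vec_def)
  have bl: "vec (butlast ys)" using s by (auto simp: vec_def dest: in_set_butlastD)
  show "runs R S (Seq (Assign 33 (Hd (Reg 31))) (Seq (Assign 31 (Tl (Reg 31)))
      (Seq (rev_com 15 31) (Assign 15 (Pair (Reg 33) (Reg 15)))))) s1 r Q"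
  proof (intro runs_Seq runs_Assign)
    show "size (eval_expr (Hd (Reg 31)) s1) \<le> S" using s1 l last by (simp add: size_string_le)
    show "size (eval_expr (Tl (Reg 31)) (s1(33 := eval_expr (Hd (Reg 31)) s1))) \<le> S"
      using s1 t bl by (simp add: size_enc_le)
    show "runs R S (rev_com 15 31) (s1(33 := eval_expr (Hd (Reg 31)) s1,
        31 := eval_expr (Tl (Reg 31)) (s1(33 := eval_expr (Hd (Reg 31)) s1)))) r
        (\<lambda>s' r'. runs R S (Assign 15 (Pair (Reg 33) (Reg 15))) s' r' Q)"
    proof (rule runs_rev_com_enc[where xs = "rev (butlast ys)"])
      fix s2 assume s2: "s2 15 = enc (rev (rev (butlast ys)))"
        "\<And>z. z \<noteq> 15 \<Longrightarrow> z \<noteq> 30 \<Longrightarrow> s2 z = (s1(33 := eval_expr (Hd (Reg 31)) s1,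
        31 := eval_expr (Tl (Reg 31)) (s1(33 := eval_expr (Hd (Reg 31)) s1)))) z"
      then have v: "eval_expr (Pair (Reg 33) (Reg 15)) s2 = enc (rotate_right ys)"
        using s1 l by (simp add: rotate_right_def)
      have fr: "s2 z = s z" if "z \<notin> {15, 30, 31, 33}" for z
        using s2(2)[of z] s1(2)[of z] that by simp
      have "size (enc (rotate_right ys)) \<le> S"
        using s by (intro size_enc_le) (simp add: vec_def)
      moreover have "Q (s2(15 := enc (rotate_right ys))) r" by (rule Q) (simp_all add: fr)
      ultimately show "runs R S (Assign 15 (Pair (Reg 33) (Reg 15))) s2 r Q"
        by (intro runs_Assign; unfold v)
    qed (use s1 t bl in auto)
  qed
qed (use s in auto)

text \<open>The loop invariant describes prefixes of \<open>as\<close>, while the recursion peels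
  off the first element; this is the update of the invariant in one iteration.\<close>

lemma conv_add_append: "conv_add R cs (as @ [a]) ys
    = lin_comb R a (conv_add R cs as ys) ((rotate_right ^^ length as) ys)"
  by (induction as arbitrary: cs ys) (simp_all add: funpow_swap1)

lemma vec_funpow_rotate_right:
  "vec ys \<Longrightarrow> ys \<noteq> [] \<Longrightarrow> vec ((rotate_right ^^ n) ys) \<and> (rotate_right ^^ n) ys \<noteq> [] \<and>
    length ((rotate_right ^^ n) ys) = length ys"
  by (induction n) (auto simp: vec_def)

lemma runs_conv_com:
  assumes s: "s 6 = enc cs" "s 14 = enc as" "s 15 = enc ys"
    and vec: "vec cs" "vec as" "vec ys" "ys \<noteq> []" "length cs = length ys"
    and Q: "\<And>s'. s' 16 = enc (conv_add R cs as ys) \<Longrightarrow>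
      (\<And>z. z \<notin> {15, 16, 17, 18, 20, 21, 22, 23, 24, 30, 31, 33} \<Longrightarrow> s' z = s z) \<Longrightarrow> Q s' r"
  shows "runs R S conv_com s r Q"
  unfolding conv_com_def
proof (intro runs_Seq runs_Assign)
  let ?body = "Seq (Assign 18 (Hd (Reg 17))) (Seq lincomb_com rot_com)"
  let ?X = "{15, 16, 17, 18, 20, 21, 22, 23, 24, 30, 31, 33} :: nat set"
  show "size (eval_expr (Reg 6) s) \<le> S" using s vec by (simp add: size_enc_le)
  show "runs R S (foreach 17 14 ?body) (s(16 := eval_expr (Reg 6) s)) r Q"
  proof (rule runs_foreach[where ts = "map tree_of_string as" and I = "\<lambda>i s' r'. r' = r \<and>
        s' 16 = enc (conv_add R cs (take i as) ys) \<and> s' 15 = enc ((rotate_right ^^ i) ys) \<and>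
        (\<forall>z. z \<notin> ?X \<longrightarrow> s' z = s z)"])
    fix i s' r' assume "i < length (map tree_of_string as)"
      and I: "r' = r \<and> s' 16 = enc (conv_add R cs (take i as) ys) \<and>
        s' 15 = enc ((rotate_right ^^ i) ys) \<and> (\<forall>z. z \<notin> ?X \<longrightarrow> s' z = s z)"
      and t: "s' 17 = tree_of_list (drop i (map tree_of_string as))"
    then have i: "i < length as" by simp
    have ai: "as ! i \<in> carrier R" using i vec by (auto simp: vec_def)
    have l: "left (s' 17) = tree_of_string (as ! i)" using t i by simp
    note rot = vec_funpow_rotate_right[OF vec(3,4), of i]
    have "vec (take i as)" using vec by (intro vec_take)
    then have c: "vec (conv_add R cs (take i as) ys)" "length (conv_add R cs (take i as) ys) = length ys"
      using cring.conv_add_closed[OF cring, of "take i as" cs ys] vec by (auto simp: vec_def)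
    show "runs R S ?body s' r' (\<lambda>s'' r''. s'' 17 = tree_of_list (drop i (map tree_of_string as)) \<and> r'' = r \<and>
        (s''(17 := tree_of_list (drop (Suc i) (map tree_of_string as)))) 16 = enc (conv_add R cs (take (Suc i) as) ys) \<and>
        (s''(17 := tree_of_list (drop (Suc i) (map tree_of_string as)))) 15 = enc ((rotate_right ^^ Suc i) ys) \<and>
        (\<forall>z. z \<notin> ?X \<longrightarrow> (s''(17 := tree_of_list (drop (Suc i) (map tree_of_string as)))) z = s z))"
    proof (intro runs_Seq runs_Assign)
      show "size (eval_expr (Hd (Reg 17)) s') \<le> S" using l ai by (simp add: size_string_le)
      show "runs R S lincomb_com (s'(18 := eval_expr (Hd (Reg 17)) s')) r' (\<lambda>s'a r'a. runs R S rot_com s'a r'a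
        (\<lambda>s'' r''. s'' 17 = tree_of_list (drop i (map tree_of_string as)) \<and> r'' = r \<and>
        (s''(17 := tree_of_list (drop (Suc i) (map tree_of_string as)))) 16 = enc (conv_add R cs (take (Suc i) as) ys) \<and>
        (s''(17 := tree_of_list (drop (Suc i) (map tree_of_string as)))) 15 = enc ((rotate_right ^^ Suc i) ys) \<and>
        (\<forall>z. z \<notin> ?X \<longrightarrow> (s''(17 := tree_of_list (drop (Suc i) (map tree_of_string as)))) z = s z)))"
      proof (rule runs_lincomb_com[where a = "as ! i" and cs = "conv_add R cs (take i as) ys"
            and ys = "(rotate_right ^^ i) ys"], goal_cases)
        case (8 s1)
        have "s1 15 = enc ((rotate_right ^^ i) ys)" using 8(2)[of 15] I by simp
        then show ?case
        proof (rule runs_rot_com, goal_cases)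
          case (3 s2)
          have "s2 16 = enc (conv_add R cs (take (Suc i) as) ys)"
            using 3(2)[of 16] 8(1) i by (simp add: take_Suc_conv_app_nth conv_add_append)
          moreover have "s2 z = s z" if "z \<notin> ?X" for z
            using 3(2)[of z] 8(2)[of z] I that by auto
          moreover have "s2 17 = tree_of_list (drop i (map tree_of_string as))"
            using 3(2)[of 17] 8(2)[of 17] t by simp
          ultimately show ?case using 3(1) I by simp
        qed (use rot in auto)
      qed (use I l ai rot c in auto)
    qed
  next
    fix s' r' assume "r' = r \<and> s' 16 = enc (conv_add R cs (take (length (map tree_of_string as)) as) ys) \<and>
        s' 15 = enc ((rotate_right ^^ length (map tree_of_string as)) ys) \<and> (\<forall>z. z \<notin> ?X \<longrightarrow> s' z = s z)"
    then show "Q s' r'" using Q by simp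
  qed (use s vec size_enc_le[of as] in \<open>auto simp: enc_def\<close>)
qed

lemma runs_add_com:
  assumes s: "s 2 = tree_of_string \<one>\<^bsub>R\<^esub>" "s 14 = enc cs" "s 15 = enc ys"
    and vec: "vec cs" "vec ys" "length cs = length ys"
    and Q: "\<And>s'. s' 16 = enc (lin_comb R \<one>\<^bsub>R\<^esub> cs ys) \<Longrightarrow>
      (\<And>z. z \<notin> {16, 18, 20, 21, 22, 23, 24, 30} \<Longrightarrow> s' z = s z) \<Longrightarrow> Q s' r"
  shows "runs R S add_com s r Q"
proof -
  interpret cring R by (rule cring)
  show ?thesis
    unfolding add_com_def
  proof (intro runs_Seq runs_Assign)
    show "runs R S lincomb_com (s(16 := eval_expr (Reg 14) s,
        18 := eval_expr (Reg 2) (s(16 := eval_expr (Reg 14) s)))) r Q"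
    proof (rule runs_lincomb_com[where a = "\<one>\<^bsub>R\<^esub>" and cs = cs and ys = ys], goal_cases)
      case (8 s')
      then show ?case by (intro Q) simp_all
    qed (use s vec in auto)
  qed (use s vec in \<open>simp_all add: size_enc_le size_string_le\<close>)
qed

lemma runs_gate_com:
  assumes s: "s 2 = tree_of_string \<one>\<^bsub>R\<^esub>" "s 5 = enc A" "s 6 = enc (replicate (length A) \<zero>\<^bsub>R\<^esub>)"
      "s 7 = tree_of_list (rev (map enc vs))" "left (s 10) = tree_of_gate g"
    and vec: "vec A" "A \<noteq> []" "\<And>i. i < length vs \<Longrightarrow> vec (vs ! i) \<and> length (vs ! i) = length A"
    and S: "size (tree_of_list (map enc vs)) \<le> S" "size (tree_of_gate g) \<le> S"
    and g: "case g of Var \<Rightarrow> True | Const a \<Rightarrow> a \<in> carrier R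
      | Plus i j \<Rightarrow> i < length vs \<and> j < length vs | Times i j \<Rightarrow> i < length vs \<and> j < length vs"
    and Q: "\<And>s'. s' 16 = enc (gate_val R A vs g) \<Longrightarrow> (\<And>z. z \<notin> {11..33} \<Longrightarrow> s' z = s z) \<Longrightarrow> Q s' r"
  shows "runs R S gate_com s r Q"
proof -
  interpret cring R by (rule cring)
  have zeros: "vec (replicate n \<zero>\<^bsub>R\<^esub>)" if "n \<le> length A" for n
    using vec that by (auto simp: vec_def)
  let ?binary = "Seq (Assign 12 (Hd (Tl (Hd (Reg 10))))) (Seq (Assign 13 (Hd (Tl (Tl (Hd (Reg 10))))))
        (Seq (lookup_com 14 12) (Seq (lookup_com 15 13) (IfElse 11 conv_com add_com))))"
  \<comment> \<open>Addition and multiplication share the code that fetches the operands; the rest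
    of the tag in register 11 decides between them only afterwards.\<close>
  have binary: "runs R S ?binary s1 r Q"
    if ij: "left (right (left (s1 10))) = tree_of_nat i" "left (right (right (left (s1 10)))) = tree_of_nat j"
      "i < length vs" "j < length vs"
      and nat: "size (tree_of_nat i) \<le> S" "size (tree_of_nat j) \<le> S"
      and s1: "\<And>z. z \<noteq> 11 \<Longrightarrow> s1 z = s z"
      and v: "gate_val R A vs g = (if s1 11 = Leaf then lin_comb R \<one>\<^bsub>R\<^esub> (vs ! i) (vs ! j)
        else conv_add R (replicate (length A) \<zero>\<^bsub>R\<^esub>) (vs ! i) (vs ! j))"
    for s1 i j
  proof (intro runs_Seq runs_Assign)
    let ?s2 = "s1(12 := eval_expr (Hd (Tl (Hd (Reg 10)))) s1)"
    let ?s3 = "?s2(13 := eval_expr (Hd (Tl (Tl (Hd (Reg 10))))) ?s2)"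
    show "size (eval_expr (Hd (Tl (Hd (Reg 10)))) s1) \<le> S"
      "size (eval_expr (Hd (Tl (Tl (Hd (Reg 10))))) ?s2) \<le> S" using ij nat by simp_all
    show "runs R S (lookup_com 14 12) ?s3 r (\<lambda>s' r'. runs R S (Seq (lookup_com 15 13) (IfElse 11 conv_com add_com)) s' r' Q)"
    proof (rule runs_lookup_com[where vs = "map enc vs" and n = i], goal_cases)
      case (6 s4)
      show ?case
      proof (rule runs_Seq, rule runs_lookup_com[where vs = "map enc vs" and n = j], goal_cases)
        case (6 s5)
        have 14: "s5 14 = enc (vs ! i)" using 6(2)[of 14] \<open>s4 14 = _\<close> ij by simp
        have 15: "s5 15 = enc (vs ! j)" using 6(1) ij by simp
        have fr: "s5 z = s1 z" if "z \<notin> {12..33}" for z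
        proof -
          from that have "z \<notin> {15, 30, 31, 32}" "z \<notin> {14, 30, 31, 32}" "z \<noteq> 12" "z \<noteq> 13" by auto
          then show ?thesis
            using 6(2)[of z] \<open>\<And>z. z \<notin> {14, 30, 31, 32} \<Longrightarrow> s4 z = _ z\<close>[of z] by simp
        qed
        have fr': "s5 z = s z" if "z \<notin> {11..33}" for z
        proof -
          from that have "z \<notin> {12..33}" "z \<noteq> 11" by auto
          then show ?thesis using fr[of z] s1[of z] by simp
        qed
        show ?case
        proof (rule runs_IfElse)
          assume "s5 11 \<noteq> Leaf"
          then have v: "gate_val R A vs g = conv_add R (replicate (length A) \<zero>\<^bsub>R\<^esub>) (vs ! i) (vs ! j)"
            using v fr[of 11] by simp
          have 6: "s5 6 = enc (replicate (length A) \<zero>\<^bsub>R\<^esub>)" using fr'[of 6] s by simp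
          show "runs R S conv_com s5 r Q"
          proof (rule runs_conv_com[OF 6 14 15], goal_cases)
            case (6 s6)
            have "s6 z = s z" if "z \<notin> {11..33}" for z
            proof -
              from that have "z \<notin> {15, 16, 17, 18, 20, 21, 22, 23, 24, 30, 31, 33}" by auto
              then show ?thesis using 6(2)[of z] fr'[OF that] by simp
            qed
            then show ?case using 6(1) v by (intro Q) simp_all
          qed (use vec(3)[OF ij(3)] vec(3)[OF ij(4)] vec(2) zeros in auto)
        next
          assume "s5 11 = Leaf"
          then have v: "gate_val R A vs g = lin_comb R \<one>\<^bsub>R\<^esub> (vs ! i) (vs ! j)"
            using v fr[of 11] by simp
          have 2: "s5 2 = tree_of_string \<one>\<^bsub>R\<^esub>" using fr'[of 2] s by simp
          show "runs R S add_com s5 r Q"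
          proof (rule runs_add_com[OF 2 14 15], goal_cases)
            case (4 s6)
            have "s6 z = s z" if "z \<notin> {11..33}" for z
            proof -
              from that have "z \<notin> {16, 18, 20, 21, 22, 23, 24, 30}" by auto
              then show ?thesis using 4(2)[of z] fr'[OF that] by simp
            qed
            then show ?case using 4(1) v by (intro Q) simp_all
          qed (use vec(3)[OF ij(3)] vec(3)[OF ij(4)] in auto)
        qed
      next
        case 1
        then show ?case using \<open>\<And>z. z \<notin> {14, 30, 31, 32} \<Longrightarrow> s4 z = _ z\<close>[of 7] s1[of 7] s by simp
      next
        case 3
        then show ?case using \<open>\<And>z. z \<notin> {14, 30, 31, 32} \<Longrightarrow> s4 z = _ z\<close>[of 13] ij by simp
      qed (use S ij in simp_all)
    qed (use S ij s1[of 7] s in simp_all)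
  qed
  show ?thesis
  proof (cases g)
    case Var
    then have l: "left (left (s 10)) = Leaf" using s by (simp add: tree_of_nat_def)
    have "Q (s(11 := Leaf, 16 := enc A)) r" by (rule Q) (auto simp: Var)
    then show ?thesis unfolding gate_com_def
      by (intro runs_Seq runs_Assign runs_IfElse)
        (use s l vec in \<open>simp_all add: Var size_enc_le tree_of_nat_def\<close>)
  next
    case (Const a)
    then have a: "a \<in> carrier R" using g by simp
    have l: "left (left (s 10)) = Node Leaf Leaf" "left (right (left (s 10))) = tree_of_string a"
      using s Const by (simp_all add: tree_of_nat_def)
    have "tl (replicate (length A) \<zero>\<^bsub>R\<^esub>) = replicate (length A - 1) \<zero>\<^bsub>R\<^esub>" by simp
    moreover have "vec (a # replicate (length A - 1) \<zero>\<^bsub>R\<^esub>)" using a vec by (cases A) (auto simp: vec_def)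
    moreover have "1 \<le> S" using S Const by simp
    moreover have "Q (s(11 := Leaf, 16 := enc (a # replicate (length A - 1) \<zero>\<^bsub>R\<^esub>))) r"
      by (rule Q) (auto simp: Const)
    ultimately show ?thesis unfolding gate_com_def
      by (intro runs_Seq runs_Assign runs_IfElse)
        (use s l in \<open>simp_all add: Const size_enc_le tree_of_nat_def\<close>)
  next
    case (Plus i j)
    have l: "left (left (s 10)) = Node Leaf (Node Leaf Leaf)" "left (right (left (s 10))) = tree_of_nat i"
      "left (right (right (left (s 10)))) = tree_of_nat j"
      using s Plus by (simp_all add: tree_of_nat_def numeral_2_eq_2)
    have sz: "2 \<le> S" "size (tree_of_nat i) \<le> S" "size (tree_of_nat j) \<le> S" using S Plus by simp_all
    show ?thesis unfolding gate_com_def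
      apply (rule runs_Seq, rule runs_Assign)
      using l sz apply simp
      apply (rule runs_IfElse)
       apply (rule runs_Seq, rule runs_Assign)
      using l sz apply simp
       apply (rule runs_IfElse)
        apply (rule runs_Seq, rule runs_Assign)
      using l sz apply simp
        apply (rule binary[of _ i j])
      using l sz g Plus by simp_all
  next
    case (Times i j)
    have l: "left (left (s 10)) = Node Leaf (Node Leaf (Node Leaf Leaf))" "left (right (left (s 10))) = tree_of_nat i"
      "left (right (right (left (s 10)))) = tree_of_nat j"
      using s Times by (simp_all add: tree_of_nat_def numeral_3_eq_3)
    have sz: "3 \<le> S" "size (tree_of_nat i) \<le> S" "size (tree_of_nat j) \<le> S" using S Times by simp_all
    show ?thesis unfolding gate_com_def
      apply (rule runs_Seq, rule runs_Assign)
      using l sz apply simp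
      apply (rule runs_IfElse)
       apply (rule runs_Seq, rule runs_Assign)
      using l sz apply simp
       apply (rule runs_IfElse)
        apply (rule runs_Seq, rule runs_Assign)
      using l sz apply simp
        apply (rule binary[of _ i j])
      using l sz g Times by simp_all
  qed
qed

end

section \<open>Input, coin tosses and the iteration over r\<close>

lemma circuit_vals_eq_Nil: "circuit_vals R A C = [] \<longleftrightarrow> C = []"
  using length_circuit_vals[of R A C] by (metis length_0_conv)

text \<open>Register 4 starts at 2 and is increased once per gate and once per bit of the string for
  zero. This is how the program learns m, and it gives w = s + m + 2 in unary.\<close>

definition init_com :: com where
  "init_com = Seq (Assign 1 (Hd (Reg 0))) (Seq (Assign 2 (Hd (Tl (Reg 0)))) (Seq (Assign 3 (Hd (Tl (Tl (Reg 0)))))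
    (Seq (Assign 4 (Pair Null (Pair Null Null))) (Seq (foreach 50 3 (Assign 4 (Pair Null (Reg 4))))
      (foreach 50 1 (Assign 4 (Pair Null (Reg 4))))))))"

definition toss_com :: com where
  "toss_com = Seq (Assign 5 Null) (Seq (Assign 6 Null) (foreach 50 4 (Seq (Toss 54)
    (Seq (IfElse 54 (Assign 5 (Pair (Reg 2) (Reg 5))) (Assign 5 (Pair (Reg 1) (Reg 5))))
      (Assign 6 (Pair (Reg 1) (Reg 6)))))))"

text \<open>Four nested loops over the unary number w produce w^4 rounds, so w^4 itself never has to
  be computed.\<close>

definition zero_test :: com where
  "zero_test = Seq init_com (Seq toss_com (Seq (Assign 8 (Pair Null Null))
    (Seq (foreach 50 4 (foreach 51 4 (foreach 52 4 (foreach 53 4 round_com)))) (Assign 0 (Reg 8)))))"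

lemma tree_of_nat_0 [simp]: "tree_of_nat 0 = Leaf"
  by (simp add: tree_of_nat_def)

lemma tree_of_nat_Suc [simp]: "tree_of_nat (Suc n) = Node Leaf (tree_of_nat n)"
  by (simp add: tree_of_nat_def)

lemma size_tree_of_nat [simp]: "size (tree_of_nat n) = n"
  by (induction n) simp_all

lemma runs_count_up:
  assumes y: "s y = tree_of_list ts" "size (tree_of_list ts) \<le> S" "y \<noteq> 4"
    and n: "s 4 = tree_of_nat n" "n + length ts \<le> S"
    and Q: "\<And>s'. s' 4 = tree_of_nat (n + length ts) \<Longrightarrow> (\<And>z. z \<notin> {4, 50} \<Longrightarrow> s' z = s z) \<Longrightarrow> Q s' r"
  shows "runs R S (foreach 50 y (Assign 4 (Pair Null (Reg 4)))) s r Q"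
proof (rule runs_foreach[where ts = ts and I = "\<lambda>i s' r'. r' = r \<and> s' 4 = tree_of_nat (n + i) \<and>
    (\<forall>z. z \<notin> {4, 50} \<longrightarrow> s' z = s z)"])
  fix i s' r' assume "i < length ts" and I: "r' = r \<and> s' 4 = tree_of_nat (n + i) \<and>
      (\<forall>z. z \<notin> {4, 50} \<longrightarrow> s' z = s z)" and t: "s' 50 = tree_of_list (drop i ts)"
  then have v: "eval_expr (Pair Null (Reg 4)) s' = tree_of_nat (n + Suc i)" "n + Suc i \<le> S" using n by simp_all
  show "runs R S (Assign 4 (Pair Null (Reg 4))) s' r' (\<lambda>s' r'. s' 50 = tree_of_list (drop i ts) \<and> r' = r \<and>
      (s'(50 := tree_of_list (drop (Suc i) ts))) 4 = tree_of_nat (n + Suc i) \<and>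
      (\<forall>z. z \<notin> {4, 50} \<longrightarrow> (s'(50 := tree_of_list (drop (Suc i) ts))) z = s z))"
    by (rule runs_Assign; unfold v) (use I t v in auto)
next
  fix s' r' assume "r' = r \<and> s' 4 = tree_of_nat (n + length ts) \<and> (\<forall>z. z \<notin> {4, 50} \<longrightarrow> s' z = s z)"
  then show "Q s' r'" using Q by simp
qed (use y n in auto)

text \<open>\<open>J n\<close> records that n rounds are complete. A body worth q rounds becomes a
  loop worth w q rounds, and nesting uses q = 1, w, w^2, w^3. The cap N keeps n in the range where
  vectors still fit, and X contains the loop registers of the enclosing loops.\<close>

lemma runs_foreach_repeat:
  fixes J :: "nat \<Rightarrow> state \<Rightarrow> bool"
  assumes body: "\<And>n s. n + q \<le> N \<Longrightarrow> J n s \<Longrightarrow>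
      runs R S c s r (\<lambda>s' r'. r' = r \<and> J (n + q) s' \<and> (\<forall>z\<in>insert x X. s' z = s z))"
    and J: "\<And>n s. J n s \<Longrightarrow> s 4 = tree_of_nat w" "\<And>n s v. J n s \<Longrightarrow> J n (s(x := v))"
    and w: "w \<le> S" and x: "x \<notin> X" and n: "n + w * q \<le> N" "J n s"
  shows "runs R S (foreach x 4 c) s r (\<lambda>s' r'. r' = r \<and> J (n + w * q) s' \<and> (\<forall>z\<in>X. s' z = s z))"
proof (rule runs_foreach[where ts = "replicate w Leaf" and I = "\<lambda>i s' r'. r' = r \<and> J (n + i * q) s' \<and>
    (\<forall>z\<in>X. s' z = s z)"])
  fix i s1 r1 assume "i < length (replicate w Leaf)" and I: "r1 = r \<and> J (n + i * q) s1 \<and> (\<forall>z\<in>X. s1 z = s z)"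
    and t: "s1 x = tree_of_list (drop i (replicate w Leaf))"
  then have "Suc i \<le> w" by simp
  then have "Suc i * q \<le> w * q" by (rule mult_le_mono1)
  then have "n + i * q + q \<le> N" using n by simp
  from body[OF this, of s1] I
  have "runs R S c s1 r1 (\<lambda>s' r'. r' = r \<and> J (n + i * q + q) s' \<and> (\<forall>z\<in>insert x X. s' z = s1 z))" by simp
  then show "runs R S c s1 r1 (\<lambda>s' r'. s' x = tree_of_list (drop i (replicate w Leaf)) \<and> r' = r \<and>
      J (n + Suc i * q) (s'(x := tree_of_list (drop (Suc i) (replicate w Leaf)))) \<and>
      (\<forall>z\<in>X. (s'(x := tree_of_list (drop (Suc i) (replicate w Leaf)))) z = s z))"
  proof (rule runs_mono, goal_cases)
    case (1 s' r')
    have "n + i * q + q = n + Suc i * q" by simp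
    then have "J (n + Suc i * q) (s'(x := tree_of_list (drop (Suc i) (replicate w Leaf))))"
      using 1 J(2) by metis
    then show ?case using 1 t I x by auto
  qed
next
  show "s 4 = tree_of_list (replicate w Leaf)" using J(1)[OF n(2)] by (simp add: tree_of_nat_def)
  show "size (tree_of_list (replicate w Leaf)) \<le> S" using w by (simp flip: tree_of_nat_def)
  show "r = r \<and> J (n + 0 * q) (s(x := tree_of_list (replicate w Leaf))) \<and>
    (\<forall>z\<in>X. (s(x := tree_of_list (replicate w Leaf))) z = s z)" using J(2)[OF n(2)] x by auto
qed simp

text \<open>Register 7 holds the value vectors of all gates at once, which explains the factor
  \<open>length C\<close> in the bound on S.\<close>

locale circuit_run = program_run +
  fixes C :: "bool list gate list"
  assumes C: "circuit R C" and SV: "length C * (K * (2 * m + 1) + 1) \<le> S"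
    and SC: "size (tree_of_list (map tree_of_gate C)) \<le> S"
begin

lemma circuit_vals_vec:
  assumes "vec A" "A \<noteq> []" "n \<le> length C" "i < n"
  shows "vec (circuit_vals R A (take n C) ! i) \<and> length (circuit_vals R A (take n C) ! i) = length A"
  using circuit_vals_closed[OF cring C _ assms(2-4)] assms(1) by (auto simp: vec_def)

lemma size_vals:
  assumes "vec A" "A \<noteq> []" "n \<le> length C"
  shows "size (tree_of_list (map enc (circuit_vals R A (take n C)))) \<le> S"
proof -
  let ?vs = "circuit_vals R A (take n C)"
  have len: "length ?vs = n" using assms by simp
  have "size (tree_of_list (map enc ?vs)) = (\<Sum>v\<leftarrow>?vs. Suc (size (enc v)))"
    by (simp add: size_tree_of_list comp_def)
  also have "\<dots> \<le> (\<Sum>v\<leftarrow>?vs. K * (2 * m + 1) + 1)"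
  proof (rule sum_list_mono)
    fix v assume "v \<in> set ?vs"
    then obtain i where "i < n" "v = ?vs ! i" using len by (auto simp: in_set_conv_nth)
    then have "vec v" using circuit_vals_vec[OF assms] by simp
    then show "Suc (size (enc v)) \<le> K * (2 * m + 1) + 1" using size_enc[of v] by simp
  qed
  also have "\<dots> = n * (K * (2 * m + 1) + 1)" using len by (simp add: sum_list_triv)
  also have "\<dots> \<le> length C * (K * (2 * m + 1) + 1)" using assms by (intro mult_le_mono1)
  finally show ?thesis using SV by simp
qed

lemma runs_eval_com:
  assumes s: "s 2 = tree_of_string \<one>\<^bsub>R\<^esub>" "s 3 = tree_of_list (map tree_of_gate C)"
      "s 5 = enc A" "s 6 = enc (replicate (length A) \<zero>\<^bsub>R\<^esub>)"
    and A: "vec A" "A \<noteq> []"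
    and Q: "\<And>s'. left (s' 7) = enc (last (circuit_vals R A C)) \<Longrightarrow>
      (\<And>z. z \<notin> {7..33} \<or> z = 8 \<Longrightarrow> s' z = s z) \<Longrightarrow> Q s' r"
  shows "runs R S eval_com s r Q"
  unfolding eval_com_def
proof (rule runs_Seq, rule runs_Assign)
  let ?vs = "\<lambda>i. circuit_vals R A (take i C)"
  let ?fr = "\<lambda>s'. \<forall>z. z \<notin> {7..33} \<or> z = 8 \<longrightarrow> s' z = s z"
  let ?body = "Seq gate_com (Assign 7 (Pair (Reg 16) (Reg 7)))"
  show "runs R S (foreach 10 3 ?body) (s(7 := eval_expr Null s)) r Q"
  proof (rule runs_foreach[where ts = "map tree_of_gate C" and I = "\<lambda>i s' r'. r' = r \<and>
      s' 7 = tree_of_list (rev (map enc (?vs i))) \<and> ?fr s'"])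
    fix i s1 r1 assume "i < length (map tree_of_gate C)"
      and I: "r1 = r \<and> s1 7 = tree_of_list (rev (map enc (?vs i))) \<and> ?fr s1"
      and t: "s1 10 = tree_of_list (drop i (map tree_of_gate C))"
    then have i: "i < length C" by simp
    have vs: "?vs (Suc i) = ?vs i @ [gate_val R A (?vs i) (C ! i)]"
      using i by (simp add: take_Suc_conv_app_nth circuit_vals_snoc)
    have len: "length (?vs i) = i" using i by simp
    have "Suc (size (tree_of_gate (C ! i))) \<le> size (tree_of_list (map tree_of_gate C))"
      unfolding size_tree_of_list using i by (intro member_le_sum_list) auto
    then have gS: "size (tree_of_gate (C ! i)) \<le> S" using SC by simp
    show "runs R S ?body s1 r1 (\<lambda>s' r'. s' 10 = tree_of_list (drop i (map tree_of_gate C)) \<and> r' = r \<and>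
        (s'(10 := tree_of_list (drop (Suc i) (map tree_of_gate C)))) 7 = tree_of_list (rev (map enc (?vs (Suc i)))) \<and>
        ?fr (s'(10 := tree_of_list (drop (Suc i) (map tree_of_gate C)))))"
    proof (rule runs_Seq, rule runs_gate_com[where A = A and g = "C ! i" and vs = "?vs i"], goal_cases)
      case (12 s2)
      have v: "eval_expr (Pair (Reg 16) (Reg 7)) s2 = tree_of_list (rev (map enc (?vs (Suc i))))"
        using 12(1) 12(2)[of 7] I by (simp add: vs)
      have "size (tree_of_list (rev (map enc (?vs (Suc i))))) = size (tree_of_list (map enc (?vs (Suc i))))"
        by (simp add: size_tree_of_list flip: rev_map)
      then have sz: "size (tree_of_list (rev (map enc (?vs (Suc i))))) \<le> S"
        using size_vals[OF A, of "Suc i"] i by simp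
      have fr: "s2 z = s z" if "z \<notin> {7..33} \<or> z = 8" for z
        using 12(2)[of z] I that by force
      show ?case
        by (rule runs_Assign; unfold v) (use sz 12(2)[of 10] t I fr in auto)
    next
      case 11
      then show ?case using C i unfolding circuit_def len by blast
    next
      case (8 j)
      then show ?case using circuit_vals_vec[OF A, of i j] i len by simp
    next
      case 9
      then show ?case using size_vals[OF A, of i] i by simp
    qed (use s I t i A gS in auto)
  next
    fix s' r' assume *: "r' = r \<and> s' 7 = tree_of_list (rev (map enc (?vs (length (map tree_of_gate C))))) \<and> ?fr s'"
    have "?vs (length C) \<noteq> []" using C circuit_vals_eq_Nil[of R A C] by (simp add: circuit_def)
    then have "left (s' 7) = enc (last (circuit_vals R A C))"
      using * by (simp add: left_tree_of_list hd_rev last_map)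
    then have "Q s' r" using * by (intro Q) simp_all
    then show "Q s' r'" using * by simp
  next
    show "(s(7 := eval_expr Null s)) 3 = tree_of_list (map tree_of_gate C)" using s by simp
    show "size (tree_of_list (map tree_of_gate C)) \<le> S" by (rule SC)
  qed (use s in \<open>auto simp: circuit_vals_def\<close>)
qed simp

lemma tree_of_bit_eq_Leaf [simp]: "tree_of_bit b = Leaf \<longleftrightarrow> \<not> b" by (cases b) auto

lemma runs_check_com:
  assumes s: "s 1 = tree_of_string \<zero>\<^bsub>R\<^esub>" "left (s 7) = enc v" and v: "vec v"
    and Q: "\<And>s'. s' 8 = (if set v \<subseteq> {\<zero>\<^bsub>R\<^esub>} then s 8 else Leaf) \<Longrightarrow>
      (\<And>z. z \<notin> {8, 14} \<union> {40..46} \<Longrightarrow> s' z = s z) \<Longrightarrow> Q s' r"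
  shows "runs R S check_com s r Q"
  unfolding check_com_def
proof (rule runs_Seq, rule runs_Assign)
  interpret cring R by (rule cring)
  let ?z = "\<zero>\<^bsub>R\<^esub>"
  let ?fr = "\<lambda>s'. \<forall>z. z \<notin> {8, 14} \<union> {40..46} \<longrightarrow> s' z = s z"
  let ?inner = "Seq (Assign 43 (Hd (Reg 41))) (Seq (Assign 44 (Hd (Reg 42)))
      (Seq (IfElse 43 (IfElse 44 (Assign 46 Null) (Assign 8 Null)) (IfElse 44 (Assign 8 Null) (Assign 46 Null)))
        (Assign 42 (Tl (Reg 42)))))"
  let ?body = "Seq (Assign 42 (Reg 1)) (Seq (Assign 45 (Hd (Reg 40))) (foreach 41 45 ?inner))"
  let ?ts = "map tree_of_string v"
  show "size (eval_expr (Hd (Reg 7)) s) \<le> S" using s v by (simp add: size_enc_le)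
  show "runs R S (foreach 40 14 ?body) (s(14 := eval_expr (Hd (Reg 7)) s)) r Q"
  proof (rule runs_foreach[where ts = "?ts" and I = "\<lambda>i s' r'. r' = r \<and>
      s' 8 = (if set (take i v) \<subseteq> {?z} then s 8 else Leaf) \<and> ?fr s'"])
    fix i s1 r1 assume "i < length ?ts"
      and I: "r1 = r \<and> s1 8 = (if set (take i v) \<subseteq> {?z} then s 8 else Leaf) \<and> ?fr s1"
      and t: "s1 40 = tree_of_list (drop i ?ts)"
    then have i: "i < length v" by simp
    define u where "u = v ! i"
    have u: "u \<in> carrier R" using v i by (auto simp: vec_def u_def)
    \<comment> \<open>All encodings have length m, so agreement on the bits visited is equality of
      the strings.\<close>
    have len: "length u = m" "length ?z = m" using u R zero_closed by (auto simp: ring_by_oracle_def)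
    have l: "left (s1 40) = tree_of_string u" using t i by (simp add: u_def)
    have s11: "s1 1 = tree_of_string ?z" using I s by simp
    let ?bs = "map tree_of_bit u"
    show "runs R S ?body s1 r1 (\<lambda>s' r'. s' 40 = tree_of_list (drop i ?ts) \<and> r' = r \<and>
        (s'(40 := tree_of_list (drop (Suc i) ?ts))) 8 = (if set (take (Suc i) v) \<subseteq> {?z} then s 8 else Leaf) \<and>
        ?fr (s'(40 := tree_of_list (drop (Suc i) ?ts))))"
    proof (rule runs_Seq, rule runs_Assign, goal_cases)
      case 1
      then show ?case using s11 by (simp add: size_string_le)
    next
      case 2
      show ?case
      proof (rule runs_Seq, rule runs_Assign, goal_cases)
        case 1
        then show ?case using l u by (simp add: size_string_le)
      next
        case 2
        let ?s2 = "s1(42 := eval_expr (Reg 1) s1)"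
        let ?s3 = "?s2(45 := eval_expr (Hd (Reg 40)) ?s2)"
        show ?case
        proof (rule runs_foreach[where ts = ?bs and I = "\<lambda>j s' r'. r' = r \<and>
            s' 8 = (if take j u = take j ?z then s1 8 else Leaf) \<and>
            s' 42 = tree_of_list (drop j (map tree_of_bit ?z)) \<and> s' 40 = s1 40 \<and> ?fr s'"])
          fix j s4 r4 assume "j < length ?bs"
            and J: "r4 = r \<and> s4 8 = (if take j u = take j ?z then s1 8 else Leaf) \<and>
            s4 42 = tree_of_list (drop j (map tree_of_bit ?z)) \<and> s4 40 = s1 40 \<and> ?fr s4"
            and t4: "s4 41 = tree_of_list (drop j ?bs)"
          then have j: "j < length u" "j < length ?z" using len by simp_all
          have l4: "left (s4 41) = tree_of_bit (u ! j)" "left (s4 42) = tree_of_bit (?z ! j)"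
            using J t4 j by simp_all
          have bS: "size (tree_of_bit b) \<le> S" for b
          proof -
            have "1 * (2 * m + 1) \<le> K * (2 * m + 1)" using K by (intro mult_le_mono1) simp
            then show ?thesis using K by (cases b) auto
          qed
          have "size (tree_of_list (drop (Suc j) (map tree_of_bit ?z))) \<le> size (tree_of_string ?z)"
            unfolding tree_of_string_def by (rule size_tree_of_list_drop)
          then have dS: "size (tree_of_list (drop (Suc j) (map tree_of_bit ?z))) \<le> S"
            using size_string_le[OF zero_closed] by simp
          have r4: "right (s4 42) = tree_of_list (drop (Suc j) (map tree_of_bit ?z))"
            using J by (simp add: drop_Suc tl_drop)
          have tk: "take (Suc j) u = take (Suc j) ?z \<longleftrightarrow> take j u = take j ?z \<and> u ! j = ?z ! j"
            using j by (simp add: take_Suc_conv_app_nth)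
          show "runs R S ?inner s4 r4 (\<lambda>s' r'. s' 41 = tree_of_list (drop j ?bs) \<and> r' = r \<and>
            (s'(41 := tree_of_list (drop (Suc j) ?bs))) 8 = (if take (Suc j) u = take (Suc j) ?z then s1 8 else Leaf) \<and>
            (s'(41 := tree_of_list (drop (Suc j) ?bs))) 42 = tree_of_list (drop (Suc j) (map tree_of_bit ?z)) \<and>
            (s'(41 := tree_of_list (drop (Suc j) ?bs))) 40 = s1 40 \<and>
            ?fr (s'(41 := tree_of_list (drop (Suc j) ?bs))))"
            by (intro runs_Seq runs_Assign runs_IfElse)
              (use j J l4 bS dS r4 t4 in \<open>simp_all add: tk\<close>)
        next
          fix s4 r4 assume J: "r4 = r \<and> s4 8 = (if take (length ?bs) u = take (length ?bs) ?z then s1 8 else Leaf) \<and>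
            s4 42 = tree_of_list (drop (length ?bs) (map tree_of_bit ?z)) \<and> s4 40 = s1 40 \<and> ?fr s4"
          have "set (take (Suc i) v) \<subseteq> {?z} \<longleftrightarrow> set (take i v) \<subseteq> {?z} \<and> u = ?z"
            using i by (auto simp: take_Suc_conv_app_nth u_def)
          then show "s4 40 = tree_of_list (drop i ?ts) \<and> r4 = r \<and>
            (s4(40 := tree_of_list (drop (Suc i) ?ts))) 8 = (if set (take (Suc i) v) \<subseteq> {?z} then s 8 else Leaf) \<and>
            ?fr (s4(40 := tree_of_list (drop (Suc i) ?ts)))"
            using J I t len by simp
        next
          show "?s3 45 = tree_of_list ?bs" using l by (simp add: tree_of_string_def)
          show "size (tree_of_list ?bs) \<le> S" using size_string_le[OF u] by (simp add: tree_of_string_def)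
          show "r1 = r \<and> (?s3(41 := tree_of_list ?bs)) 8 = (if take 0 u = take 0 ?z then s1 8 else Leaf) \<and>
            (?s3(41 := tree_of_list ?bs)) 42 = tree_of_list (drop 0 (map tree_of_bit ?z)) \<and>
            (?s3(41 := tree_of_list ?bs)) 40 = s1 40 \<and> ?fr (?s3(41 := tree_of_list ?bs))"
            using I s11 by (simp add: tree_of_string_def)
        qed
      qed
    qed
  next
    fix s' r' assume "r' = r \<and> s' 8 = (if set (take (length ?ts) v) \<subseteq> {?z} then s 8 else Leaf) \<and> ?fr s'"
    then show "Q s' r'" using Q by simp
  qed (use s size_enc_le[OF v] in \<open>auto simp: enc_def\<close>)
qed

lemma runs_round_com:
  assumes s: "s 1 = tree_of_string \<zero>\<^bsub>R\<^esub>" "s 2 = tree_of_string \<one>\<^bsub>R\<^esub>"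
      "s 3 = tree_of_list (map tree_of_gate C)"
      "s 5 = enc A" "s 6 = enc (replicate (length A) \<zero>\<^bsub>R\<^esub>)"
    and A: "vec (\<zero>\<^bsub>R\<^esub> # A)" "A \<noteq> []"
    and Q: "\<And>s'. s' 5 = enc (\<zero>\<^bsub>R\<^esub> # A) \<Longrightarrow> s' 6 = enc (replicate (Suc (length A)) \<zero>\<^bsub>R\<^esub>) \<Longrightarrow>
      s' 8 = (if last (circuit_vals R A C) = replicate (length A) \<zero>\<^bsub>R\<^esub> then s 8 else Leaf) \<Longrightarrow>
      (\<And>z. z < 5 \<or> z \<ge> 47 \<Longrightarrow> s' z = s z) \<Longrightarrow> Q s' r"
  shows "runs R S round_com s r Q"
  unfolding round_com_def
proof (rule runs_Seq, rule runs_eval_com[where A = A], goal_cases)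
  case (7 s1)
  let ?v = "last (circuit_vals R A C)"
  have A': "vec A" using A by (auto simp: vec_def)
  have ne: "C \<noteq> []" using C by (simp add: circuit_def)
  then have "?v = circuit_vals R A (take (length C) C) ! (length C - 1)"
    by (simp add: last_conv_nth circuit_vals_eq_Nil)
  then have v: "vec ?v" "length ?v = length A"
    using circuit_vals_vec[OF A' A(2), of "length C" "length C - 1"] ne by auto
  have z: "vec (replicate (Suc (length A)) \<zero>\<^bsub>R\<^esub>)" using A by (auto simp: vec_def)
  have test: "set ?v \<subseteq> {\<zero>\<^bsub>R\<^esub>} \<longleftrightarrow> ?v = replicate (length A) \<zero>\<^bsub>R\<^esub>"
  proof
    assume "set ?v \<subseteq> {\<zero>\<^bsub>R\<^esub>}"
    then show "?v = replicate (length A) \<zero>\<^bsub>R\<^esub>" by (intro replicate_eqI[OF v(2)]) auto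
  next
    assume *: "?v = replicate (length A) \<zero>\<^bsub>R\<^esub>"
    show "set ?v \<subseteq> {\<zero>\<^bsub>R\<^esub>}" unfolding * by auto
  qed
  show ?case
  proof (rule runs_Seq, rule runs_check_com[where v = ?v], goal_cases)
    case (4 s2)
    have fr: "s2 z = s z" if "z < 7 \<or> z \<ge> 47" for z
      using 4(2)[of z] 7(2)[of z] that by force
    show ?case
    proof (intro runs_Seq runs_Assign Q)
    qed (use 4(1) 7(2)[of 8] fr s size_enc_le[OF A(1)] size_enc_le[OF z] in \<open>auto simp: test\<close>)
  qed (use 7 s v in auto)
qed (use s A in \<open>auto simp: vec_def\<close>)

end


locale zero_test_run = circuit_run +
  fixes w :: nat
  assumes w: "w = length C + m + 2" and Kw: "w + w ^ 4 \<le> K" and SI: "size (input_tree R C) \<le> S"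
begin

lemma w_le: "w \<le> S"
proof -
  have "w \<le> K * 1" using Kw by simp
  also have "\<dots> \<le> K * (2 * m + 1)" by (intro mult_le_mono2) simp
  finally show ?thesis using K by simp
qed

lemma runs_init_com:
  assumes Q: "\<And>s'. s' 1 = tree_of_string \<zero>\<^bsub>R\<^esub> \<Longrightarrow> s' 2 = tree_of_string \<one>\<^bsub>R\<^esub> \<Longrightarrow>
    s' 3 = tree_of_list (map tree_of_gate C) \<Longrightarrow> s' 4 = tree_of_nat w \<Longrightarrow> Q s' r"
  shows "runs R S init_com (initial_state (input_tree R C)) r Q"
proof -
  interpret cring R by (rule cring)
  have inp: "input_tree R C = Node (tree_of_string \<zero>\<^bsub>R\<^esub>) (Node (tree_of_string \<one>\<^bsub>R\<^esub>)
      (Node (tree_of_list (map tree_of_gate C)) Leaf))"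
    by (simp add: input_tree_def)
  let ?s1 = "(initial_state (input_tree R C))(1 := tree_of_string \<zero>\<^bsub>R\<^esub>, 2 := tree_of_string \<one>\<^bsub>R\<^esub>,
    3 := tree_of_list (map tree_of_gate C), 4 := tree_of_nat 2)"
  have len: "length \<zero>\<^bsub>R\<^esub> = m" using R zero_closed by (auto simp: ring_by_oracle_def)
  have loops: "runs R S (Seq (foreach 50 3 (Assign 4 (Pair Null (Reg 4)))) (foreach 50 1 (Assign 4 (Pair Null (Reg 4))))) ?s1 r Q"
  proof (rule runs_Seq, rule runs_count_up[where ts = "map tree_of_gate C" and n = 2], goal_cases)
    case (6 s2)
    show ?case
    proof (rule runs_count_up[where ts = "map tree_of_bit \<zero>\<^bsub>R\<^esub>" and n = "2 + length C"], goal_cases)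
      case (6 s3)
      then show ?case using \<open>\<And>z. z \<notin> {4, 50} \<Longrightarrow> s2 z = _ z\<close> len w
        by (intro Q) (simp_all add: add.commute add.left_commute)
    next
      case 2
      then show ?case using size_string_le[OF zero_closed] by (simp add: tree_of_string_def)
    qed (use 6 len w w_le in \<open>auto simp: tree_of_string_def\<close>)
  qed (use SC w w_le in auto)
  show ?thesis unfolding init_com_def
  proof (rule runs_Seq, rule runs_Assign, goal_cases)
    case 2
    show ?case
    proof (rule runs_Seq, rule runs_Assign, goal_cases)
      case 2
      show ?case
      proof (rule runs_Seq, rule runs_Assign, goal_cases)
        case 2
        show ?case
        proof (rule runs_Seq, rule runs_Assign, goal_cases)
          case 2
          then show ?case using loops by (simp add: inp initial_state_def numeral_2_eq_2)
        qed (use w_le w in simp)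
      qed (use SC in \<open>simp add: inp initial_state_def\<close>)
    qed (simp add: inp initial_state_def size_string_le)
  qed (simp add: inp initial_state_def size_string_le)
qed

text \<open>Coins are consed as they arrive, so the coefficients are the first w coins in reverse
  order; reversal is a bijection and leaves the count of bad outcomes unchanged.\<close>

lemma runs_toss_com:
  assumes s: "s 1 = tree_of_string \<zero>\<^bsub>R\<^esub>" "s 2 = tree_of_string \<one>\<^bsub>R\<^esub>" "s 4 = tree_of_nat w"
    and r: "w \<le> length r"
    and Q: "\<And>s'. s' 5 = enc (point R 0 (rev (take w r))) \<Longrightarrow> s' 6 = enc (replicate w \<zero>\<^bsub>R\<^esub>) \<Longrightarrow>
      (\<And>z. z \<notin> {5, 6, 50, 54} \<Longrightarrow> s' z = s z) \<Longrightarrow> Q s' (drop w r)"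
  shows "runs R S toss_com s r Q"
  unfolding toss_com_def
proof (intro runs_Seq runs_Assign)
  interpret cring R by (rule cring)
  let ?fr = "\<lambda>s'. \<forall>z. z \<notin> {5, 6, 50, 54} \<longrightarrow> s' z = s z"
  let ?body = "Seq (Toss 54) (Seq (IfElse 54 (Assign 5 (Pair (Reg 2) (Reg 5))) (Assign 5 (Pair (Reg 1) (Reg 5))))
      (Assign 6 (Pair (Reg 1) (Reg 6))))"
  let ?p = "\<lambda>i. point R 0 (rev (take i r))" and ?ts = "replicate w Leaf"
  let ?s1 = "s(5 := eval_expr Null s, 6 := eval_expr Null (s(5 := eval_expr Null s)))"
  have wK: "w \<le> K" using Kw by simp
  show "runs R S (foreach 50 4 ?body) ?s1 r Q"
  proof (rule runs_foreach[where ts = ?ts and I = "\<lambda>i s' r'. r' = drop i r \<and> s' 5 = enc (?p i) \<and>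
      s' 6 = enc (replicate i \<zero>\<^bsub>R\<^esub>) \<and> ?fr s'"])
    fix i s1 r1 assume "i < length ?ts" and I: "r1 = drop i r \<and> s1 5 = enc (?p i) \<and>
      s1 6 = enc (replicate i \<zero>\<^bsub>R\<^esub>) \<and> ?fr s1" and t: "s1 50 = tree_of_list (drop i ?ts)"
    then have i: "i < w" "i < length r" using r by simp_all
    have r1: "r1 = r ! i # drop (Suc i) r" using I i by (simp add: Cons_nth_drop_Suc)
    have p: "?p (Suc i) = (if r ! i then \<one>\<^bsub>R\<^esub> else \<zero>\<^bsub>R\<^esub>) # ?p i"
      using i by (simp add: point_def take_Suc_conv_app_nth)
    have "vec (?p (Suc i))" "vec (replicate (Suc i) \<zero>\<^bsub>R\<^esub>)" using i wK by (auto simp: vec_def point_def)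
    then have sz: "size (enc (?p (Suc i))) \<le> S" "size (enc (replicate (Suc i) \<zero>\<^bsub>R\<^esub>)) \<le> S"
      by (auto intro: size_enc_le)
    have reg: "s1 1 = tree_of_string \<zero>\<^bsub>R\<^esub>" "s1 2 = tree_of_string \<one>\<^bsub>R\<^esub>" using I s by simp_all
    show "runs R S ?body s1 r1 (\<lambda>s' r'. s' 50 = tree_of_list (drop i ?ts) \<and> r' = drop (Suc i) r \<and>
        (s'(50 := tree_of_list (drop (Suc i) ?ts))) 5 = enc (?p (Suc i)) \<and>
        (s'(50 := tree_of_list (drop (Suc i) ?ts))) 6 = enc (replicate (Suc i) \<zero>\<^bsub>R\<^esub>) \<and>
        ?fr (s'(50 := tree_of_list (drop (Suc i) ?ts))))"
      unfolding r1
      by (intro runs_Seq runs_Toss runs_IfElse runs_Assign)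
        (use I t reg sz in \<open>auto simp: p split: if_splits\<close>)
  next
    fix s' r' assume "r' = drop (length ?ts) r \<and> s' 5 = enc (?p (length ?ts)) \<and>
      s' 6 = enc (replicate (length ?ts) \<zero>\<^bsub>R\<^esub>) \<and> ?fr s'"
    then show "Q s' r'" using Q by simp
  next
    show "?s1 4 = tree_of_list ?ts" using s by (simp add: tree_of_nat_def)
    show "size (tree_of_list ?ts) \<le> S" using w_le by (simp flip: tree_of_nat_def)
  qed (simp add: point_def enc_Nil)
qed auto

definition passes :: "bool list \<Rightarrow> nat \<Rightarrow> bool" where
  "passes es n \<longleftrightarrow> last (circuit_vals R (point R n es) C) = replicate (n + length es) \<zero>\<^bsub>R\<^esub>"

lemma runs_zero_test:
  assumes r: "w \<le> length r"
  shows "runs R S zero_test (initial_state (input_tree R C)) r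
    (\<lambda>s' r'. s' 0 \<noteq> Leaf \<longleftrightarrow> (\<forall>n<w ^ 4. passes (rev (take w r)) n))"
  unfolding zero_test_def
proof (rule runs_Seq, rule runs_init_com)
  interpret cring R by (rule cring)
  let ?Q = "\<lambda>s' r'. s' 0 \<noteq> Leaf \<longleftrightarrow> (\<forall>n<w ^ 4. passes (rev (take w r)) n)"
  fix s1 :: state assume s1: "s1 1 = tree_of_string \<zero>\<^bsub>R\<^esub>" "s1 2 = tree_of_string \<one>\<^bsub>R\<^esub>"
    "s1 3 = tree_of_list (map tree_of_gate C)" "s1 4 = tree_of_nat w"
  define es where "es = rev (take w r)"
  have es: "length es = w" using r by (simp add: es_def)
  define J where "J n s \<longleftrightarrow> s 1 = tree_of_string \<zero>\<^bsub>R\<^esub> \<and> s 2 = tree_of_string \<one>\<^bsub>R\<^esub> \<and>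
    s 3 = tree_of_list (map tree_of_gate C) \<and> s 4 = tree_of_nat w \<and>
    s 5 = enc (point R n es) \<and> s 6 = enc (replicate (n + w) \<zero>\<^bsub>R\<^esub>) \<and>
    s 8 = (if \<forall>i<n. passes es i then Node Leaf Leaf else Leaf)" for n and s :: state
  have w0: "w > 0" using w by simp
  have round: "runs R S round_com s r' (\<lambda>s'' r''. r'' = r' \<and> J (n + 1) s'' \<and> (\<forall>z\<in>insert 53 {50, 51, 52}. s'' z = s z))"
    if n: "n + 1 \<le> w ^ 4" and J: "J n s" for n s r'
  proof (rule runs_round_com[where A = "point R n es"], goal_cases)
    case (8 s')
    have "s' z = s z" if "z < 5 \<or> z \<ge> 47" for z using 8(4) that by simp
    then show ?case using 8(1-3) J es
      by (auto simp: J_def point_def passes_def less_Suc_eq add.commute)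
  next
    case 6
    then show ?case using n Kw es by (auto simp: vec_def point_def)
  next
    case 7
    then show ?case using es w0 by (auto simp: point_def)
  qed (use J es in \<open>simp_all add: J_def point_def\<close>)
  have J4: "J n s \<Longrightarrow> s 4 = tree_of_nat w" for n s by (simp add: J_def)
  have Jst: "J n s \<Longrightarrow> x \<ge> 50 \<Longrightarrow> J n (s(x := v))" for n s x v by (simp add: J_def)
  have rep: "runs R S (foreach x 4 c) s r' (\<lambda>s'' r''. r'' = r' \<and> J (n + w * q) s'' \<and> (\<forall>z\<in>X. s'' z = s z))"
    if "\<And>n s. n + q \<le> w ^ 4 \<Longrightarrow> J n s \<Longrightarrow>
        runs R S c s r' (\<lambda>s'' r''. r'' = r' \<and> J (n + q) s'' \<and> (\<forall>z\<in>insert x X. s'' z = s z))"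
      "x \<ge> 50" "x \<notin> X" "n + w * q \<le> w ^ 4" "J n s" for x q c X n s r'
    by (rule runs_foreach_repeat[where J = J and N = "w ^ 4"]) (fact that J4 Jst[OF _ that(2)] w_le)+
  have loop1: "runs R S (foreach 53 4 round_com) s r'
      (\<lambda>s'' r''. r'' = r' \<and> J (n + w * 1) s'' \<and> (\<forall>z\<in>{50, 51, 52}. s'' z = s z))"
    if "n + w * 1 \<le> w ^ 4" "J n s" for n s r'
    by (rule rep[OF round]) (use that in simp_all)
  have loop2: "runs R S (foreach 52 4 (foreach 53 4 round_com)) s r'
      (\<lambda>s'' r''. r'' = r' \<and> J (n + w * (w * 1)) s'' \<and> (\<forall>z\<in>{50, 51}. s'' z = s z))"
    if "n + w * (w * 1) \<le> w ^ 4" "J n s" for n s r'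
    by (rule rep, rule runs_mono[OF loop1]) (use that in auto)
  have loop3: "runs R S (foreach 51 4 (foreach 52 4 (foreach 53 4 round_com))) s r'
      (\<lambda>s'' r''. r'' = r' \<and> J (n + w * (w * (w * 1))) s'' \<and> (\<forall>z\<in>{50}. s'' z = s z))"
    if "n + w * (w * (w * 1)) \<le> w ^ 4" "J n s" for n s r'
    by (rule rep, rule runs_mono[OF loop2]) (use that in auto)
  have w4: "w * (w * (w * (w * 1))) = w ^ 4" by (simp add: power4_eq_xxxx)
  have loop4: "runs R S (foreach 50 4 (foreach 51 4 (foreach 52 4 (foreach 53 4 round_com)))) s r'
      (\<lambda>s'' r''. r'' = r' \<and> J (0 + w * (w * (w * (w * 1)))) s'' \<and> (\<forall>z\<in>{}. s'' z = s z))"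
    if "J 0 s" for s r'
    by (rule rep, rule runs_mono[OF loop3]) (use that w4 in auto)
  show "runs R S (Seq toss_com (Seq (Assign 8 (Pair Null Null))
      (Seq (foreach 50 4 (foreach 51 4 (foreach 52 4 (foreach 53 4 round_com)))) (Assign 0 (Reg 8))))) s1 r ?Q"
  proof (rule runs_Seq, rule runs_toss_com[OF s1(1,2,4) r])
    fix s2 :: state assume s2: "s2 5 = enc (point R 0 (rev (take w r)))" "s2 6 = enc (replicate w \<zero>\<^bsub>R\<^esub>)"
      "\<And>z. z \<notin> {5, 6, 50, 54} \<Longrightarrow> s2 z = s1 z"
    show "runs R S (Seq (Assign 8 (Pair Null Null))
      (Seq (foreach 50 4 (foreach 51 4 (foreach 52 4 (foreach 53 4 round_com)))) (Assign 0 (Reg 8)))) s2 (drop w r) ?Q"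
    proof (rule runs_Seq, rule runs_Assign, goal_cases)
      case 2
      let ?s3 = "s2(8 := eval_expr (Pair Null Null) s2)"
      have "J 0 ?s3" using s1 s2 by (simp add: J_def es_def)
      show ?case
      proof (rule runs_Seq, rule runs_mono[OF loop4[OF \<open>J 0 ?s3\<close>]])
        fix s4 r4 assume "r4 = drop w r \<and> J (0 + w * (w * (w * (w * 1)))) s4 \<and> (\<forall>z\<in>{}. s4 z = ?s3 z)"
        then have "J (w ^ 4) s4" using w4 by simp
        then have s48: "s4 8 = (if \<forall>n<w ^ 4. passes (rev (take w r)) n then Node Leaf Leaf else Leaf)" by (simp add: J_def es_def)
        then show "runs R S (Assign 0 (Reg 8)) s4 r4 ?Q"
          using w_le w by (intro runs_Assign) (simp_all add: s48)
      qed
    qed (use w_le w in simp)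
  qed
qed

end

section \<open>Size of the input and acceptance probability\<close>

lemma UP_cring_UP: "cring R \<Longrightarrow> UP_cring R"
  by (simp add: UP_cring_def)

lemma card_bool_lists: "card {r :: bool list. length r = n} = 2 ^ n" "finite {r :: bool list. length r = n}"
proof -
  have eq: "{r :: bool list. length r = n} = {r. set r \<subseteq> UNIV \<and> length r = n}" by simp
  show "card {r :: bool list. length r = n} = 2 ^ n"
    unfolding eq by (subst card_lists_length_eq) simp_all
  show "finite {r :: bool list. length r = n}"
    unfolding eq by (rule finite_lists_length_eq) simp
qed

text \<open>The verdict depends on the first w coins only; a coin sequence is determined by them and
  the remaining T - w coins, which are free.\<close>

lemma card_prefix_in_le:
  assumes B: "\<And>es. es \<in> B \<Longrightarrow> length es = w" and T: "w \<le> T"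
  shows "card {r :: bool list. length r = T \<and> rev (take w r) \<in> B} \<le> card B * 2 ^ (T - w)"
proof -
  let ?A = "{r :: bool list. length r = T \<and> rev (take w r) \<in> B}"
  let ?f = "\<lambda>r. (rev (take w r), drop w r)"
  have "inj_on ?f ?A" by (rule inj_onI) (metis append_take_drop_id prod.inject rev_rev_ident)
  moreover have "?f ` ?A \<subseteq> B \<times> {r. length r = T - w}" by auto
  moreover have "finite B"
    by (rule finite_subset[OF _ card_bool_lists(2)[of w]]) (use B in auto)
  ultimately have "card ?A \<le> card (B \<times> {r :: bool list. length r = T - w})"
    using card_bool_lists(2)[of "T - w"] by (intro card_inj_on_le[of ?f]) auto
  then show ?thesis by (simp add: card_cartesian_product card_bool_lists)
qed

text \<open>A gate has at most three list cells, a tag of at most 3, and either two unary positions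
  below \<open>length C\<close> or a string of tree size at most 2m; one more cell holds it in the
  list, which gives 7. The term 4m + 3 accounts for zero, one and the three outer cells.\<close>

lemma size_input_tree:
  assumes R: "ring_by_oracle R m" and C: "circuit R C"
  shows "size (tree_of_list (map tree_of_gate C)) \<le> length C * (2 * (length C + m) + 7)"
    "size (input_tree R C) \<le> 4 * m + 3 + length C * (2 * (length C + m) + 7)"
proof -
  interpret cring R using R by (simp add: ring_by_oracle_def)
  have str: "size (tree_of_string a) \<le> 2 * m" if "a \<in> carrier R" for a
    using R size_tree_of_string[of a] that by (auto simp: ring_by_oracle_def)
  have gate: "size (tree_of_gate g) \<le> 2 * (length C + m) + 6" if g: "g \<in> set C" for g
  proof -
    obtain k where k: "k < length C" "C ! k = g" using g by (auto simp: in_set_conv_nth)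
    then have "case g of Var \<Rightarrow> True | Const a \<Rightarrow> a \<in> carrier R
        | Plus i j \<Rightarrow> i < k \<and> j < k | Times i j \<Rightarrow> i < k \<and> j < k"
      using C by (auto simp: circuit_def)
    then show ?thesis using k(1) str by (cases g) (auto simp: add.commute dest!: str)
  qed
  have "size (tree_of_list (map tree_of_gate C)) = (\<Sum>g\<leftarrow>C. Suc (size (tree_of_gate g)))"
    by (simp add: size_tree_of_list comp_def)
  also have "\<dots> \<le> (\<Sum>g\<leftarrow>C. 2 * (length C + m) + 7)"
    using gate by (intro sum_list_mono) fastforce
  also have "\<dots> = length C * (2 * (length C + m) + 7)" by (simp add: sum_list_triv)
  finally show 1: "size (tree_of_list (map tree_of_gate C)) \<le> length C * (2 * (length C + m) + 7)" .
  show "size (input_tree R C) \<le> 4 * m + 3 + length C * (2 * (length C + m) + 7)"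
    using 1 str[OF zero_closed] str[OF one_closed] by (simp add: input_tree_def)
qed

theorem theorem10:
  shows "\<exists>(P :: com) (p :: nat poly).
    \<forall>(R :: bool list ring) (m :: nat) (C :: bool list gate list).
      ring_by_oracle R m \<longrightarrow> circuit R C \<longrightarrow>
      (let T = poly p (circuit_size C + m); inp = input_tree R C in
         halts_within R P inp T \<and>
         (circuit_poly R C = \<zero>\<^bsub>UP R\<^esub> \<longrightarrow> accept_prob R P inp T = 1) \<and>
         (circuit_poly R C \<noteq> \<zero>\<^bsub>UP R\<^esub> \<longrightarrow> accept_prob R P inp T \<le> 1 / 3))"
proof -
  obtain q :: "nat poly" where q: "\<And>S. poly q S = cost S zero_test" using cost_poly by blast
  \<comment> \<open>All bounds are polynomials in n = s + m: \<open>[:2, 1:]\<close> is w,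
    \<open>[:1, 2:]\<close> is 2n + 1 \<ge> 2m + 1, and \<open>Kp\<close> is w + w^4.
    \<open>Sp\<close> adds up the bounds for the list of values, a single vector and the input, so
    it dominates each of them.\<close>
  define Kp :: "nat poly" where "Kp = [:2, 1:] + [:2, 1:] ^ 4"
  define Sp :: "nat poly" where
    "Sp = [:0, 1:] * (Kp * [:1, 2:] + 1) + Kp * [:1, 2:] + ([:3, 4:] + [:0, 1:] * [:7, 2:])"
  \<comment> \<open>The summand \<open>Sp\<close> guarantees w \<le> T, so a coin sequence of length
    T suffices for the w tosses.\<close>
  define p :: "nat poly" where "p = q \<circ>\<^sub>p Sp + Sp"
  have main: "halts_within R zero_test (input_tree R C) (poly p (length C + m)) \<and>
      (circuit_poly R C = \<zero>\<^bsub>UP R\<^esub> \<longrightarrow> accept_prob R zero_test (input_tree R C) (poly p (length C + m)) = 1) \<and>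
      (circuit_poly R C \<noteq> \<zero>\<^bsub>UP R\<^esub> \<longrightarrow> accept_prob R zero_test (input_tree R C) (poly p (length C + m)) \<le> 1 / 3)"
    if R: "ring_by_oracle R m" and C: "circuit R C" for R :: "bool list ring" and m and C :: "bool list gate list"
  proof -
    define n where "n = length C + m"
    define w where "w = n + 2"
    define K where "K = w + w ^ 4"
    define S where "S = poly Sp n"
    define T where "T = poly p n"
    define inp where "inp = input_tree R C"
    have cr: "cring R" and fin: "finite (carrier R)" using R by (simp_all add: ring_by_oracle_def)
    interpret UP_cring R "UP R" using UP_cring_UP[OF cr] by simp_all
    have S: "S = n * (K * (2 * n + 1) + 1) + K * (2 * n + 1) + (4 * n + 3 + n * (2 * n + 7))"
      by (simp add: S_def Sp_def Kp_def K_def w_def algebra_simps)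
    have T: "T = cost S zero_test + S" by (simp add: T_def p_def poly_pcompose q S_def)
    have Km: "K * (2 * m + 1) \<le> K * (2 * n + 1)" by (simp add: n_def)
    have CS: "length C * (2 * (length C + m) + 7) \<le> n * (2 * n + 7)"
      unfolding n_def by (intro mult_le_mono) auto
    interpret zero_test_run R m K S C w
    proof
      show "ring_by_oracle R m" "circuit R C" by (fact R C)+
      show "K > 0" "w + w ^ 4 \<le> K" by (simp_all add: K_def w_def)
      show "w = length C + m + 2" by (simp add: w_def n_def)
      show "K * (2 * m + 1) \<le> S" using Km unfolding S by linarith
      have "length C * (K * (2 * m + 1) + 1) \<le> n * (K * (2 * n + 1) + 1)"
        using Km by (intro mult_le_mono) (auto simp: n_def)
      then show "length C * (K * (2 * m + 1) + 1) \<le> S" unfolding S by linarith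
      show "size (tree_of_list (map tree_of_gate C)) \<le> S"
        using size_input_tree(1)[OF R C] CS unfolding S by linarith
      have "4 * m \<le> 4 * n" by (simp add: n_def)
      then show "size (input_tree R C) \<le> S"
        using size_input_tree(2)[OF R C] CS unfolding S by linarith
    qed
    have wT: "w \<le> T" using w_le T by simp
    have run: "\<exists>t s' r'. exec R zero_test (initial_state inp, r) t (s', r') \<and> t \<le> T \<and>
        (s' 0 \<noteq> Leaf \<longleftrightarrow> (\<forall>i<w ^ 4. passes (rev (take w r)) i))" if "length r = T" for r
      using runs_zero_test[of r] wT that unfolding runs_def inp_def T by fastforce
    have halts: "halts_within R zero_test inp T"
      unfolding halts_within_def using run by blast
    define Acc where "Acc = {r. \<exists>t s' r'. exec R zero_test (initial_state inp, r) t (s', r') \<and> s' 0 \<noteq> Leaf}"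
    \<comment> \<open>Acceptance asks for some accepting run; determinism identifies it with the run
      just constructed.\<close>
    have Acc: "r \<in> Acc \<longleftrightarrow> (\<forall>i<w ^ 4. passes (rev (take w r)) i)" if len: "length r = T" for r
    proof -
      obtain t s' r' where *: "exec R zero_test (initial_state inp, r) t (s', r')"
        "s' 0 \<noteq> Leaf \<longleftrightarrow> (\<forall>i<w ^ 4. passes (rev (take w r)) i)" using run[OF len] by blast
      have "r \<in> Acc \<longleftrightarrow> s' 0 \<noteq> Leaf"
      proof
        assume "r \<in> Acc"
        then obtain u s'' r'' where "exec R zero_test (initial_state inp, r) u (s'', r'')" "s'' 0 \<noteq> Leaf"
          unfolding Acc_def by blast
        then show "s' 0 \<noteq> Leaf" using exec_deterministic[OF *(1)] by blast
      next
        assume "s' 0 \<noteq> Leaf"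
        then show "r \<in> Acc" using *(1) unfolding Acc_def by blast
      qed
      then show ?thesis using * by blast
    qed
    let ?\<Omega> = "{r :: bool list. length r = T}"
    have ne: "?\<Omega> \<noteq> {}" using Ex_list_of_length[of T] by auto
    have prob: "accept_prob R zero_test inp T = card (?\<Omega> \<inter> Acc) / 2 ^ T"
      unfolding accept_prob_def Acc_def[symmetric]
      by (subst measure_pmf_of_set[OF ne card_bool_lists(2)]) (simp add: card_bool_lists)
    have point: "set (point R i es) \<subseteq> carrier R" for i es by (auto simp: point_def)
    have "accept_prob R zero_test inp T = 1" if zero: "circuit_poly R C = \<zero>\<^bsub>UP R\<^esub>"
    proof -
      have "passes es i" if "length es = w" for es i
      proof -
        have "length (point R i es) = i + length es" by (simp add: point_def)
        moreover from this have "point R i es \<noteq> []" using that w by auto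
        ultimately show ?thesis
          unfolding passes_def using circuit_zero_complete[OF C point _ zero, of i es] by simp
      qed
      then have "r \<in> Acc" if "length r = T" for r
        unfolding Acc[OF that] using that wT by simp
      then have "?\<Omega> \<inter> Acc = ?\<Omega>" by auto
      then show ?thesis by (simp add: prob card_bool_lists)
    qed
    moreover have "accept_prob R zero_test inp T \<le> 1 / 3" if nonzero: "circuit_poly R C \<noteq> \<zero>\<^bsub>UP R\<^esub>"
    proof -
      have w2: "w \<ge> 2" by (simp add: w_def)
      \<comment> \<open>The choice b = w^3 works because w exceeds m.\<close>
      have "m * w * w \<le> w ^ 3"
        unfolding power3_eq_cube using w by (intro mult_le_mono1) simp
      moreover have "w ^ 3 \<ge> 2 ^ 3" using w2 by (rule power_mono) simp
      then have "w ^ 3 \<ge> 3" by simp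
      moreover have "card (carrier R) \<le> 2 ^ m"
        using card_mono[OF card_bool_lists(2)[of m], of "carrier R"] R
        by (simp add: ring_by_oracle_def card_bool_lists)
      ultimately obtain \<kappa> where \<kappa>: "w \<le> \<kappa>" "\<kappa> \<le> 2 * w ^ 3 + 1"
        and card: "card {es. length es = w \<and>
          last (circuit_vals R (point R (\<kappa> - w) es) C) = replicate \<kappa> \<zero>\<^bsub>R\<^esub>} \<le> 2 ^ length C"
        using circuit_nonzero_sound[OF fin _ C nonzero, of m w "w ^ 3"] w2 by auto
      define B where "B = {es. length es = w \<and> passes es (\<kappa> - w)}"
      have cardB: "card B \<le> 2 ^ length C"
        using card \<kappa> by (simp add: B_def passes_def cong: conj_cong)
      \<comment> \<open>The good value \<kappa> of r is at most 2 w^3 + 1, so its offset \<kappa> -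
        w is among the w^4 offsets tried; subtracting w \<ge> 2 absorbs the 1.\<close>
      have "2 * w ^ 3 \<le> w * w ^ 3" using w2 by (rule mult_le_mono1)
      then have "2 * w ^ 3 \<le> w ^ 4" by (simp add: power_numeral_reduce)
      then have lt: "\<kappa> - w < w ^ 4" using \<kappa> w2 by linarith
      have "?\<Omega> \<inter> Acc \<subseteq> {r. length r = T \<and> rev (take w r) \<in> B}"
        using Acc lt wT by (auto simp: B_def)
      moreover have "finite {r. length r = T \<and> rev (take w r) \<in> B}"
        by (rule finite_subset[OF _ card_bool_lists(2)[of T]]) auto
      ultimately have "card (?\<Omega> \<inter> Acc) \<le> card {r. length r = T \<and> rev (take w r) \<in> B}"
        by (intro card_mono)
      also have "\<dots> \<le> card B * 2 ^ (T - w)" using wT by (intro card_prefix_in_le) (simp_all add: B_def)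
      also have "\<dots> \<le> 2 ^ length C * 2 ^ (T - w)" using cardB by (rule mult_le_mono1)
      \<comment> \<open>The factor 4 is the two coins by which w exceeds s + m.\<close>
      finally have "4 * card (?\<Omega> \<inter> Acc) \<le> 2 ^ 2 * (2 ^ length C * 2 ^ (T - w))" by simp
      also have "\<dots> = 2 ^ (2 + length C + (T - w))" by (simp add: power_add)
      also have "\<dots> \<le> 2 ^ T" using w wT by (intro power_increasing) auto
      finally have "4 * card (?\<Omega> \<inter> Acc) \<le> 2 ^ T" .
      then have "real (4 * card (?\<Omega> \<inter> Acc)) \<le> real (2 ^ T)" by (rule of_nat_mono)
      then have "real (card (?\<Omega> \<inter> Acc)) / 2 ^ T \<le> 1 / 4" by (simp add: divide_simps)
      then show ?thesis unfolding prob by linarith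
    qed
    ultimately show ?thesis using halts unfolding T_def inp_def n_def by blast
  qed
  show ?thesis
    unfolding Let_def by (intro exI[of _ zero_test] exI[of _ p] allI impI main)
qed

end
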